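(* Let $M\ge1$ be an integer, $m,\alpha,\beta\in\mathbb{R}$, $\kappa>0$ and $1<p<\infty$. If $\alpha<\frac{M+m}p<M-\beta$, then the family of operators $\left(S^{\alpha,\beta}(t)\right)_{t>0}$ is $\mathcal R$-bounded on $L^p_m=L^p(\mathbb{R}^M,|y|^m\,dy)$.
   Context: For $t>0$, $$S^{\alpha,\beta}(t)f(y)=t^{-\frac M2}\Big(\frac{|y|}{\sqrt t}\wedge1\Big)^{-\alpha}\int_{\mathbb{R}^M}\Big(\frac{|z|}{\sqrt t}\wedge1\Big)^{-\beta}\exp\Big(-\frac{|y-z|^2}{\kappa t}\Big)f(z)\,dz,$$ where $a\wedge b=\min\{a,b\}$ and $\kappa>0$ is a fixed constant. A set $\mathcal S$ of bounded linear operators on a Banach space $X$ is $\mathcal R$-bounded if there is a constant $C$ such that $\|\sum_i\varepsilon_iS_ix_i\|_{L^p(\Omega;X)}\le C\|\sum_i\varepsilon_ix_i\|_{L^p(\Omega;X)}$ for all finite families $(x_i)\subset X$, $(S_i)\subset\mathcal S$, where $\varepsilon_i:\Omega\to\{-1,1\}$ are independent symmetric random variables on a probability space $\Omega$ (the notion is independent of $1\le p<\infty$). For $X$ an $L^p$ space, $1<p<\infty$, this is equivalent to the square function estimate $\|(\sum_i|S_if_i|^2)^{1/2}\|_{X}\le C\|(\sum_i|f_i|^2)^{1/2}\|_{X}$ for all finite families. *)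

theory Defs
  imports "HOL-Probability.Probability"
begin

(* Elements of L^p(mu) are represented by functions; the space itself is the quotient by
   a.e. equality.  Accordingly operators are only required to be linear up to null sets. *)

definition Lp_space :: "'a measure \<Rightarrow> real \<Rightarrow> ('a \<Rightarrow> 'b::real_normed_vector) set" where
  "Lp_space \<mu> p = {f \<in> borel_measurable \<mu>. integrable \<mu> (\<lambda>x. norm (f x) powr p)}"

definition Lp_norm :: "'a measure \<Rightarrow> real \<Rightarrow> ('a \<Rightarrow> 'b::real_normed_vector) \<Rightarrow> real" where
  "Lp_norm \<mu> p f = (\<integral>x. norm (f x) powr p \<partial>\<mu>) powr (1 / p)"

definition bounded_linear_Lp ::
  "'a measure \<Rightarrow> real \<Rightarrow> (('a \<Rightarrow> 'k::real_normed_field) \<Rightarrow> 'a \<Rightarrow> 'k) \<Rightarrow> bool" where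
  "bounded_linear_Lp \<mu> p T \<longleftrightarrow>
     (\<forall>f\<in>Lp_space \<mu> p. T f \<in> Lp_space \<mu> p) \<and>
     (\<forall>f\<in>Lp_space \<mu> p. \<forall>g\<in>Lp_space \<mu> p.
        AE x in \<mu>. T (\<lambda>y. f y + g y) x = T f x + T g x) \<and>
     (\<forall>c. \<forall>f\<in>Lp_space \<mu> p. AE x in \<mu>. T (\<lambda>y. c * f y) x = c * T f x) \<and>
     (\<exists>C. \<forall>f\<in>Lp_space \<mu> p. Lp_norm \<mu> p (T f) \<le> C * Lp_norm \<mu> p f)"

definition rademacher_sequence :: "'w measure \<Rightarrow> (nat \<Rightarrow> 'w \<Rightarrow> real) \<Rightarrow> bool" where
  "rademacher_sequence \<Omega> \<epsilon> \<longleftrightarrow>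
     prob_space \<Omega> \<and>
     prob_space.indep_vars \<Omega> (\<lambda>_. borel) \<epsilon> UNIV \<and>
     (\<forall>i. \<epsilon> i \<in> space \<Omega> \<rightarrow> {-1, 1}) \<and>
     (\<forall>i. measure \<Omega> {\<omega> \<in> space \<Omega>. \<epsilon> i \<omega> = 1} = 1 / 2) \<and>
     (\<forall>i. measure \<Omega> {\<omega> \<in> space \<Omega>. \<epsilon> i \<omega> = - 1} = 1 / 2)"

(* R-boundedness on X = L^p(mu), the Rademacher averages being measured in L^q(Omega; X).
   The norm of F in L^q(Omega; X) is the L^q(Omega) norm of omega |-> ||F omega||_X. *)
definition R_bounded_Lp ::
  "'w measure \<Rightarrow> (nat \<Rightarrow> 'w \<Rightarrow> real) \<Rightarrow> real \<Rightarrow> 'a measure \<Rightarrow> real \<Rightarrow>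
   (('a \<Rightarrow> 'k::real_normed_field) \<Rightarrow> 'a \<Rightarrow> 'k) set \<Rightarrow> bool" where
  "R_bounded_Lp \<Omega> \<epsilon> q \<mu> p \<S> \<longleftrightarrow>
     (\<forall>T\<in>\<S>. bounded_linear_Lp \<mu> p T) \<and>
     (\<exists>C. \<forall>(n::nat) T f. (\<forall>i<n. T i \<in> \<S>) \<and> (\<forall>i<n. f i \<in> Lp_space \<mu> p) \<longrightarrow>
        Lp_norm \<Omega> q (\<lambda>\<omega>. Lp_norm \<mu> p (\<lambda>x. \<Sum>i<n. \<epsilon> i \<omega> *\<^sub>R T i (f i) x))
        \<le> C * Lp_norm \<Omega> q (\<lambda>\<omega>. Lp_norm \<mu> p (\<lambda>x. \<Sum>i<n. \<epsilon> i \<omega> *\<^sub>R f i x)))"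

(* |y|^m dy on R^M, M = CARD('n).  Here and below, 0 powr r = 0 only matters at the origin,
   a null set. *)
definition weighted_lborel :: "real \<Rightarrow> (real ^ 'n) measure" where
  "weighted_lborel m = density lborel (\<lambda>y. ennreal (norm y powr m))"

definition S_integrand ::
  "real \<Rightarrow> real \<Rightarrow> real \<Rightarrow> (real ^ 'n \<Rightarrow> 'k::real_normed_field) \<Rightarrow> real ^ 'n \<Rightarrow> real ^ 'n \<Rightarrow> 'k" where
  "S_integrand \<kappa> \<beta> t f y z =
     (min (norm z / sqrt t) 1 powr (- \<beta>) * exp (- ((norm (y - z))\<^sup>2 / (\<kappa> * t)))) *\<^sub>R f z"

definition S_op ::
  "real \<Rightarrow> real \<Rightarrow> real \<Rightarrow> real \<Rightarrow>
   (real ^ 'n \<Rightarrow> 'k::{real_normed_field, euclidean_space}) \<Rightarrow> real ^ 'n \<Rightarrow> 'k" where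
  "S_op \<kappa> \<alpha> \<beta> t f y =
     (t powr (- (real CARD('n) / 2)) * min (norm y / sqrt t) 1 powr (- \<alpha>)) *\<^sub>R
       (\<integral>z. S_integrand \<kappa> \<beta> t f y z \<partial>lborel)"

end

theory Submission
  imports Defs
begin

text \<open>
  By Khintchine's inequalities, R-boundedness reduces to a square function estimate. Conjugating
  with the weight turns the problem into an unweighted one, with $f$ replaced by
  $g = |z|^{m/p} |f|$. The conjugated kernel of $S^{\alpha,\beta}(t)$ is dominated, uniformly in
  $t = s^2$, by the kernel $s^{-M} e^{-|y-z|/s}$ (relevant for $|y| \sim |z|$, $|y| \ge s$) plus two
  Hardy kernels that are homogeneous of degree $-M$ and independent of $t$. The two inequalities
  on $\alpha, \beta$ are exactly what Schur's test with power weights needs for the Hardy kernels,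
  and a single positive operator satisfies the square function estimate by Minkowski's inequality.

  For the averages $E_s$ with kernel $s^{-M} e^{-|y-z|/s}$ and $p > 2$ one has
  $(E_s g)^2 \le c E_s(g^2)$, so that it suffices to bound the $L^r$-norm of $\sum_i E_{s_i} h_i$ by
  that of $\sum_i h_i$ for $h_i \ge 0$, $r = p/2$. This is an analogue of Doob's dual inequality
  and avoids maximal functions:
  $(\sum_i a_i)^r \le r \sum_i a_i (\sum_{s_j \ge s_i} a_j)^{r-1}$, and the tail sums, after passing to
  the scales $r s_j$, vary so slowly on the scale $s_i$ that $E_{s_i}$ can be moved across. The case
  $p < 2$ follows by duality.
\<close>

section \<open>Elementary inequalities and radial integrals\<close>

text \<open>The exponential kernel takes the place of the Gaussian because it satisfies a Harnack
  inequality: moving its centre by x costs only the factor exp(|x| / s). After passing to the scales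
  \<open>r * s j\<close> this factor is at most exp(|x| / (r s)) with s = \<open>s i\<close>, and
  its power r - 1 leaves exp(-|x| / (r s)) of the kernel of width s, which is still integrable. The
  price is that an estimate at the scales \<open>s i\<close> returns the scales
  \<open>r * s i\<close>; a supremum over all powers of r closes the circle. With \<gamma> = m / p
  the hypotheses read \<beta> + \<gamma> < M - M / p and \<alpha> - \<gamma> < M / p, one for each
  Hardy kernel. Their sum \<alpha> + \<beta> < M makes the kernel bound work near the origin. The
  Rademacher averages are measured in L^q with q unrelated to p, so Fubini cannot be combined with
  Khintchine's inequality directly. The upper estimate therefore passes to a common larger exponent
  through a weighted Hoelder inequality, and the lower one uses only the first moment.\<close>

lemma powr_add_le:
  fixes a b p :: real
  assumes "0 \<le> a" "0 \<le> b" "0 \<le> p"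
  shows "(a + b) powr p \<le> 2 powr p * (a powr p + b powr p)"
proof -
  have "(a + b) powr p \<le> (2 * max a b) powr p"
    using assms by (intro powr_mono2) auto
  also have "\<dots> = 2 powr p * max a b powr p"
    using assms by (simp add: powr_mult)
  also have "max a b powr p \<le> a powr p + b powr p"
    by (auto simp: max_def)
  finally show ?thesis by simp
qed

text \<open>This is u \<le> exp u at u = x / r, raised to the power r. It lets exponential decay
  absorb polynomial growth, and later bounds moments by exponential moments.\<close>

lemma powr_le_exp:
  fixes x r :: real
  assumes "0 \<le> x" "0 < r"
  shows "x powr r \<le> r powr r * exp x"
proof -
  have "x / r \<le> exp (x / r)"
    using exp_ge_add_one_self[of "x / r"] by linarith
  then have "(x / r) powr r \<le> exp (x / r) powr r"
    using assms by (intro powr_mono2) auto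
  also have "\<dots> = exp x" using assms by (simp add: exp_powr_real)
  finally show ?thesis using assms by (simp add: powr_divide field_simps)
qed

text \<open>Young's inequality for the normalised functions \<open>f / A powr (1 / p)\<close> and
  \<open>g / B powr (1 / q)\<close>. Real upper bounds stand in for the two integrals, so that real
  powers can be taken without separate finiteness arguments. The normalisation fails if a bound is
  0; then the product vanishes almost everywhere.\<close>

lemma nn_integral_Holder:
  fixes f g :: "'a \<Rightarrow> real"
  assumes [measurable]: "f \<in> borel_measurable M" "g \<in> borel_measurable M"
    and nn: "\<And>x. 0 \<le> f x" "\<And>x. 0 \<le> g x"
    and pq: "1 < p" "1 < q" "1 / p + 1 / q = 1"
    and AB: "0 \<le> A" "0 \<le> B"
    and fA: "(\<integral>\<^sup>+x. ennreal (f x powr p) \<partial>M) \<le> ennreal A"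
    and gB: "(\<integral>\<^sup>+x. ennreal (g x powr q) \<partial>M) \<le> ennreal B"
  shows "(\<integral>\<^sup>+x. ennreal (f x * g x) \<partial>M) \<le> ennreal (A powr (1 / p) * B powr (1 / q))"
proof (cases "A = 0 \<or> B = 0")
  case True
  then have "AE x in M. f x * g x = 0"
  proof
    assume "A = 0"
    then have "AE x in M. ennreal (f x powr p) = 0"
      using fA by (subst nn_integral_0_iff_AE[symmetric]) auto
    then show ?thesis by eventually_elim (auto simp: ennreal_eq_0_iff)
  next
    assume "B = 0"
    then have "AE x in M. ennreal (g x powr q) = 0"
      using gB by (subst nn_integral_0_iff_AE[symmetric]) auto
    then show ?thesis by eventually_elim (auto simp: ennreal_eq_0_iff)
  qed
  then have "(\<integral>\<^sup>+x. ennreal (f x * g x) \<partial>M) = 0"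
    by (subst nn_integral_0_iff_AE) (auto elim: eventually_mono)
  then show ?thesis by simp
next
  case False
  then have pos: "A > 0" "B > 0" using AB by auto
  define a b where "a = A powr (1 / p)" and "b = B powr (1 / q)"
  have ab: "a > 0" "b > 0" "a powr p = A" "b powr q = B"
    using pos pq by (auto simp: a_def b_def powr_powr)
  have le: "f x * g x \<le> (a * b / (p * A)) * f x powr p + (a * b / (q * B)) * g x powr q" for x
  proof -
    have "(f x / a) * (g x / b) \<le> (f x / a) powr p / p + (g x / b) powr q / q"
      using nn ab pq by (intro Youngs_inequality) auto
    also have "\<dots> = f x powr p / (p * A) + g x powr q / (q * B)"
      using nn ab pq by (simp add: powr_divide mult.commute)
    finally have "(a * b) * ((f x / a) * (g x / b)) \<le> (a * b) * (f x powr p / (p * A) + g x powr q / (q * B))"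
      using ab by (intro mult_left_mono) auto
    then show ?thesis using ab by (simp add: algebra_simps)
  qed
  have "(\<integral>\<^sup>+x. ennreal (f x * g x) \<partial>M) \<le>
      (\<integral>\<^sup>+x. ennreal (a * b / (p * A)) * ennreal (f x powr p)
        + ennreal (a * b / (q * B)) * ennreal (g x powr q) \<partial>M)"
    using le ab pos pq by (intro nn_integral_mono) (simp flip: ennreal_mult' ennreal_plus)
  also have "\<dots> = ennreal (a * b / (p * A)) * (\<integral>\<^sup>+x. ennreal (f x powr p) \<partial>M)
        + ennreal (a * b / (q * B)) * (\<integral>\<^sup>+x. ennreal (g x powr q) \<partial>M)"
    by (simp add: nn_integral_add nn_integral_cmult)
  also have "\<dots> \<le> ennreal (a * b / (p * A)) * ennreal A + ennreal (a * b / (q * B)) * ennreal B"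
    using fA gB by (intro add_mono mult_left_mono) auto
  also have "\<dots> = ennreal (a * b / p + a * b / q)"
    using ab pos pq by (simp flip: ennreal_mult' ennreal_plus)
  also have "a * b / p + a * b / q = a * b" 
    using pq(3) by (metis (no_types, lifting) divide_inverse mult.right_neutral mult_1 distrib_left)
  finally show ?thesis by (simp add: a_def b_def)
qed

text \<open>A substitute for polar coordinates: \<open>g\<close> is dominated by the sum of
  \<open>c k\<close> times the indicator of the ball of radius \<open>R k\<close>, and the volumes
  of the balls are known.\<close>

lemma nn_integral_le_ball_sum:
  fixes g :: "'a::euclidean_space \<Rightarrow> real" and a :: 'a
  assumes cov: "\<And>x. g x \<le> 0 \<or> (\<exists>k. norm (x - a) \<le> R k \<and> g x \<le> c k)"
    and nn: "\<And>k. 0 \<le> c k" "\<And>k. 0 \<le> R k"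
    and S: "(\<lambda>k. c k * R k ^ DIM('a)) sums S"
  shows "(\<integral>\<^sup>+x. ennreal (g x) \<partial>lborel) \<le> ennreal (unit_ball_vol DIM('a) * S)"
proof -
  have "ennreal (g x) \<le> (\<Sum>k. ennreal (c k) * indicator (cball a (R k)) x)" for x
  proof -
    consider "g x \<le> 0" | k where "norm (x - a) \<le> R k" "g x \<le> c k" using cov by blast
    then show ?thesis
    proof cases
      case 1 then show ?thesis by (simp add: ennreal_neg)
    next
      case (2 k)
      then have "ennreal (g x) \<le> (\<Sum>k\<in>{k}. ennreal (c k) * indicator (cball a (R k)) x)"
        by (auto simp: dist_norm norm_minus_commute indicator_def intro: ennreal_leI)
      also have "\<dots> \<le> (\<Sum>k. ennreal (c k) * indicator (cball a (R k)) x)"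
        by (rule sum_le_suminf) auto
      finally show ?thesis .
    qed
  qed
  then have "(\<integral>\<^sup>+x. ennreal (g x) \<partial>lborel) \<le> (\<integral>\<^sup>+x. (\<Sum>k. ennreal (c k) * indicator (cball a (R k)) x) \<partial>lborel)"
    by (intro nn_integral_mono) auto
  also have "\<dots> = (\<Sum>k. \<integral>\<^sup>+x. ennreal (c k) * indicator (cball a (R k)) x \<partial>lborel)"
    by (intro nn_integral_suminf borel_measurable_times_ennreal borel_measurable_indicator) auto
  also have "\<dots> = (\<Sum>k. ennreal (unit_ball_vol DIM('a) * (c k * R k ^ DIM('a))))"
  proof (rule suminf_cong)
    fix k
    have "(\<integral>\<^sup>+x. ennreal (c k) * indicator (cball a (R k)) x \<partial>lborel) = ennreal (c k) * emeasure lborel (cball a (R k))"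
      by (rule nn_integral_cmult_indicator) simp
    then show "(\<integral>\<^sup>+x. ennreal (c k) * indicator (cball a (R k)) x \<partial>lborel)
        = ennreal (unit_ball_vol DIM('a) * (c k * R k ^ DIM('a)))"
      using nn by (simp add: emeasure_cball mult_ac flip: ennreal_mult')
  qed
  also have "\<dots> = ennreal (unit_ball_vol DIM('a) * S)"
    using nn sums_mult[OF S, of "unit_ball_vol DIM('a)"]
    by (intro suminf_ennreal_eq) auto
  finally show ?thesis .
qed

section \<open>Integrals of powers and exponentials of the norm, by layers\<close>

lemma obtain_dyadic:
  fixes x :: real
  assumes "1 \<le> x"
  obtains k :: nat where "2 ^ k \<le> x" "x \<le> 2 * 2 ^ k"
proof
  define k where "k = nat \<lfloor>log 2 x\<rfloor>"
  have "0 \<le> log 2 x" using assms by simp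
  then have k: "real k \<le> log 2 x" "log 2 x \<le> real k + 1" by (auto simp: k_def)
  show "2 ^ k \<le> x" using k(1) assms by (simp add: le_log_iff powr_realpow)
  show "x \<le> 2 * 2 ^ k" using k(2) assms by (simp add: log_le_iff powr_realpow powr_add)
qed

lemma powr_le_powr_comparable:
  fixes x y \<tau> :: real
  assumes "0 < y" "y \<le> 2 * x" "x \<le> 2 * y"
  shows "x powr \<tau> \<le> 2 powr \<bar>\<tau>\<bar> * y powr \<tau>"
proof -
  have xy: "x > 0" using assms by simp
  have "(x / y) powr \<tau> \<le> 2 powr \<bar>\<tau>\<bar>"
  proof (cases "\<tau> \<ge> 0")
    case True
    then show ?thesis using assms xy by (auto intro!: powr_mono2 simp: field_simps)
  next
    case False
    then have "(x / y) powr \<tau> = (y / x) powr \<bar>\<tau>\<bar>"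
      using assms xy by (simp add: powr_divide powr_minus_divide abs_if powr_minus field_simps)
    then show ?thesis using assms xy by (auto intro!: powr_mono2 simp: field_simps)
  qed
  then show ?thesis using assms xy by (simp add: powr_divide field_simps)
qed

text \<open>The balls of radius R / 2^k contribute multiples of (R / 2^k)^(D - \<tau>), a geometric
  series whose ratio is below 1 because \<tau> < D.\<close>

lemma nn_integral_norm_powr_cball:
  fixes \<tau> :: real
  assumes "\<tau> < real DIM('a::euclidean_space)"
  obtains C where "0 \<le> C"
    "\<And>R. 0 < R \<Longrightarrow> (\<integral>\<^sup>+z. ennreal (norm (z::'a) powr (- \<tau>) * indicator (cball 0 R) z) \<partial>lborel)
        \<le> ennreal (C * R powr (DIM('a) - \<tau>))"
proof
  define D where "D = real DIM('a)"
  define q where "q = (1/2) powr (D - \<tau>)"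
  have q: "0 < q" "q < 1" using assms powr_less_mono'[of "1/2" 0 "D - \<tau>"] by (auto simp: q_def D_def)
  define C where "C = unit_ball_vol DIM('a) * (2 powr \<bar>\<tau>\<bar> * (1 / (1 - q)))"
  show "0 \<le> C" using q by (simp add: C_def)
  fix R :: real assume R: "0 < R"
  define Rk where "Rk k = R / 2 ^ k" for k :: nat
  define c where "c k = 2 powr \<bar>\<tau>\<bar> * Rk k powr (- \<tau>)" for k
  have Rk: "Rk k > 0" for k using R by (simp add: Rk_def)
  have "(\<integral>\<^sup>+z. ennreal (norm (z::'a) powr (- \<tau>) * indicator (cball 0 R) z) \<partial>lborel)
      \<le> ennreal (unit_ball_vol DIM('a) * (2 powr \<bar>\<tau>\<bar> * R powr (D - \<tau>) * (1 / (1 - q))))"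
  proof (rule nn_integral_le_ball_sum[where R = Rk and c = c and a = 0])
    fix z :: 'a
    show "norm z powr (- \<tau>) * indicator (cball 0 R) z \<le> 0 \<or>
        (\<exists>k. norm (z - 0) \<le> Rk k \<and> norm z powr (- \<tau>) * indicator (cball 0 R) z \<le> c k)"
    \<comment> \<open>At the origin the integrand is 0, since \<open>0 powr\<close> any exponent is
      0; no covering ball has to be found there.\<close>
    proof (cases "z = 0 \<or> norm z > R")
      case True then show ?thesis by auto
    next
      case False
      then have z: "0 < norm z" "norm z \<le> R" by auto
      then have "1 \<le> R / norm z" by simp
      then obtain k where k: "2 ^ k \<le> R / norm z" "R / norm z \<le> 2 * 2 ^ k" by (rule obtain_dyadic)
      have 1: "norm z \<le> Rk k" "Rk k \<le> 2 * norm z" using k z by (auto simp: Rk_def field_simps)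
      have "norm z powr (- \<tau>) \<le> 2 powr \<bar>- \<tau>\<bar> * Rk k powr (- \<tau>)"
        using 1 z Rk[of k] by (intro powr_le_powr_comparable) auto
      then show ?thesis using 1 z by (auto simp: c_def intro!: exI[of _ k])
    qed
  next
    have "(\<lambda>k. 2 powr \<bar>\<tau>\<bar> * R powr (D - \<tau>) * q ^ k) sums (2 powr \<bar>\<tau>\<bar> * R powr (D - \<tau>) * (1 / (1 - q)))"
      using q by (intro sums_mult geometric_sums) auto
    moreover have "c k * Rk k ^ DIM('a) = 2 powr \<bar>\<tau>\<bar> * R powr (D - \<tau>) * q ^ k" for k
    proof -
      have "c k * Rk k ^ DIM('a) = 2 powr \<bar>\<tau>\<bar> * Rk k powr (D - \<tau>)"
        using Rk[of k] by (simp add: c_def D_def powr_diff powr_minus powr_realpow field_simps)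
      also have "Rk k powr (D - \<tau>) = (R * (1/2) powr k) powr (D - \<tau>)"
        by (simp add: Rk_def powr_realpow field_simps)
      also have "(R * (1/2) powr k) powr (D - \<tau>) = R powr (D - \<tau>) * (1/2) powr ((D - \<tau>) * k)"
        using R by (simp only: powr_mult powr_powr) (simp add: mult.commute)
      also have "(1/2) powr ((D - \<tau>) * k) = q ^ k"
        by (simp add: q_def powr_powr flip: powr_realpow)
      finally show ?thesis by simp
    qed
    ultimately show "(\<lambda>k. c k * Rk k ^ DIM('a)) sums (2 powr \<bar>\<tau>\<bar> * R powr (D - \<tau>) * (1 / (1 - q)))"
      by simp
  qed (use Rk in \<open>auto simp: c_def less_imp_le\<close>)
  then show "(\<integral>\<^sup>+z. ennreal (norm (z::'a) powr (- \<tau>) * indicator (cball 0 R) z) \<partial>lborel)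
        \<le> ennreal (C * R powr (DIM('a) - \<tau>))"
    by (simp add: C_def D_def mult_ac)
qed

text \<open>The same argument with growing radii. The shell between R 2^k and 2 R 2^k lies in the
  ball of radius \<open>2 * Rk k\<close>, whence the factor 2^D, and the series converges because D
  < \<tau>.\<close>

lemma nn_integral_norm_powr_outside:
  fixes \<tau> :: real
  assumes "real DIM('a::euclidean_space) < \<tau>"
  obtains C where "0 \<le> C"
    "\<And>R. 0 < R \<Longrightarrow> (\<integral>\<^sup>+z. ennreal (norm (z::'a) powr (- \<tau>) * indicator {z. R \<le> norm z} z) \<partial>lborel)
        \<le> ennreal (C * R powr (DIM('a) - \<tau>))"
proof
  define D where "D = real DIM('a)"
  define q where "q = 2 powr (D - \<tau>)"
  have q: "0 < q" "q < 1" using assms powr_less_mono[of "D - \<tau>" 0 2] by (auto simp: q_def D_def)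
  define C where "C = unit_ball_vol DIM('a) * (2 powr \<bar>\<tau>\<bar> * 2 powr D * (1 / (1 - q)))"
  show "0 \<le> C" using q by (simp add: C_def)
  fix R :: real assume R: "0 < R"
  define Rk where "Rk k = R * 2 ^ k" for k :: nat
  define c where "c k = 2 powr \<bar>\<tau>\<bar> * Rk k powr (- \<tau>)" for k
  have Rk: "Rk k > 0" for k using R by (simp add: Rk_def)
  have "(\<integral>\<^sup>+z. ennreal (norm (z::'a) powr (- \<tau>) * indicator {z. R \<le> norm z} z) \<partial>lborel)
      \<le> ennreal (unit_ball_vol DIM('a) * (2 powr \<bar>\<tau>\<bar> * 2 powr D * R powr (D - \<tau>) * (1 / (1 - q))))"
  proof (rule nn_integral_le_ball_sum[where R = "\<lambda>k. 2 * Rk k" and c = c and a = 0])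
    fix z :: 'a
    show "norm z powr (- \<tau>) * indicator {z. R \<le> norm z} z \<le> 0 \<or>
        (\<exists>k. norm (z - 0) \<le> 2 * Rk k \<and> norm z powr (- \<tau>) * indicator {z. R \<le> norm z} z \<le> c k)"
    proof (cases "norm z < R")
      case True then show ?thesis by auto
    next
      case False
      then have z: "0 < norm z" "R \<le> norm z" using R by auto
      then have "1 \<le> norm z / R" using R by simp
      then obtain k where k: "2 ^ k \<le> norm z / R" "norm z / R \<le> 2 * 2 ^ k" by (rule obtain_dyadic)
      have 1: "Rk k \<le> norm z" "norm z \<le> 2 * Rk k" using k R by (auto simp: Rk_def field_simps)
      have "norm z powr (- \<tau>) \<le> 2 powr \<bar>- \<tau>\<bar> * Rk k powr (- \<tau>)"
        using 1 z Rk[of k] by (intro powr_le_powr_comparable) auto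
      then show ?thesis using 1 z by (auto simp: c_def intro!: exI[of _ k])
    qed
  next
    have "(\<lambda>k. 2 powr \<bar>\<tau>\<bar> * 2 powr D * R powr (D - \<tau>) * q ^ k) sums (2 powr \<bar>\<tau>\<bar> * 2 powr D * R powr (D - \<tau>) * (1 / (1 - q)))"
      using q by (intro sums_mult geometric_sums) auto
    moreover have "c k * (2 * Rk k) ^ DIM('a) = 2 powr \<bar>\<tau>\<bar> * 2 powr D * R powr (D - \<tau>) * q ^ k" for k
    proof -
      have "c k * (2 * Rk k) ^ DIM('a) = 2 powr \<bar>\<tau>\<bar> * 2 powr D * Rk k powr (D - \<tau>)"
        using Rk[of k] by (simp add: c_def D_def powr_diff powr_minus powr_realpow field_simps)
      also have "Rk k powr (D - \<tau>) = (R * 2 powr k) powr (D - \<tau>)"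
        by (simp add: Rk_def powr_realpow field_simps)
      also have "(R * 2 powr k) powr (D - \<tau>) = R powr (D - \<tau>) * 2 powr ((D - \<tau>) * k)"
        using R by (simp only: powr_mult powr_powr) (simp add: mult.commute)
      also have "2 powr ((D - \<tau>) * k) = q ^ k"
        by (simp add: q_def powr_powr flip: powr_realpow)
      finally show ?thesis by simp
    qed
    ultimately show "(\<lambda>k. c k * (2 * Rk k) ^ DIM('a)) sums (2 powr \<bar>\<tau>\<bar> * 2 powr D * R powr (D - \<tau>) * (1 / (1 - q)))"
      by simp
  qed (use Rk in \<open>auto simp: c_def less_imp_le\<close>)
  also have "unit_ball_vol DIM('a) * (2 powr \<bar>\<tau>\<bar> * 2 powr D * R powr (D - \<tau>) * (1 / (1 - q))) = C * R powr (DIM('a) - \<tau>)"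
    by (simp add: C_def D_def mult_ac)
  finally show "(\<integral>\<^sup>+z. ennreal (norm (z::'a) powr (- \<tau>) * indicator {z. R \<le> norm z} z) \<partial>lborel)
        \<le> ennreal (C * R powr (DIM('a) - \<tau>))" .
qed

text \<open>The layer where |z - y| / s lies between k and k + 1 is covered by the ball of radius (k
  + 1) s, and the integrand is at most exp(-k) there.\<close>

lemma nn_integral_exp_norm:
  obtains C where "0 < C"
    "\<And>s y. 0 < s \<Longrightarrow> (\<integral>\<^sup>+z. ennreal (exp (- (norm (z - (y::'a::euclidean_space)) / s))) \<partial>lborel) \<le> ennreal (C * s ^ DIM('a))"
proof
  define D where "D = DIM('a)"
  define S where "S = (\<Sum>k. exp (- real k) * (real k + 1) ^ D)"
  \<comment> \<open>Half of the exponential decay absorbs the polynomial factor, the other half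
    leaves a geometric series.\<close>
  have le: "exp (- real k) * (real k + 1) ^ D \<le> (2 ^ D * D powr D * exp (1/2)) * exp (- 1 / 2) ^ k" for k
  proof -
    have "((real k + 1) / 2) powr D \<le> D powr D * exp ((real k + 1) / 2)"
      by (intro powr_le_exp) (auto simp: D_def)
    then have "(real k + 1) ^ D \<le> 2 ^ D * (D powr D * exp ((real k + 1) / 2))"
      by (simp add: powr_realpow power_divide field_simps)
    then have "exp (- real k) * (real k + 1) ^ D \<le> exp (- real k) * (2 ^ D * (D powr D * exp ((real k + 1) / 2)))"
      by (intro mult_left_mono) auto
    also have "\<dots> = (2 ^ D * D powr D) * (exp (- real k) * exp ((real k + 1) / 2))" by simp
    also have "exp (- real k) * exp ((real k + 1) / 2) = exp (1/2) * exp (-1/2) ^ k"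
      by (simp add: exp_of_nat_mult[symmetric] mult_exp_exp field_simps)
    finally show ?thesis by (simp add: mult_ac)
  qed
  have sm: "summable (\<lambda>k. exp (- real k) * (real k + 1) ^ D)"
    by (rule summable_comparison_test'[where N = 0, OF summable_mult[OF summable_geometric]])
      (use le in auto)
  define C where "C = unit_ball_vol DIM('a) * S"
  have "S > 0" unfolding S_def by (intro suminf_pos sm) auto
  then show "0 < C" by (simp add: C_def)
  fix s :: real and y :: 'a assume s: "0 < s"
  have "(\<integral>\<^sup>+z. ennreal (exp (- (norm (z - y) / s))) \<partial>lborel) \<le> ennreal (unit_ball_vol DIM('a) * (S * s ^ D))"
  proof (rule nn_integral_le_ball_sum[where R = "\<lambda>k. (real k + 1) * s" and c = "\<lambda>k. exp (- real k)" and a = y])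
    fix z
    define k where "k = nat \<lfloor>norm (z - y) / s\<rfloor>"
    have "real k \<le> norm (z - y) / s" "norm (z - y) / s \<le> real k + 1"
      using s by (auto simp: k_def)
    then have "norm (z - y) \<le> (real k + 1) * s \<and> exp (- (norm (z - y) / s)) \<le> exp (- real k)"
      using s by (auto simp: field_simps)
    then show "exp (- (norm (z - y) / s)) \<le> 0 \<or>
         (\<exists>k. norm (z - y) \<le> (real k + 1) * s \<and> exp (- (norm (z - y) / s)) \<le> exp (- real k))" by blast
  next
    have "(\<lambda>k. (exp (- real k) * (real k + 1) ^ D) * s ^ D) sums (S * s ^ D)"
      unfolding S_def by (intro sums_mult2 summable_sums sm)
    then show "(\<lambda>k. exp (- real k) * ((real k + 1) * s) ^ DIM('a)) sums (S * s ^ D)"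
      by (simp add: D_def power_mult_distrib mult_ac)
  qed (use s in auto)
  then show "(\<integral>\<^sup>+z. ennreal (exp (- (norm (z - y) / s))) \<partial>lborel) \<le> ennreal (C * s ^ DIM('a))"
    by (simp add: C_def D_def mult_ac)
qed

section \<open>Schur's test and Hardy kernels\<close>

text \<open>The hypotheses of Schur's test with a single weight: w^q is tested against the kernel
  and w^p against its transpose. They hold only almost everywhere because a power weight takes the
  default value 0 at the origin.\<close>

definition schur_bounded :: "'a measure \<Rightarrow> real \<Rightarrow> real \<Rightarrow> ('a \<Rightarrow> 'a \<Rightarrow> real) \<Rightarrow> bool" where
  "schur_bounded M p q H \<longleftrightarrow>
    (\<lambda>(y, z). H y z) \<in> borel_measurable (M \<Otimes>\<^sub>M M) \<and> (\<forall>y z. 0 \<le> H y z) \<and>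
    (\<exists>w C1 C2. w \<in> borel_measurable M \<and> (\<forall>x. 0 \<le> w x) \<and> (AE x in M. 0 < w x) \<and>
      0 \<le> (C1::real) \<and> 0 \<le> (C2::real) \<and>
      (AE y in M. (\<integral>\<^sup>+z. ennreal (H y z * w z powr q) \<partial>M) \<le> ennreal (C1 * w y powr q)) \<and>
      (AE z in M. (\<integral>\<^sup>+y. ennreal (H y z * w y powr p) \<partial>M) \<le> ennreal (C2 * w z powr p)))"

lemma schur_bounded_transpose:
  assumes "schur_bounded M q p H"
  shows "schur_bounded M p q (\<lambda>y z. H z y)"
proof -
  have "(\<lambda>x. (\<lambda>(y, z). H y z) (case x of (y, z) \<Rightarrow> (z, y))) \<in> borel_measurable (M \<Otimes>\<^sub>M M)"
    using assms unfolding schur_bounded_def by (intro measurable_compose[OF measurable_pair_swap']) auto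
  then show ?thesis
    using assms unfolding schur_bounded_def by (auto simp: case_prod_unfold)
qed

text \<open>Hoelder's inequality in z for the factorisation H f = (H^(1/q) w) (H^(1/p) f / w),
  followed by Fubini. The finiteness statement is not decoration: \<open>enn2real\<close> would turn
  an infinite integral into 0.\<close>

lemma (in sigma_finite_measure) schur_test:
  assumes H: "schur_bounded M p q H" and pq: "1 < p" "1 < q" "1 / p + 1 / q = 1"
  obtains C where "0 \<le> C"
    "\<And>f B. f \<in> borel_measurable M \<Longrightarrow> (\<And>x. 0 \<le> f x) \<Longrightarrow> 0 \<le> B
      \<Longrightarrow> (\<integral>\<^sup>+x. ennreal (f x powr p) \<partial>M) \<le> ennreal B
      \<Longrightarrow> (AE y in M. (\<integral>\<^sup>+z. ennreal (H y z * f z) \<partial>M) < \<infinity>)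
        \<and> (\<integral>\<^sup>+y. ennreal (enn2real (\<integral>\<^sup>+z. ennreal (H y z * f z) \<partial>M) powr p) \<partial>M) \<le> ennreal (C * B)"
proof -
  obtain w C1 C2 where [measurable]: "w \<in> borel_measurable M" and w0: "\<And>x. 0 \<le> w x"
    and wpos: "AE x in M. 0 < w x" and C12: "0 \<le> (C1::real)" "0 \<le> (C2::real)"
    and S1: "AE y in M. (\<integral>\<^sup>+z. ennreal (H y z * w z powr q) \<partial>M) \<le> ennreal (C1 * w y powr q)"
    and S2: "AE z in M. (\<integral>\<^sup>+y. ennreal (H y z * w y powr p) \<partial>M) \<le> ennreal (C2 * w z powr p)"
    using H unfolding schur_bounded_def by blast
  have mH[measurable]: "(\<lambda>(y, z). H y z) \<in> borel_measurable (M \<Otimes>\<^sub>M M)" and H0: "\<And>y z. 0 \<le> H y z"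
    using H unfolding schur_bounded_def by auto
  have slice1: "H y \<in> borel_measurable M" if "y \<in> space M" for y
    using measurable_compose[OF measurable_Pair1'[OF that, of M] mH] by simp
  have slice2: "(\<lambda>y. H y z) \<in> borel_measurable M" if "z \<in> space M" for z
    using measurable_compose[OF measurable_Pair2'[OF that, of M] mH] by simp
  interpret pair_sigma_finite M M by standard
  \<comment> \<open>The first factor is the p-th power of the \<open>C1 powr (1 / q)\<close> that
    Hoelder's inequality produces, the second comes from the transposed condition after
    Fubini.\<close>
  define C where "C = C1 powr (p / q) * C2"
  show ?thesis
  proof (rule that)
    show "0 \<le> C" using C12 by (simp add: C_def)
    fix f and B :: real
    assume [measurable]: "f \<in> borel_measurable M" and f0: "\<And>x. 0 \<le> f x" and B: "0 \<le> B"
      and fB: "(\<integral>\<^sup>+x. ennreal (f x powr p) \<partial>M) \<le> ennreal B"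
    \<comment> \<open>The p-th power of the second Hoelder factor. Its integral against w^p is at
      most \<open>C2 * B\<close>, which also makes it finite almost everywhere.\<close>
    define J where "J y = (\<integral>\<^sup>+z. ennreal (H y z * (f z / w z) powr p) \<partial>M)" for y
    have [measurable]: "J \<in> borel_measurable M"
      unfolding J_def by measurable
    have "(\<integral>\<^sup>+y. ennreal (w y powr p) * J y \<partial>M)
        = (\<integral>\<^sup>+y. \<integral>\<^sup>+z. ennreal (H y z * w y powr p * (f z / w z) powr p) \<partial>M \<partial>M)"
    proof (rule nn_integral_cong)
      fix y assume "y \<in> space M"
      note [measurable] = slice1[OF this]
      show "ennreal (w y powr p) * J y = (\<integral>\<^sup>+z. ennreal (H y z * w y powr p * (f z / w z) powr p) \<partial>M)"
        unfolding J_def using H0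
        by (subst nn_integral_cmult[symmetric]) (auto simp: mult_ac simp flip: ennreal_mult'')
    qed
    also have "\<dots> = (\<integral>\<^sup>+z. \<integral>\<^sup>+y. ennreal (H y z * w y powr p * (f z / w z) powr p) \<partial>M \<partial>M)"
      by (rule Fubini') measurable
    also have "\<dots> = (\<integral>\<^sup>+z. ennreal ((f z / w z) powr p) * (\<integral>\<^sup>+y. ennreal (H y z * w y powr p) \<partial>M) \<partial>M)"
    proof (rule nn_integral_cong)
      fix z assume "z \<in> space M"
      note [measurable] = slice2[OF this]
      show "(\<integral>\<^sup>+y. ennreal (H y z * w y powr p * (f z / w z) powr p) \<partial>M)
          = ennreal ((f z / w z) powr p) * (\<integral>\<^sup>+y. ennreal (H y z * w y powr p) \<partial>M)"
        using H0 by (subst nn_integral_cmult[symmetric]) (auto simp: mult_ac simp flip: ennreal_mult'')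
    qed
    also have "\<dots> \<le> (\<integral>\<^sup>+z. ennreal C2 * ennreal (f z powr p) \<partial>M)"
    proof (rule nn_integral_mono_AE)
      show "AE z in M. ennreal ((f z / w z) powr p) * (\<integral>\<^sup>+y. ennreal (H y z * w y powr p) \<partial>M)
          \<le> ennreal C2 * ennreal (f z powr p)"
        using S2 wpos
      proof eventually_elim
        case (elim z)
        have "ennreal ((f z / w z) powr p) * (\<integral>\<^sup>+y. ennreal (H y z * w y powr p) \<partial>M)
          \<le> ennreal ((f z / w z) powr p) * ennreal (C2 * w z powr p)"
          using elim by (intro mult_left_mono) auto
        also have "\<dots> = ennreal C2 * ennreal (f z powr p)"
          using elim C12 f0 by (simp add: powr_divide flip: ennreal_mult')
        finally show ?case .
      qed
    qed
    also have "\<dots> = ennreal C2 * (\<integral>\<^sup>+z. ennreal (f z powr p) \<partial>M)" by (simp add: nn_integral_cmult)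
    also have "\<dots> \<le> ennreal C2 * ennreal B" using fB by (intro mult_left_mono) auto
    finally have JB: "(\<integral>\<^sup>+y. ennreal (w y powr p) * J y \<partial>M) \<le> ennreal (C2 * B)"
      using C12 by (simp add: ennreal_mult')
    have "AE y in M. ennreal (w y powr p) * J y \<noteq> \<infinity>"
      by (rule nn_integral_PInf_AE) (use JB in \<open>auto simp: top_unique\<close>)
    then have Jfin: "AE y in M. J y < \<infinity>"
      using wpos
    proof eventually_elim
      case (elim y)
      then show ?case by (auto simp: ennreal_mult_eq_top_iff less_top)
    qed
    have key: "AE y in M. (\<integral>\<^sup>+z. ennreal (H y z * f z) \<partial>M) < \<infinity> \<and>
        ennreal (enn2real (\<integral>\<^sup>+z. ennreal (H y z * f z) \<partial>M) powr p) \<le> ennreal (C1 powr (p / q)) * (ennreal (w y powr p) * J y)"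
      using Jfin S1 wpos AE_space
    proof eventually_elim
      case (elim y)
      note [measurable] = slice1[OF elim(4)]
      define j where "j = enn2real (J y)"
      have j: "J y = ennreal j" "0 \<le> j" using elim by (auto simp: j_def)
      have "(\<integral>\<^sup>+z. ennreal (H y z * f z) \<partial>M) = (\<integral>\<^sup>+z. ennreal ((H y z powr (1 / q) * w z) * (H y z powr (1 / p) * (f z / w z))) \<partial>M)"
        using wpos
      proof (intro nn_integral_cong_AE, eventually_elim)
        case (elim z)
        have "H y z powr (1 / q) * H y z powr (1 / p) = H y z"
          using pq H0[of y z] by (simp flip: powr_add add: add.commute)
        then show ?case using elim by (simp add: field_simps)
      qed
      also have "\<dots> \<le> ennreal ((C1 * w y powr q) powr (1 / q) * j powr (1 / p))"
      proof (rule nn_integral_Holder)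
        show "(\<integral>\<^sup>+x. ennreal ((H y x powr (1 / q) * w x) powr q) \<partial>M) \<le> ennreal (C1 * w y powr q)"
          using elim pq H0 w0 by (simp add: powr_mult powr_powr)
        show "(\<integral>\<^sup>+x. ennreal ((H y x powr (1 / p) * (f x / w x)) powr p) \<partial>M) \<le> ennreal j"
        proof -
          have "(H y x powr (1 / p) * (f x / w x)) powr p = H y x * (f x / w x) powr p" for x
            using pq H0[of y x] w0[of x] f0[of x] by (subst powr_mult) (simp_all add: powr_powr)
          then show ?thesis using j by (simp add: J_def)
        qed
      qed (use pq C12 w0 f0 H0 j in auto)
      finally have le: "(\<integral>\<^sup>+z. ennreal (H y z * f z) \<partial>M) \<le> ennreal (C1 powr (1/q) * w y * j powr (1 / p))"
        using pq C12 w0 by (simp add: powr_mult powr_powr)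
      then have "enn2real (\<integral>\<^sup>+z. ennreal (H y z * f z) \<partial>M) \<le> C1 powr (1/q) * w y * j powr (1 / p)"
        using w0 by (intro enn2real_leI) auto
      then have "enn2real (\<integral>\<^sup>+z. ennreal (H y z * f z) \<partial>M) powr p \<le> (C1 powr (1/q) * w y * j powr (1 / p)) powr p"
        using pq by (intro powr_mono2) auto
      also have "\<dots> = C1 powr (p / q) * (w y powr p * j)"
        using pq w0 j by (simp add: powr_mult powr_powr)
      finally show ?case
        using le_less_trans[OF le ennreal_less_top] j w0
        by (auto simp flip: ennreal_mult' intro: ennreal_leI)
    qed
    show "(AE y in M. (\<integral>\<^sup>+z. ennreal (H y z * f z) \<partial>M) < \<infinity>)
        \<and> (\<integral>\<^sup>+y. ennreal (enn2real (\<integral>\<^sup>+z. ennreal (H y z * f z) \<partial>M) powr p) \<partial>M) \<le> ennreal (C * B)"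
    proof
      show "AE y in M. (\<integral>\<^sup>+z. ennreal (H y z * f z) \<partial>M) < \<infinity>" using key by eventually_elim auto
      have "(\<integral>\<^sup>+y. ennreal (enn2real (\<integral>\<^sup>+z. ennreal (H y z * f z) \<partial>M) powr p) \<partial>M)
        \<le> (\<integral>\<^sup>+y. ennreal (C1 powr (p / q)) * (ennreal (w y powr p) * J y) \<partial>M)"
        using key by (intro nn_integral_mono_AE) (auto elim: eventually_mono)
      also have "\<dots> = ennreal (C1 powr (p / q)) * (\<integral>\<^sup>+y. ennreal (w y powr p) * J y \<partial>M)"
        by (simp add: nn_integral_cmult)
      also have "\<dots> \<le> ennreal (C1 powr (p / q)) * ennreal (C2 * B)"
        using JB by (intro mult_left_mono) auto
      finally show "(\<integral>\<^sup>+y. ennreal (enn2real (\<integral>\<^sup>+z. ennreal (H y z * f z) \<partial>M) powr p) \<partial>M) \<le> ennreal (C * B)"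
        by (simp add: C_def mult.assoc flip: ennreal_mult')
    qed
  qed
qed

text \<open>Minkowski's inequality for l2-valued functions. With F the vector of integrals and U its
  l2 norm, U^2 is the integral of k times the inner product of F and f, hence at most U times the
  integral of k |f| by Cauchy-Schwarz; then U is cancelled.\<close>

lemma L2_set_nn_integral_le:
  fixes k :: "'a \<Rightarrow> real"
  assumes [measurable]: "k \<in> borel_measurable M" "\<And>i. i \<in> I \<Longrightarrow> f i \<in> borel_measurable M"
    and k0: "\<And>x. 0 \<le> k x" and f0: "\<And>i x. i \<in> I \<Longrightarrow> 0 \<le> f i x" and I: "finite I"
    and fin: "(\<integral>\<^sup>+x. ennreal (k x * L2_set (\<lambda>i. f i x) I) \<partial>M) < \<infinity>"
  shows "i \<in> I \<Longrightarrow> (\<integral>\<^sup>+x. ennreal (k x * f i x) \<partial>M) < \<infinity>"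
    and "L2_set (\<lambda>i. enn2real (\<integral>\<^sup>+x. ennreal (k x * f i x) \<partial>M)) I
      \<le> enn2real (\<integral>\<^sup>+x. ennreal (k x * L2_set (\<lambda>i. f i x) I) \<partial>M)"
proof -
  have fini: "(\<integral>\<^sup>+x. ennreal (k x * f i x) \<partial>M) < \<infinity>" if "i \<in> I" for i
  proof -
    have "(\<integral>\<^sup>+x. ennreal (k x * f i x) \<partial>M) \<le> (\<integral>\<^sup>+x. ennreal (k x * L2_set (\<lambda>i. f i x) I) \<partial>M)"
      using that I k0 f0 by (intro nn_integral_mono ennreal_leI mult_left_mono member_le_L2_set) auto
    then show ?thesis using fin by (rule le_less_trans)
  qed
  then show "i \<in> I \<Longrightarrow> (\<integral>\<^sup>+x. ennreal (k x * f i x) \<partial>M) < \<infinity>" .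
  define F where "F i = enn2real (\<integral>\<^sup>+x. ennreal (k x * f i x) \<partial>M)" for i
  define U where "U = L2_set F I"
  define V where "V = enn2real (\<integral>\<^sup>+x. ennreal (k x * L2_set (\<lambda>i. f i x) I) \<partial>M)"
  have F: "(\<integral>\<^sup>+x. ennreal (k x * f i x) \<partial>M) = ennreal (F i)" if "i \<in> I" for i
    using fini[OF that] by (simp add: F_def)
  have F0: "0 \<le> F i" for i by (simp add: F_def)
  have U0: "0 \<le> U" by (simp add: U_def L2_set_nonneg)
  have "ennreal (U\<^sup>2) = (\<Sum>i\<in>I. ennreal (F i) * (\<integral>\<^sup>+x. ennreal (k x * f i x) \<partial>M))"
    using F F0 by (simp add: U_def L2_set_def sum_nonneg power2_eq_square sum_ennreal flip: ennreal_mult')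
  also have "\<dots> = (\<integral>\<^sup>+x. (\<Sum>i\<in>I. ennreal (F i) * ennreal (k x * f i x)) \<partial>M)"
    by (simp add: nn_integral_cmult nn_integral_sum)
  also have "\<dots> \<le> (\<integral>\<^sup>+x. ennreal U * ennreal (k x * L2_set (\<lambda>i. f i x) I) \<partial>M)"
  proof (rule nn_integral_mono)
    fix x
    have "(\<Sum>i\<in>I. F i * (k x * f i x)) = k x * (\<Sum>i\<in>I. \<bar>F i\<bar> * \<bar>f i x\<bar>)"
      using F0 f0 by (simp add: sum_distrib_left mult_ac)
    also have "\<dots> \<le> k x * (U * L2_set (\<lambda>i. f i x) I)"
      unfolding U_def by (intro mult_left_mono L2_set_mult_ineq k0)
    finally show "(\<Sum>i\<in>I. ennreal (F i) * ennreal (k x * f i x)) \<le> ennreal U * ennreal (k x * L2_set (\<lambda>i. f i x) I)"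
      using F0 k0 f0 U0 by (simp add: sum_ennreal mult_ac flip: ennreal_mult')
  qed
  also have "\<dots> = ennreal U * ennreal V"
    using fin by (simp add: nn_integral_cmult V_def L2_set_def)
  finally have "U\<^sup>2 \<le> U * V"
    using U0 by (simp add: V_def flip: ennreal_mult')
  then have "U \<le> V" using U0 by (cases "U = 0") (auto simp: power2_eq_square V_def)
  then show "L2_set (\<lambda>i. enn2real (\<integral>\<^sup>+x. ennreal (k x * f i x) \<partial>M)) I
      \<le> enn2real (\<integral>\<^sup>+x. ennreal (k x * L2_set (\<lambda>i. f i x) I) \<partial>M)"
    unfolding U_def V_def F_def .
qed

text \<open>The constant refers to p-th powers of norms. Finiteness of the integrals is part of the
  notion, since without it the estimate for the \<open>enn2real\<close> values could hold for
  trivial reasons.\<close>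

definition l2_bounded_kernel :: "'a measure \<Rightarrow> real \<Rightarrow> ('a \<Rightarrow> 'a \<Rightarrow> real) \<Rightarrow> real \<Rightarrow> bool" where
  "l2_bounded_kernel M p H C \<longleftrightarrow>
    (\<forall>(I :: nat set) f B. finite I \<longrightarrow> (\<forall>i\<in>I. f i \<in> borel_measurable M \<and> (\<forall>x. 0 \<le> f i x)) \<longrightarrow> 0 \<le> B \<longrightarrow>
      (\<integral>\<^sup>+x. ennreal (L2_set (\<lambda>i. f i x) I powr p) \<partial>M) \<le> ennreal B \<longrightarrow>
      (AE y in M. \<forall>i\<in>I. (\<integral>\<^sup>+z. ennreal (H y z * f i z) \<partial>M) < \<infinity>) \<and>
      (\<integral>\<^sup>+y. ennreal (L2_set (\<lambda>i. enn2real (\<integral>\<^sup>+z. ennreal (H y z * f i z) \<partial>M)) I powr p) \<partial>M) \<le> ennreal (C * B))"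

text \<open>Schur's test is applied to the single function |f|, the pointwise l2 norm of the family;
  Minkowski's inequality at each y does the rest.\<close>

lemma (in sigma_finite_measure) schur_square_function:
  assumes H: "schur_bounded M p q H" and pq: "1 < p" "1 < q" "1 / p + 1 / q = 1"
  shows "\<exists>C\<ge>0. l2_bounded_kernel M p H C"
proof -
  obtain C where C: "0 \<le> C" and
    bd: "\<And>f B. f \<in> borel_measurable M \<Longrightarrow> (\<And>x. 0 \<le> f x) \<Longrightarrow> 0 \<le> B
      \<Longrightarrow> (\<integral>\<^sup>+x. ennreal (f x powr p) \<partial>M) \<le> ennreal B
      \<Longrightarrow> (AE y in M. (\<integral>\<^sup>+z. ennreal (H y z * f z) \<partial>M) < \<infinity>)
        \<and> (\<integral>\<^sup>+y. ennreal (enn2real (\<integral>\<^sup>+z. ennreal (H y z * f z) \<partial>M) powr p) \<partial>M) \<le> ennreal (C * B)"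
    using schur_test[OF H pq] by blast
  have mH[measurable]: "(\<lambda>(y, z). H y z) \<in> borel_measurable (M \<Otimes>\<^sub>M M)" and H0: "\<And>y z. 0 \<le> H y z"
    using H unfolding schur_bounded_def by auto
  have "l2_bounded_kernel M p H C"
    unfolding l2_bounded_kernel_def
  proof (intro allI impI)
    fix I :: "nat set" and f :: "nat \<Rightarrow> 'a \<Rightarrow> real" and B :: real
    assume I: "finite I" and f: "\<forall>i\<in>I. f i \<in> borel_measurable M \<and> (\<forall>x. 0 \<le> f i x)" and B: "0 \<le> B"
      and fB: "(\<integral>\<^sup>+x. ennreal (L2_set (\<lambda>i. f i x) I powr p) \<partial>M) \<le> ennreal B"
    have fm[measurable]: "f i \<in> borel_measurable M" and f0: "0 \<le> f i x" if "i \<in> I" for i x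
      using f that by auto
    define G where "G x = L2_set (\<lambda>i. f i x) I" for x
    have [measurable]: "G \<in> borel_measurable M" unfolding G_def L2_set_def by measurable
    have G: "AE y in M. (\<integral>\<^sup>+z. ennreal (H y z * G z) \<partial>M) < \<infinity>"
      "(\<integral>\<^sup>+y. ennreal (enn2real (\<integral>\<^sup>+z. ennreal (H y z * G z) \<partial>M) powr p) \<partial>M) \<le> ennreal (C * B)"
      using bd[of G B] fB B by (auto simp: G_def L2_set_nonneg)
    have key: "AE y in M. (\<forall>i\<in>I. (\<integral>\<^sup>+z. ennreal (H y z * f i z) \<partial>M) < \<infinity>) \<and>
      L2_set (\<lambda>i. enn2real (\<integral>\<^sup>+z. ennreal (H y z * f i z) \<partial>M)) I \<le> enn2real (\<integral>\<^sup>+z. ennreal (H y z * G z) \<partial>M)"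
      using G(1) AE_space
    proof eventually_elim
      case (elim y)
      have [measurable]: "H y \<in> borel_measurable M"
        using measurable_compose[OF measurable_Pair1'[OF elim(2), of M] mH] by simp
      show ?case
        using L2_set_nn_integral_le[of "H y" M I f] elim H0 f0 I fm unfolding G_def by auto
    qed
    have "(\<integral>\<^sup>+y. ennreal (L2_set (\<lambda>i. enn2real (\<integral>\<^sup>+z. ennreal (H y z * f i z) \<partial>M)) I powr p) \<partial>M)
      \<le> (\<integral>\<^sup>+y. ennreal (enn2real (\<integral>\<^sup>+z. ennreal (H y z * G z) \<partial>M) powr p) \<partial>M)"
    proof (rule nn_integral_mono_AE)
      show "AE y in M. ennreal (L2_set (\<lambda>i. enn2real (\<integral>\<^sup>+z. ennreal (H y z * f i z) \<partial>M)) I powr p)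
          \<le> ennreal (enn2real (\<integral>\<^sup>+z. ennreal (H y z * G z) \<partial>M) powr p)"
        using key
      proof eventually_elim
        case (elim y)
        then show ?case using pq by (intro ennreal_leI powr_mono2) (auto simp: L2_set_nonneg)
      qed
    qed
    also note G(2)
    finally show "(AE y in M. \<forall>i\<in>I. (\<integral>\<^sup>+z. ennreal (H y z * f i z) \<partial>M) < \<infinity>)
        \<and> (\<integral>\<^sup>+y. ennreal (L2_set (\<lambda>i. enn2real (\<integral>\<^sup>+z. ennreal (H y z * f i z) \<partial>M)) I powr p) \<partial>M) \<le> ennreal (C * B)"
      using key by (auto elim: eventually_mono)
  qed
  with C show ?thesis by blast
qed

text \<open>A weighted Hardy average over the ball of radius 2 |y|, homogeneous of degree -D jointly
  in y and z.\<close>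

definition hardy_kernel :: "real \<Rightarrow> 'a::euclidean_space \<Rightarrow> 'a \<Rightarrow> real" where
  "hardy_kernel \<theta> y z = norm y powr (\<theta> - DIM('a)) * norm z powr (- \<theta>) * indicator {u. norm u \<le> 2 * norm y} z"

lemma hardy_kernel_measurable [measurable]:
  "(\<lambda>(y, z). hardy_kernel \<theta> y (z::'a::euclidean_space)) \<in> borel_measurable (lborel \<Otimes>\<^sub>M lborel)"
proof -
  have "(\<lambda>x. norm (fst x) powr (\<theta> - DIM('a)) * norm (snd x) powr (- \<theta>) * (if norm (snd x) \<le> 2 * norm (fst x) then 1 else 0))
     \<in> borel_measurable (lborel \<Otimes>\<^sub>M (lborel :: 'a measure))"
    by measurable
  then show ?thesis unfolding hardy_kernel_def indicator_def by (simp add: case_prod_unfold of_bool_def)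
qed

text \<open>The weight is |z|^(-\<sigma>). Convergence of the z-integral at the origin requires
  \<theta> + \<sigma> q < D, that of the y-integral at infinity requires \<sigma> p > \<theta>. The
  interval left for \<sigma>, from \<theta> / p to (D - \<theta>) / q, is nonempty exactly when
  \<theta> < D / q.\<close>

lemma schur_bounded_hardy_kernel:
  assumes pq: "1 < p" "1 < q" "1 / p + 1 / q = 1" and \<theta>: "\<theta> < DIM('a::euclidean_space) / q"
  shows "schur_bounded (lborel :: 'a measure) p q (hardy_kernel \<theta>)"
proof -
  define D where "D = real DIM('a)"
  have "\<theta> / p + \<theta> / q = \<theta>" using pq(3) by (metis distrib_left divide_inverse mult.right_neutral mult_1)
  then have "\<theta> / p < (D - \<theta>) / q" using \<theta> by (simp add: D_def diff_divide_distrib)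
  then obtain \<sigma> where \<sigma>: "\<theta> / p < \<sigma>" "\<sigma> < (D - \<theta>) / q" using dense by blast
  then have \<sigma>': "\<theta> + \<sigma> * q < D" "D < D - \<theta> + \<sigma> * p" using pq by (auto simp: field_simps)
  obtain K1 where K1: "0 \<le> K1" "\<And>R. 0 < R \<Longrightarrow> (\<integral>\<^sup>+z. ennreal (norm (z::'a) powr (- (\<theta> + \<sigma> * q)) * indicator (cball 0 R) z) \<partial>lborel)
        \<le> ennreal (K1 * R powr (DIM('a) - (\<theta> + \<sigma> * q)))"
    using nn_integral_norm_powr_cball[where 'a = 'a and \<tau> = "\<theta> + \<sigma> * q", folded D_def] \<sigma>'
    unfolding D_def by blast
  obtain K2 where K2: "0 \<le> K2" "\<And>R. 0 < R \<Longrightarrow> (\<integral>\<^sup>+z. ennreal (norm (z::'a) powr (- (D - \<theta> + \<sigma> * p)) * indicator {z. R \<le> norm z} z) \<partial>lborel)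
        \<le> ennreal (K2 * R powr (DIM('a) - (D - \<theta> + \<sigma> * p)))"
    using nn_integral_norm_powr_outside[where 'a = 'a and \<tau> = "D - \<theta> + \<sigma> * p"] \<sigma>'
    unfolding D_def by blast
  define w where "w z = norm z powr (- \<sigma>)" for z :: 'a
  have [measurable]: "w \<in> borel_measurable lborel" unfolding w_def by measurable
  have w_powr: "w z powr r = norm z powr (- (\<sigma> * r))" for z r by (simp add: w_def powr_powr)
  have [measurable]: "cball (0::'a) r \<in> sets borel" for r by simp
  define C1 where "C1 = K1 * 2 powr (D - (\<theta> + \<sigma> * q))"
  define C2 where "C2 = K2 * (1/2) powr (\<theta> - \<sigma> * p)"
  have nz: "AE x in (lborel :: 'a measure). x \<noteq> 0" by (rule AE_lborel_singleton)
  have 1: "(\<integral>\<^sup>+z. ennreal (hardy_kernel \<theta> y z * w z powr q) \<partial>lborel) \<le> ennreal (C1 * w y powr q)" if y: "y \<noteq> 0" for y :: 'a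
  proof -
    have "(\<integral>\<^sup>+z. ennreal (hardy_kernel \<theta> y z * w z powr q) \<partial>lborel)
       = (\<integral>\<^sup>+z. ennreal (norm y powr (\<theta> - D)) * ennreal (norm (z::'a) powr (- (\<theta> + \<sigma> * q)) * indicator (cball 0 (2 * norm y)) z) \<partial>lborel)"
      by (intro nn_integral_cong)
        (auto simp: hardy_kernel_def w_powr D_def indicator_def powr_diff powr_minus powr_add field_simps simp flip: ennreal_mult')
    also have "\<dots> = ennreal (norm y powr (\<theta> - D)) * (\<integral>\<^sup>+z. ennreal (norm (z::'a) powr (- (\<theta> + \<sigma> * q)) * indicator (cball 0 (2 * norm y)) z) \<partial>lborel)"
      by (intro nn_integral_cmult) measurable
    also have "\<dots> \<le> ennreal (norm y powr (\<theta> - D)) * ennreal (K1 * (2 * norm y) powr (DIM('a) - (\<theta> + \<sigma> * q)))"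
      using y by (intro mult_left_mono K1) auto
    also have "\<dots> = ennreal (C1 * (norm y powr (\<theta> - D) * norm y powr (D - (\<theta> + \<sigma> * q))))"
      by (simp add: C1_def D_def powr_mult mult_ac flip: ennreal_mult')
    also have "norm y powr (\<theta> - D) * norm y powr (D - (\<theta> + \<sigma> * q)) = w y powr q"
      by (simp add: w_def powr_powr flip: powr_add)
    finally show ?thesis .
  qed
  have 2: "(\<integral>\<^sup>+y. ennreal (hardy_kernel \<theta> y z * w y powr p) \<partial>lborel) \<le> ennreal (C2 * w z powr p)" if z: "z \<noteq> 0" for z :: 'a
  proof -
    have "(\<integral>\<^sup>+y. ennreal (hardy_kernel \<theta> y z * w y powr p) \<partial>lborel)
       = (\<integral>\<^sup>+y. ennreal (norm z powr (- \<theta>)) * ennreal (norm (y::'a) powr (- (D - \<theta> + \<sigma> * p)) * indicator {y. norm z / 2 \<le> norm y} y) \<partial>lborel)"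
      by (intro nn_integral_cong)
        (auto simp: hardy_kernel_def w_powr D_def indicator_def powr_diff powr_minus powr_add field_simps simp flip: ennreal_mult')
    also have "\<dots> = ennreal (norm z powr (- \<theta>)) * (\<integral>\<^sup>+y. ennreal (norm (y::'a) powr (- (D - \<theta> + \<sigma> * p)) * indicator {y. norm z / 2 \<le> norm y} y) \<partial>lborel)"
      by (intro nn_integral_cmult) measurable
    also have "\<dots> \<le> ennreal (norm z powr (- \<theta>)) * ennreal (K2 * (norm z / 2) powr (DIM('a) - (D - \<theta> + \<sigma> * p)))"
      using z by (intro mult_left_mono K2) auto
    also have "\<dots> = ennreal (C2 * (norm z powr (- \<theta>) * norm z powr (\<theta> - \<sigma> * p)))"
      by (simp add: C2_def D_def powr_divide mult_ac flip: ennreal_mult')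
    also have "norm z powr (- \<theta>) * norm z powr (\<theta> - \<sigma> * p) = w z powr p"
      by (simp add: w_def powr_powr flip: powr_add)
    finally show ?thesis .
  qed
  show ?thesis
    unfolding schur_bounded_def
  proof (intro conjI; (rule exI[of _ w], rule exI[of _ C1], rule exI[of _ C2], intro conjI)?)
    show "AE x in lborel. 0 < w x" using nz by eventually_elim (auto simp: w_def)
    show "AE y in lborel. (\<integral>\<^sup>+z. ennreal (hardy_kernel \<theta> y z * w z powr q) \<partial>lborel) \<le> ennreal (C1 * w y powr q)"
      using nz by eventually_elim (rule 1)
    show "AE z in lborel. (\<integral>\<^sup>+y. ennreal (hardy_kernel \<theta> y z * w y powr p) \<partial>lborel) \<le> ennreal (C2 * w z powr p)"
      using nz by eventually_elim (rule 2)
  qed (use K1(1) K2(1) in \<open>auto simp: C1_def C2_def w_def hardy_kernel_def\<close>)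
qed

section \<open>Averages with an exponential kernel\<close>

definition exp_kernel :: "real \<Rightarrow> 'a::euclidean_space \<Rightarrow> 'a \<Rightarrow> real" where
  "exp_kernel s y z = exp (- (norm (z - y) / s)) / s ^ DIM('a)"

text \<open>Real values are convenient for sums and powers. As an infinite integral would become 0,
  the facts below carry an L^r hypothesis wherever the integral itself is meant.\<close>

definition exp_mean :: "real \<Rightarrow> ('a::euclidean_space \<Rightarrow> real) \<Rightarrow> 'a \<Rightarrow> real" where
  "exp_mean s f y = enn2real (\<integral>\<^sup>+z. ennreal (exp_kernel s y z * f z) \<partial>lborel)"

lemma exp_kernel_nonneg: "0 < s \<Longrightarrow> 0 \<le> exp_kernel s y z"
  by (simp add: exp_kernel_def)

lemma exp_kernel_commute: "exp_kernel s y z = exp_kernel s z y"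
  by (simp add: exp_kernel_def norm_minus_commute)

lemma exp_kernel_measurable [measurable (raw)]:
  assumes [measurable]: "f \<in> M \<rightarrow>\<^sub>M borel" "g \<in> M \<rightarrow>\<^sub>M borel"
  shows "(\<lambda>x. exp_kernel s (f x) (g x)) \<in> borel_measurable M"
  unfolding exp_kernel_def by measurable

lemma exp_mean_nonneg: "0 \<le> exp_mean s f y"
  by (simp add: exp_mean_def)

lemma exp_mean_measurable [measurable]:
  assumes [measurable]: "f \<in> borel_measurable borel"
  shows "exp_mean s f \<in> borel_measurable borel"
proof -
  have "(\<lambda>y. \<integral>\<^sup>+z. ennreal (exp_kernel s y z * f z) \<partial>lborel) \<in> borel_measurable borel"
    by measurable
  then show ?thesis unfolding exp_mean_def[abs_def] by measurable
qed

text \<open>Only an upper bound for the total mass that is uniform in s and y is needed, not its exact value.\<close>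

definition exp_kernel_mass :: "'a::euclidean_space itself \<Rightarrow> real" where
  "exp_kernel_mass _ = (SOME c. 0 < c \<and>
    (\<forall>s (y::'a). 0 < s \<longrightarrow> (\<integral>\<^sup>+z. ennreal (exp_kernel s y z) \<partial>lborel) \<le> ennreal c))"

lemma exp_kernel_mass:
  shows exp_kernel_mass_pos: "0 < exp_kernel_mass TYPE('a::euclidean_space)"
    and nn_integral_exp_kernel: "0 < s \<Longrightarrow>
      (\<integral>\<^sup>+z. ennreal (exp_kernel s (y::'a) z) \<partial>lborel) \<le> ennreal (exp_kernel_mass TYPE('a))"
proof -
  obtain C where C: "0 < C" "\<And>s y. 0 < s \<Longrightarrow>
      (\<integral>\<^sup>+z. ennreal (exp (- (norm (z - (y::'a)) / s))) \<partial>lborel) \<le> ennreal (C * s ^ DIM('a))"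
    using nn_integral_exp_norm[where 'a = 'a] by blast
  have "(\<integral>\<^sup>+z. ennreal (exp_kernel s (y::'a) z) \<partial>lborel) \<le> ennreal C" if s: "0 < s" for s y
  proof -
    have "(\<integral>\<^sup>+z. ennreal (exp_kernel s y z) \<partial>lborel)
        = (\<integral>\<^sup>+z. ennreal (1 / s ^ DIM('a)) * ennreal (exp (- (norm (z - y) / s))) \<partial>lborel)"
      using s by (simp add: exp_kernel_def flip: ennreal_mult')
    also have "\<dots> = ennreal (1 / s ^ DIM('a)) * (\<integral>\<^sup>+z. ennreal (exp (- (norm (z - y) / s))) \<partial>lborel)"
      by (intro nn_integral_cmult) measurable
    also have "\<dots> \<le> ennreal (1 / s ^ DIM('a)) * ennreal (C * s ^ DIM('a))"
      using C(2)[OF s] by (intro mult_left_mono) auto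
    finally show ?thesis using s by (simp flip: ennreal_mult')
  qed
  then have "\<exists>c. 0 < c \<and>
    (\<forall>s (y::'a). 0 < s \<longrightarrow> (\<integral>\<^sup>+z. ennreal (exp_kernel s y z) \<partial>lborel) \<le> ennreal c)"
    using C(1) by blast
  from someI_ex[OF this, folded exp_kernel_mass_def[of "TYPE('a)"]]
  show "0 < exp_kernel_mass TYPE('a)" and "0 < s \<Longrightarrow>
      (\<integral>\<^sup>+z. ennreal (exp_kernel s (y::'a) z) \<partial>lborel) \<le> ennreal (exp_kernel_mass TYPE('a))"
    by blast+
qed

lemma le_one_plus_powr:
  fixes x r :: real
  assumes "0 \<le> x" "1 \<le> r"
  shows "x \<le> 1 + x powr r"
proof (cases "x \<le> 1")
  case False
  then have "x powr 1 \<le> x powr r" using assms by (intro powr_mono) auto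
  then show ?thesis using False by simp
next
  case True
  then show ?thesis by (simp add: add_increasing2)
qed

text \<open>By f \<le> 1 + f^r the integral splits into the mass of the kernel and the integral of
  f^r, multiplied by the maximum s^(-D) of the kernel.\<close>

lemma exp_mean_finite:
  fixes f :: "'a::euclidean_space \<Rightarrow> real"
  assumes s: "0 < s" and [measurable]: "f \<in> borel_measurable borel" and f0: "\<And>x. 0 \<le> f x"
    and r: "1 \<le> r" and fin: "(\<integral>\<^sup>+x. ennreal (f x powr r) \<partial>lborel) < \<infinity>"
  shows "(\<integral>\<^sup>+z. ennreal (exp_kernel s y z * f z) \<partial>lborel) < \<infinity>"
proof -
  have "(\<integral>\<^sup>+z. ennreal (exp_kernel s y z * f z) \<partial>lborel)
    \<le> (\<integral>\<^sup>+z. ennreal (exp_kernel s y z) + ennreal (1 / s ^ DIM('a)) * ennreal (f z powr r) \<partial>lborel)"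
  proof (rule nn_integral_mono)
    fix z
    have "exp_kernel s y z * f z \<le> exp_kernel s y z * (1 + f z powr r)"
      using s r f0 by (intro mult_left_mono le_one_plus_powr) (auto simp: exp_kernel_nonneg)
    also have "\<dots> \<le> exp_kernel s y z + 1 / s ^ DIM('a) * f z powr r"
    proof -
      have "exp_kernel s y z \<le> 1 / s ^ DIM('a)"
        using s by (auto simp: exp_kernel_def intro!: divide_right_mono)
      from mult_right_mono[OF this, of "f z powr r"] show ?thesis
        by (simp add: algebra_simps)
    qed
    finally show "ennreal (exp_kernel s y z * f z)
        \<le> ennreal (exp_kernel s y z) + ennreal (1 / s ^ DIM('a)) * ennreal (f z powr r)"
      using s by (simp add: exp_kernel_nonneg flip: ennreal_mult' ennreal_plus)
  qed
  also have "\<dots> = (\<integral>\<^sup>+z. ennreal (exp_kernel s y z) \<partial>lborel)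
      + ennreal (1 / s ^ DIM('a)) * (\<integral>\<^sup>+z. ennreal (f z powr r) \<partial>lborel)"
    by (simp add: nn_integral_add nn_integral_cmult)
  also have "\<dots> < \<infinity>"
    using le_less_trans[OF nn_integral_exp_kernel[OF s, of y] ennreal_less_top] fin
    by (auto simp: ennreal_mult_less_top)
  finally show ?thesis .
qed

lemma ennreal_exp_mean:
  fixes f :: "'a::euclidean_space \<Rightarrow> real"
  assumes "0 < s" "f \<in> borel_measurable borel" "\<And>x. 0 \<le> f x"
    and "1 \<le> r" "(\<integral>\<^sup>+x. ennreal (f x powr r) \<partial>lborel) < \<infinity>"
  shows "ennreal (exp_mean s f y) = (\<integral>\<^sup>+z. ennreal (exp_kernel s y z * f z) \<partial>lborel)"
  using exp_mean_finite[OF assms, of y] by (simp add: exp_mean_def)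

text \<open>Jensen's inequality for a measure of total mass at most c, which costs c^(r - 1). The
  extra exponent \<rho> allows f^r to lie merely in some L^\<rho>; the square function estimate uses
  r = 2 and \<rho> = p / 2.\<close>

lemma exp_mean_powr_le:
  fixes f :: "'a::euclidean_space \<Rightarrow> real"
  assumes s: "0 < s" and fm[measurable]: "f \<in> borel_measurable borel" and f0: "\<And>x. 0 \<le> f x"
    and r: "1 < r" and \<rho>: "1 \<le> \<rho>" and fin: "(\<integral>\<^sup>+x. ennreal ((f x powr r) powr \<rho>) \<partial>lborel) < \<infinity>"
  shows "exp_mean s f y powr r \<le> exp_kernel_mass TYPE('a) powr (r - 1) * exp_mean s (\<lambda>x. f x powr r) y"
proof -
  define c where "c = exp_kernel_mass TYPE('a)"
  have c: "0 < c" by (simp add: c_def exp_kernel_mass_pos)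
  define q where "q = r / (r - 1)"
  have q: "1 < q" "1 / q + 1 / r = 1" using r by (auto simp: q_def field_simps)
  define J where "J = exp_mean s (\<lambda>x. f x powr r) y"
  have J: "ennreal J = (\<integral>\<^sup>+z. ennreal (exp_kernel s y z * f z powr r) \<partial>lborel)"
    unfolding J_def by (rule ennreal_exp_mean[OF s _ _ \<rho> fin]) auto
  have J0: "0 \<le> J" by (simp add: J_def exp_mean_nonneg)
  note k0 = exp_kernel_nonneg[OF s]
  have "(\<integral>\<^sup>+z. ennreal (exp_kernel s y z * f z) \<partial>lborel)
      = (\<integral>\<^sup>+z. ennreal (exp_kernel s y z powr (1 / q) * (exp_kernel s y z powr (1 / r) * f z)) \<partial>lborel)"
    using q(2) by (simp add: abs_of_nonneg[OF k0] flip: mult.assoc powr_add)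
  also have "\<dots> \<le> ennreal (c powr (1 / q) * J powr (1 / r))"
  proof (rule nn_integral_Holder)
    show "(\<integral>\<^sup>+x. ennreal ((exp_kernel s y x powr (1 / q)) powr q) \<partial>lborel) \<le> ennreal c"
      using nn_integral_exp_kernel[OF s, of y] q by (simp add: powr_powr c_def abs_of_nonneg[OF k0])
    show "(\<integral>\<^sup>+x. ennreal ((exp_kernel s y x powr (1 / r) * f x) powr r) \<partial>lborel) \<le> ennreal J"
      unfolding J using r f0 by (simp add: powr_mult powr_powr abs_of_nonneg[OF k0])
  qed (use q r c J0 k0 f0 in auto)
  finally have "exp_mean s f y \<le> c powr (1 / q) * J powr (1 / r)"
    unfolding exp_mean_def by (intro enn2real_leI) auto
  then have "exp_mean s f y powr r \<le> (c powr (1 / q) * J powr (1 / r)) powr r"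
    using r by (intro powr_mono2) (auto simp: exp_mean_nonneg)
  also have "\<dots> = c powr (r / q) * J"
    using r c J0 by (simp add: powr_mult powr_powr)
  also have "r / q = r - 1" using r by (simp add: q_def)
  finally show ?thesis by (simp add: c_def J_def)
qed

text \<open>Self-adjointness, by Fubini and the symmetry of the kernel. On the right the average of
  \<open>g\<close> stays an extended integral, since nothing prevents it from being
  infinite.\<close>

lemma nn_integral_exp_mean_mult:
  fixes f g :: "'a::euclidean_space \<Rightarrow> real"
  assumes s: "0 < s" and [measurable]: "f \<in> borel_measurable borel" "g \<in> borel_measurable borel"
    and f0: "\<And>x. 0 \<le> f x" and g0: "\<And>x. 0 \<le> g x"
    and r: "1 \<le> r" "(\<integral>\<^sup>+x. ennreal (f x powr r) \<partial>lborel) < \<infinity>"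
  shows "(\<integral>\<^sup>+y. ennreal (exp_mean s f y * g y) \<partial>lborel)
    = (\<integral>\<^sup>+z. ennreal (f z) * (\<integral>\<^sup>+y. ennreal (exp_kernel s z y * g y) \<partial>lborel) \<partial>lborel)"
proof -
  note k0 = exp_kernel_nonneg[OF s]
  have "(\<integral>\<^sup>+y. ennreal (exp_mean s f y * g y) \<partial>lborel)
      = (\<integral>\<^sup>+y. (\<integral>\<^sup>+z. ennreal (exp_kernel s y z * f z * g y) \<partial>lborel) \<partial>lborel)"
  proof (rule nn_integral_cong)
    fix y
    have "ennreal (exp_mean s f y * g y) = (\<integral>\<^sup>+z. ennreal (exp_kernel s y z * f z) \<partial>lborel) * ennreal (g y)"
      using ennreal_exp_mean[OF s _ f0 r, of y] g0 by (simp add: ennreal_mult'')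
    also have "\<dots> = (\<integral>\<^sup>+z. ennreal (exp_kernel s y z * f z * g y) \<partial>lborel)"
      using g0 by (subst nn_integral_multc[symmetric]) (auto simp: ennreal_mult'')
    finally show "ennreal (exp_mean s f y * g y) = (\<integral>\<^sup>+z. ennreal (exp_kernel s y z * f z * g y) \<partial>lborel)" .
  qed
  also have "\<dots> = (\<integral>\<^sup>+z. (\<integral>\<^sup>+y. ennreal (exp_kernel s y z * f z * g y) \<partial>lborel) \<partial>lborel)"
    by (rule lborel_pair.Fubini') measurable
  also have "\<dots> = (\<integral>\<^sup>+z. ennreal (f z) * (\<integral>\<^sup>+y. ennreal (exp_kernel s z y * g y) \<partial>lborel) \<partial>lborel)"
  proof (rule nn_integral_cong)
    fix z
    have "(\<integral>\<^sup>+y. ennreal (exp_kernel s y z * f z * g y) \<partial>lborel)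
      = (\<integral>\<^sup>+y. ennreal (f z) * ennreal (exp_kernel s z y * g y) \<partial>lborel)"
      using f0 by (simp add: exp_kernel_commute[of s _ z] mult_ac flip: ennreal_mult')
    then show "(\<integral>\<^sup>+y. ennreal (exp_kernel s y z * f z * g y) \<partial>lborel)
      = ennreal (f z) * (\<integral>\<^sup>+y. ennreal (exp_kernel s z y * g y) \<partial>lborel)"
      by (simp add: nn_integral_cmult)
  qed
  finally show ?thesis .
qed

lemma nn_integral_exp_mean_le:
  fixes f :: "'a::euclidean_space \<Rightarrow> real"
  assumes s: "0 < s" and [measurable]: "f \<in> borel_measurable borel" and f0: "\<And>x. 0 \<le> f x"
    and r: "1 \<le> r" "(\<integral>\<^sup>+x. ennreal (f x powr r) \<partial>lborel) < \<infinity>"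
  shows "(\<integral>\<^sup>+y. ennreal (exp_mean s f y) \<partial>lborel)
    \<le> ennreal (exp_kernel_mass TYPE('a)) * (\<integral>\<^sup>+z. ennreal (f z) \<partial>lborel)"
proof -
  have "(\<integral>\<^sup>+y. ennreal (exp_mean s f y) \<partial>lborel)
      = (\<integral>\<^sup>+z. ennreal (f z) * (\<integral>\<^sup>+y. ennreal (exp_kernel s z y) \<partial>lborel) \<partial>lborel)"
    using nn_integral_exp_mean_mult[OF s _ _ f0 _ r, of "\<lambda>_. 1"] by simp
  also have "\<dots> \<le> (\<integral>\<^sup>+z. ennreal (f z) * ennreal (exp_kernel_mass TYPE('a)) \<partial>lborel)"
    by (intro nn_integral_mono mult_left_mono nn_integral_exp_kernel s) auto
  also have "\<dots> = ennreal (exp_kernel_mass TYPE('a)) * (\<integral>\<^sup>+z. ennreal (f z) \<partial>lborel)"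
    by (subst nn_integral_multc) (auto simp: mult.commute)
  finally show ?thesis .
qed

lemma nn_integral_exp_mean_powr_le:
  fixes f :: "'a::euclidean_space \<Rightarrow> real"
  assumes s: "0 < s" and [measurable]: "f \<in> borel_measurable borel" and f0: "\<And>x. 0 \<le> f x"
    and r: "1 < r" and fin: "(\<integral>\<^sup>+x. ennreal (f x powr r) \<partial>lborel) < \<infinity>"
  shows "(\<integral>\<^sup>+y. ennreal (exp_mean s f y powr r) \<partial>lborel)
    \<le> ennreal (exp_kernel_mass TYPE('a) powr r) * (\<integral>\<^sup>+z. ennreal (f z powr r) \<partial>lborel)"
proof -
  define c where "c = exp_kernel_mass TYPE('a)"
  have c: "0 < c" by (simp add: c_def exp_kernel_mass_pos)
  have fin1: "(\<integral>\<^sup>+x. ennreal ((f x powr r) powr 1) \<partial>lborel) < \<infinity>" using fin by simp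
  have "(\<integral>\<^sup>+y. ennreal (exp_mean s f y powr r) \<partial>lborel)
      \<le> (\<integral>\<^sup>+y. ennreal (c powr (r - 1)) * ennreal (exp_mean s (\<lambda>x. f x powr r) y) \<partial>lborel)"
    using exp_mean_powr_le[OF s _ f0 r _ fin1] unfolding c_def
    by (intro nn_integral_mono) (auto simp flip: ennreal_mult' intro!: ennreal_leI)
  also have "\<dots> = ennreal (c powr (r - 1)) * (\<integral>\<^sup>+y. ennreal (exp_mean s (\<lambda>x. f x powr r) y) \<partial>lborel)"
    by (intro nn_integral_cmult) measurable
  also have "\<dots> \<le> ennreal (c powr (r - 1)) * (ennreal c * (\<integral>\<^sup>+z. ennreal (f z powr r) \<partial>lborel))"
    unfolding c_def by (intro mult_left_mono nn_integral_exp_mean_le[OF s _ _ _ fin1]) auto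
  also have "\<dots> = ennreal (c powr r) * (\<integral>\<^sup>+z. ennreal (f z powr r) \<partial>lborel)"
    using c by (simp add: powr_diff flip: mult.assoc ennreal_mult')
  finally show ?thesis by (simp add: c_def)
qed

section \<open>A dual Doob inequality for averages at different scales\<close>

lemma powr_sum_le:
  fixes a :: "'i \<Rightarrow> real"
  assumes I: "finite I" and a: "\<And>i. i \<in> I \<Longrightarrow> 0 \<le> a i" and r: "0 \<le> r"
  shows "(\<Sum>i\<in>I. a i) powr r \<le> real (card I) powr r * (\<Sum>i\<in>I. a i powr r)"
proof (cases "I = {}")
  case False
  define m where "m = Max (a ` I)"
  obtain j where j: "j \<in> I" "m = a j"
    using Max_in[of "a ` I"] I False unfolding m_def by blast
  have "(\<Sum>i\<in>I. a i) \<le> real (card I) * m"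
    unfolding m_def using I by (intro sum_bounded_above) auto
  then have "(\<Sum>i\<in>I. a i) powr r \<le> (real (card I) * m) powr r"
    using a r by (intro powr_mono2 sum_nonneg) auto
  also have "\<dots> = real (card I) powr r * a j powr r" using a j by (simp add: powr_mult)
  also have "a j powr r \<le> (\<Sum>i\<in>I. a i powr r)" using I j by (intro member_le_sum) auto
  finally show ?thesis by (simp add: mult_left_mono)
qed simp

text \<open>Convexity: t^r lies below its increment bound r (t - u) t^(r - 1) added to u^r, where t
  = u + a. Young's inequality for u t^(r - 1) gives this without differentiation.\<close>

lemma powr_add_le_tangent:
  fixes u a r :: real
  assumes "0 \<le> u" "0 \<le> a" "1 < r"
  shows "(u + a) powr r \<le> u powr r + r * a * (u + a) powr (r - 1)"
proof -
  define t where "t = u + a"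
  have t: "0 \<le> t" using assms by (simp add: t_def)
  have "u * t powr (r - 1) \<le> u powr r / r + (t powr (r - 1)) powr (r / (r - 1)) / (r / (r - 1))"
    using assms t by (intro Youngs_inequality) (auto simp: field_simps)
  also have "(t powr (r - 1)) powr (r / (r - 1)) = t powr r" using assms by (simp add: powr_powr)
  finally have "r * (u * t powr (r - 1)) \<le> r * (u powr r / r + t powr r / (r / (r - 1)))"
    using assms by (intro mult_left_mono) auto
  also have "\<dots> = u powr r + (r - 1) * t powr r"
    using assms by (simp add: field_simps)
  finally have "r * (u * t powr (r - 1)) \<le> u powr r + (r - 1) * t powr r" .
  moreover have "t powr r = t * t powr (r - 1)"
    using t by (cases "t = 0") (auto simp: powr_diff)
  ultimately have "t powr r \<le> u powr r + r * (t * t powr (r - 1)) - r * (u * t powr (r - 1))"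
    by (simp add: algebra_simps)
  also have "\<dots> = u powr r + r * a * t powr (r - 1)" by (simp add: t_def algebra_simps)
  finally show ?thesis by (simp add: t_def)
qed

text \<open>A discrete form of integrating r A^(r - 1) dA. The indices are added in order of
  decreasing \<open>s\<close>, so that the tail of each new index is the whole set collected so
  far.\<close>

lemma powr_sum_le_tails:
  fixes a s :: "'i \<Rightarrow> real"
  assumes "finite I" "\<And>i. i \<in> I \<Longrightarrow> 0 \<le> a i" "1 < r"
  shows "(\<Sum>i\<in>I. a i) powr r \<le> r * (\<Sum>i\<in>I. a i * (\<Sum>j\<in>{j\<in>I. s i \<le> s j}. a j) powr (r - 1))"
  using assms(1,2)
proof (induction I rule: finite_ranking_induct[where f = "\<lambda>i. - s i"])
  case empty
  then show ?case by simp
next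
  case (insert x S)
  show ?case
  proof (cases "x \<in> S")
    case True
    then show ?thesis using insert by (simp add: insert_absorb)
  next
    case False
    define T where "T = insert x S"
    have tail_x: "{j \<in> T. s x \<le> s j} = T" using insert by (auto simp: T_def)
    have "(\<Sum>i\<in>T. a i) powr r = ((\<Sum>i\<in>S. a i) + a x) powr r"
      using False insert by (simp add: T_def add.commute)
    also have "\<dots> \<le> (\<Sum>i\<in>S. a i) powr r + r * a x * ((\<Sum>i\<in>S. a i) + a x) powr (r - 1)"
      using insert assms(3) by (intro powr_add_le_tangent sum_nonneg) auto
    also have "(\<Sum>i\<in>S. a i) powr r \<le> r * (\<Sum>i\<in>S. a i * (\<Sum>j\<in>{j\<in>S. s i \<le> s j}. a j) powr (r - 1))"
      using insert by auto
    \<comment> \<open>The new index enters an old tail only in case of a tie; as all terms are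
      nonnegative, this can only increase the right-hand side.\<close>
    also have "\<dots> \<le> r * (\<Sum>i\<in>S. a i * (\<Sum>j\<in>{j\<in>T. s i \<le> s j}. a j) powr (r - 1))"
      using insert assms(3)
      by (intro mult_left_mono sum_mono powr_mono2 sum_mono2 sum_nonneg) (auto simp: T_def)
    also have "\<dots> + r * a x * ((\<Sum>i\<in>S. a i) + a x) powr (r - 1)
        = r * (\<Sum>i\<in>T. a i * (\<Sum>j\<in>{j\<in>T. s i \<le> s j}. a j) powr (r - 1))"
    proof -
      have "(\<Sum>i\<in>T. a i * (\<Sum>j\<in>{j\<in>T. s i \<le> s j}. a j) powr (r - 1))
         = a x * (\<Sum>j\<in>{j\<in>T. s x \<le> s j}. a j) powr (r - 1) + (\<Sum>i\<in>S. a i * (\<Sum>j\<in>{j\<in>T. s i \<le> s j}. a j) powr (r - 1))"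
        unfolding T_def using False insert by (subst sum.insert) auto
      also have "(\<Sum>j\<in>{j\<in>T. s x \<le> s j}. a j) = (\<Sum>i\<in>S. a i) + a x"
        unfolding tail_x using False insert by (simp add: T_def)
      finally show ?thesis by (simp add: algebra_simps)
    qed
    finally show ?thesis by (simp add: T_def)
  qed
qed

text \<open>Widening the kernel increases the exponential; only the normalising power of the scale
  is lost.\<close>

lemma exp_mean_scale_le:
  fixes f :: "'a::euclidean_space \<Rightarrow> real"
  assumes s: "0 < s" and fm[measurable]: "f \<in> borel_measurable borel" and f0: "\<And>x. 0 \<le> f x"
    and r: "1 \<le> r" "(\<integral>\<^sup>+x. ennreal (f x powr r) \<partial>lborel) < \<infinity>" and \<rho>: "1 \<le> \<rho>"
  shows "exp_mean s f y \<le> \<rho> ^ DIM('a) * exp_mean (\<rho> * s) f y"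
proof -
  have \<rho>s: "0 < \<rho> * s" using s \<rho> by simp
  have le: "exp_kernel s y z \<le> \<rho> ^ DIM('a) * exp_kernel (\<rho> * s) y z" for z
  proof -
    have "norm (z - y) / (\<rho> * s) \<le> norm (z - y) / s"
      using s \<rho> by (intro divide_left_mono) auto
    then show ?thesis
      using s \<rho> by (auto simp: exp_kernel_def power_mult_distrib intro!: divide_right_mono)
  qed
  have "ennreal (exp_mean s f y) = (\<integral>\<^sup>+z. ennreal (exp_kernel s y z * f z) \<partial>lborel)"
    by (rule ennreal_exp_mean[OF s fm f0 r])
  also have "\<dots> \<le> (\<integral>\<^sup>+z. ennreal (\<rho> ^ DIM('a)) * ennreal (exp_kernel (\<rho> * s) y z * f z) \<partial>lborel)"
    using mult_right_mono[OF le f0] \<rho> by (intro nn_integral_mono) (auto simp: mult.assoc simp flip: ennreal_mult' intro!: ennreal_leI)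
  also have "\<dots> = ennreal (\<rho> ^ DIM('a)) * (\<integral>\<^sup>+z. ennreal (exp_kernel (\<rho> * s) y z * f z) \<partial>lborel)"
    by (intro nn_integral_cmult) measurable
  also have "\<dots> = ennreal (\<rho> ^ DIM('a) * exp_mean (\<rho> * s) f y)"
    using ennreal_exp_mean[OF \<rho>s fm f0 r, of y] \<rho> by (simp add: ennreal_mult')
  finally show ?thesis
    using \<rho> by (simp add: exp_mean_nonneg)
qed

text \<open>The Harnack inequality: the triangle inequality in the exponent. The separate parameter
  \<open>t\<close> gives one common rate for all scales s \<ge> t, so the bound survives summation
  over a tail.\<close>

lemma exp_mean_translate_le:
  fixes f :: "'a::euclidean_space \<Rightarrow> real"
  assumes s: "0 < s" and t: "0 < t" "t \<le> s" and fm[measurable]: "f \<in> borel_measurable borel" and f0: "\<And>x. 0 \<le> f x"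
    and r: "1 \<le> r" "(\<integral>\<^sup>+x. ennreal (f x powr r) \<partial>lborel) < \<infinity>"
  shows "exp_mean s f y \<le> exp (norm (y - x) / t) * exp_mean s f x"
proof -
  define b where "b = exp (norm (y - x) / t)"
  have le: "exp_kernel s y z \<le> b * exp_kernel s x z" for z
  proof -
    have "norm (z - x) \<le> norm (z - y) + norm (y - x)" by (rule norm_diff_triangle_ineq[of z y y x, simplified])
    then have "norm (z - x) / s \<le> norm (z - y) / s + norm (y - x) / s"
      using s by (simp add: divide_right_mono flip: add_divide_distrib)
    moreover have "norm (y - x) / s \<le> norm (y - x) / t"
      using s t by (intro divide_left_mono) auto
    ultimately have "exp (- (norm (z - y) / s)) \<le> exp (norm (y - x) / t - norm (z - x) / s)" by simp
    also have "\<dots> = b * exp (- (norm (z - x) / s))" by (simp add: b_def exp_diff exp_minus field_simps)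
    finally show ?thesis
      using s by (simp add: exp_kernel_def divide_right_mono)
  qed
  have "ennreal (exp_mean s f y) = (\<integral>\<^sup>+z. ennreal (exp_kernel s y z * f z) \<partial>lborel)"
    by (rule ennreal_exp_mean[OF s fm f0 r])
  also have "\<dots> \<le> (\<integral>\<^sup>+z. ennreal b * ennreal (exp_kernel s x z * f z) \<partial>lborel)"
    using mult_right_mono[OF le f0] by (intro nn_integral_mono) (auto simp: b_def mult.assoc simp flip: ennreal_mult' intro!: ennreal_leI)
  also have "\<dots> = ennreal b * (\<integral>\<^sup>+z. ennreal (exp_kernel s x z * f z) \<partial>lborel)"
    by (intro nn_integral_cmult) measurable
  also have "\<dots> = ennreal (b * exp_mean s f x)"
    using ennreal_exp_mean[OF s fm f0 r, of x] by (simp add: b_def ennreal_mult')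
  finally show ?thesis
    by (simp add: b_def exp_mean_nonneg)
qed

text \<open>After transposing the average, U^(r - 1) grows from x to y by at most exp((r - 1) |y -
  x| / (r s)). Since -1/s + (r - 1)/(r s) = -1/(r s), the kernel of scale r s remains, and its
  normalisation accounts for r^D.\<close>

lemma nn_integral_exp_mean_slowly_varying:
  fixes h U :: "'a::euclidean_space \<Rightarrow> real"
  assumes s: "0 < s" and r: "1 < r"
    and hm[measurable]: "h \<in> borel_measurable borel" and Um[measurable]: "U \<in> borel_measurable borel"
    and h0: "\<And>x. 0 \<le> h x" and U0: "\<And>x. 0 \<le> U x"
    and fin: "(\<integral>\<^sup>+x. ennreal (h x powr r) \<partial>lborel) < \<infinity>"
    and slow: "\<And>x y. U y \<le> exp (norm (y - x) / (r * s)) * U x"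
  shows "(\<integral>\<^sup>+y. ennreal (exp_mean s h y * U y powr (r - 1)) \<partial>lborel)
    \<le> ennreal (r ^ DIM('a) * exp_kernel_mass TYPE('a)) * (\<integral>\<^sup>+x. ennreal (h x * U x powr (r - 1)) \<partial>lborel)"
proof -
  define K where "K = r ^ DIM('a) * exp_kernel_mass TYPE('a)"
  have rs: "0 < r * s" using r s by simp
  have inner: "(\<integral>\<^sup>+y. ennreal (exp_kernel s x y * U y powr (r - 1)) \<partial>lborel) \<le> ennreal (K * U x powr (r - 1))" for x
  proof -
    have "(\<integral>\<^sup>+y. ennreal (exp_kernel s x y * U y powr (r - 1)) \<partial>lborel)
       \<le> (\<integral>\<^sup>+y. ennreal (r ^ DIM('a) * U x powr (r - 1)) * ennreal (exp_kernel (r * s) x y) \<partial>lborel)"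
    proof (rule nn_integral_mono)
      fix y
      have "U y powr (r - 1) \<le> (exp (norm (y - x) / (r * s)) * U x) powr (r - 1)"
        using slow U0 r by (intro powr_mono2) auto
      also have "\<dots> = exp (norm (y - x) / (r * s) * (r - 1)) * U x powr (r - 1)"
        using U0 by (simp add: powr_mult exp_powr_real)
      finally have "exp_kernel s x y * U y powr (r - 1)
          \<le> exp_kernel s x y * (exp (norm (y - x) / (r * s) * (r - 1)) * U x powr (r - 1))"
        using s by (intro mult_left_mono exp_kernel_nonneg) auto
      also have "\<dots> = (exp (- (norm (y - x) / s)) * exp (norm (y - x) / (r * s) * (r - 1))) * U x powr (r - 1) / s ^ DIM('a)"
        by (simp add: exp_kernel_def)
      also have "exp (- (norm (y - x) / s)) * exp (norm (y - x) / (r * s) * (r - 1)) = exp (- (norm (y - x) / (r * s)))"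
        using s r by (simp add: mult_exp_exp) (simp add: field_simps)
      also have "exp (- (norm (y - x) / (r * s))) * U x powr (r - 1) / s ^ DIM('a)
          = (r ^ DIM('a) * U x powr (r - 1)) * exp_kernel (r * s) x y"
        using r s by (simp add: exp_kernel_def power_mult_distrib)
      finally show "ennreal (exp_kernel s x y * U y powr (r - 1))
          \<le> ennreal (r ^ DIM('a) * U x powr (r - 1)) * ennreal (exp_kernel (r * s) x y)"
        using r by (auto simp flip: ennreal_mult' intro!: ennreal_leI)
    qed
    also have "\<dots> = ennreal (r ^ DIM('a) * U x powr (r - 1)) * (\<integral>\<^sup>+y. ennreal (exp_kernel (r * s) x y) \<partial>lborel)"
      by (intro nn_integral_cmult) measurable
    also have "\<dots> \<le> ennreal (r ^ DIM('a) * U x powr (r - 1)) * ennreal (exp_kernel_mass TYPE('a))"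
      by (intro mult_left_mono nn_integral_exp_kernel rs) auto
    also have "\<dots> = ennreal (K * U x powr (r - 1))"
      using r by (simp add: K_def mult_ac flip: ennreal_mult'')
    finally show ?thesis .
  qed
  have "(\<integral>\<^sup>+y. ennreal (exp_mean s h y * U y powr (r - 1)) \<partial>lborel)
      = (\<integral>\<^sup>+x. ennreal (h x) * (\<integral>\<^sup>+y. ennreal (exp_kernel s x y * U y powr (r - 1)) \<partial>lborel) \<partial>lborel)"
    using r by (intro nn_integral_exp_mean_mult[OF s _ _ h0 _ _ fin]) auto
  also have "\<dots> \<le> (\<integral>\<^sup>+x. ennreal (h x) * ennreal (K * U x powr (r - 1)) \<partial>lborel)"
    by (intro nn_integral_mono mult_left_mono inner) auto
  also have "\<dots> = (\<integral>\<^sup>+x. ennreal K * ennreal (h x * U x powr (r - 1)) \<partial>lborel)"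
    using h0 r exp_kernel_mass_pos[where 'a = 'a] by (simp add: K_def mult_ac less_imp_le flip: ennreal_mult')
  also have "\<dots> = ennreal K * (\<integral>\<^sup>+x. ennreal (h x * U x powr (r - 1)) \<partial>lborel)"
    by (intro nn_integral_cmult) measurable
  finally show ?thesis by (simp add: K_def)
qed

text \<open>
  The bound is self-improving: it controls the sum at the scales s i by the sum at the scales
  r * s i, but only to the power 1 - 1/r. Iterating over the scales r ^ k * s i, where a crude bound
  depending on the number of summands is available, closes the estimate.
\<close>

lemma sum_exp_mean_step:
  fixes h :: "'i \<Rightarrow> 'a::euclidean_space \<Rightarrow> real"
  assumes r: "1 < r" and I: "finite I" and s: "\<And>i. i \<in> I \<Longrightarrow> 0 < s i"
    and hm: "\<And>i. i \<in> I \<Longrightarrow> h i \<in> borel_measurable borel" and h0: "\<And>i x. i \<in> I \<Longrightarrow> 0 \<le> h i x"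
    and B: "0 \<le> B" "(\<integral>\<^sup>+x. ennreal ((\<Sum>i\<in>I. h i x) powr r) \<partial>lborel) \<le> ennreal B"
    and Y: "0 \<le> Y" "(\<integral>\<^sup>+x. ennreal ((\<Sum>i\<in>I. exp_mean (r * s i) (h i) x) powr r) \<partial>lborel) \<le> ennreal Y"
  shows "(\<integral>\<^sup>+x. ennreal ((\<Sum>i\<in>I. exp_mean (s i) (h i) x) powr r) \<partial>lborel)
    \<le> ennreal ((r * (r ^ DIM('a)) powr (r - 1) * (r ^ DIM('a) * exp_kernel_mass TYPE('a)))
        * (B powr (1 / r) * Y powr (1 - 1 / r)))"
proof -
  note [measurable] = hm
  define R where "R = r ^ DIM('a)"
  define c where "c = exp_kernel_mass TYPE('a)"
  have R: "0 < R" and c: "0 < c" using r by (auto simp: R_def c_def exp_kernel_mass_pos)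
  \<comment> \<open>The tails already use the enlarged scales. All of these are at least
    \<open>r * s i\<close>, hence \<open>U i\<close> varies slowly in the sense of the preceding
    lemma.\<close>
  define U where "U i x = (\<Sum>j\<in>{j\<in>I. s i \<le> s j}. exp_mean (r * s j) (h j) x)" for i x
  define V where "V x = (\<Sum>i\<in>I. exp_mean (r * s i) (h i) x)" for x
  have Um[measurable]: "U i \<in> borel_measurable borel" for i unfolding U_def by measurable
  have [measurable]: "V \<in> borel_measurable borel" unfolding V_def by measurable
  have U0: "0 \<le> U i x" and UV: "U i x \<le> V x" for i x
    unfolding U_def V_def using I by (auto intro!: sum_nonneg sum_mono2 simp: exp_mean_nonneg)
  have fin: "(\<integral>\<^sup>+x. ennreal (h i x powr r) \<partial>lborel) < \<infinity>" if i: "i \<in> I" for i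
  proof -
    have "(\<integral>\<^sup>+x. ennreal (h i x powr r) \<partial>lborel) \<le> (\<integral>\<^sup>+x. ennreal ((\<Sum>i\<in>I. h i x) powr r) \<partial>lborel)"
      using i r h0 I by (intro nn_integral_mono ennreal_leI powr_mono2 member_le_sum) auto
    also note B(2)
    finally show ?thesis by (rule le_less_trans) simp
  qed
  have slow: "U i y \<le> exp (norm (y - x) / (r * s i)) * U i x" if i: "i \<in> I" for i x y
    unfolding U_def sum_distrib_left
  proof (rule sum_mono)
    fix j assume j: "j \<in> {j\<in>I. s i \<le> s j}"
    then show "exp_mean (r * s j) (h j) y \<le> exp (norm (y - x) / (r * s i)) * exp_mean (r * s j) (h j) x"
      using r s i h0 by (intro exp_mean_translate_le[OF _ _ _ _ _ _ fin]) auto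
  qed
  have pt: "(\<Sum>i\<in>I. exp_mean (s i) (h i) x) powr r
      \<le> r * (\<Sum>i\<in>I. R powr (r - 1) * (exp_mean (s i) (h i) x * U i x powr (r - 1)))" for x
  proof -
    have "(\<Sum>i\<in>I. exp_mean (s i) (h i) x) powr r \<le> r * (\<Sum>i\<in>I. exp_mean (s i) (h i) x *
        (\<Sum>j\<in>{j\<in>I. s i \<le> s j}. exp_mean (s j) (h j) x) powr (r - 1))"
      using I r by (intro powr_sum_le_tails) (auto simp: exp_mean_nonneg)
    also have "\<dots> \<le> r * (\<Sum>i\<in>I. exp_mean (s i) (h i) x * (R * U i x) powr (r - 1))"
    proof (intro mult_left_mono sum_mono powr_mono2)
      fix i
      show "(\<Sum>j\<in>{j\<in>I. s i \<le> s j}. exp_mean (s j) (h j) x) \<le> R * U i x"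
        unfolding U_def sum_distrib_left R_def using r s h0
        by (intro sum_mono exp_mean_scale_le[OF _ _ _ _ fin]) auto
    qed (use r in \<open>auto simp: exp_mean_nonneg intro!: sum_nonneg\<close>)
    also have "\<dots> = r * (\<Sum>i\<in>I. R powr (r - 1) * (exp_mean (s i) (h i) x * U i x powr (r - 1)))"
      using R U0 by (simp add: powr_mult mult_ac)
    finally show ?thesis .
  qed
  have e0: "0 \<le> exp_mean t f x" for t and f :: "'a \<Rightarrow> real" and x by (rule exp_mean_nonneg)
  have "(\<integral>\<^sup>+x. ennreal ((\<Sum>i\<in>I. exp_mean (s i) (h i) x) powr r) \<partial>lborel)
      \<le> (\<integral>\<^sup>+x. ennreal (r * R powr (r - 1)) * (\<Sum>i\<in>I. ennreal (exp_mean (s i) (h i) x * U i x powr (r - 1))) \<partial>lborel)"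
    using pt r e0 U0 by (intro nn_integral_mono)
      (auto simp: sum_ennreal sum_distrib_left mult_ac simp flip: ennreal_mult' intro!: ennreal_leI)
  also have "\<dots> = ennreal (r * R powr (r - 1)) * (\<Sum>i\<in>I. \<integral>\<^sup>+x. ennreal (exp_mean (s i) (h i) x * U i x powr (r - 1)) \<partial>lborel)"
    by (subst nn_integral_cmult) (auto simp: nn_integral_sum)
  \<comment> \<open>Only after the average has been removed from \<open>h i\<close> may the tail be
    enlarged to the full sum \<open>V\<close>: it no longer depends on i, so the \<open>h i\<close>
    can be added up.\<close>
  also have "\<dots> \<le> ennreal (r * R powr (r - 1)) * (\<Sum>i\<in>I. ennreal (R * c) * (\<integral>\<^sup>+x. ennreal (h i x * V x powr (r - 1)) \<partial>lborel))"
  proof (intro mult_left_mono sum_mono)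
    fix i assume i: "i \<in> I"
    have "(\<integral>\<^sup>+x. ennreal (exp_mean (s i) (h i) x * U i x powr (r - 1)) \<partial>lborel)
      \<le> ennreal (R * c) * (\<integral>\<^sup>+x. ennreal (h i x * U i x powr (r - 1)) \<partial>lborel)"
      unfolding R_def c_def
      using i s r h0 U0 slow by (intro nn_integral_exp_mean_slowly_varying[OF _ _ _ _ _ _ fin]) auto
    also have "\<dots> \<le> ennreal (R * c) * (\<integral>\<^sup>+x. ennreal (h i x * V x powr (r - 1)) \<partial>lborel)"
      using i r U0 UV h0 by (intro mult_left_mono nn_integral_mono ennreal_leI powr_mono2) auto
    finally show "(\<integral>\<^sup>+x. ennreal (exp_mean (s i) (h i) x * U i x powr (r - 1)) \<partial>lborel)
      \<le> ennreal (R * c) * (\<integral>\<^sup>+x. ennreal (h i x * V x powr (r - 1)) \<partial>lborel)" .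
  qed auto
  also have "\<dots> = ennreal (r * R powr (r - 1)) * (ennreal (R * c) * (\<integral>\<^sup>+x. ennreal ((\<Sum>i\<in>I. h i x) * V x powr (r - 1)) \<partial>lborel))"
    using h0 by (simp add: sum_distrib_right sum_nonneg nn_integral_sum flip: sum_ennreal sum_distrib_left)
  also have "\<dots> \<le> ennreal (r * R powr (r - 1)) * (ennreal (R * c) * ennreal (B powr (1 / r) * Y powr (1 / (r / (r - 1)))))"
  proof (intro mult_left_mono nn_integral_Holder)
    show "(\<integral>\<^sup>+x. ennreal ((V x powr (r - 1)) powr (r / (r - 1))) \<partial>lborel) \<le> ennreal Y"
      using Y r by (simp add: powr_powr V_def)
  qed (use B Y r h0 in \<open>auto simp: sum_nonneg field_simps\<close>)
  also have "\<dots> = ennreal ((r * R powr (r - 1) * (R * c)) * (B powr (1 / r) * Y powr (1 - 1 / r)))"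
    using r R c by (simp add: diff_divide_distrib flip: ennreal_mult')
  finally show ?thesis by (simp add: R_def c_def)
qed

text \<open>The dependence on \<open>card I\<close> is harmless: the bound serves only to show that
  a quantity is finite before it is absorbed into itself.\<close>

lemma sum_exp_mean_crude:
  fixes h :: "'i \<Rightarrow> 'a::euclidean_space \<Rightarrow> real"
  assumes r: "1 < r" and I: "finite I" and s: "\<And>i. i \<in> I \<Longrightarrow> 0 < s i"
    and hm: "\<And>i. i \<in> I \<Longrightarrow> h i \<in> borel_measurable borel" and h0: "\<And>i x. i \<in> I \<Longrightarrow> 0 \<le> h i x"
    and B: "\<And>i. i \<in> I \<Longrightarrow> (\<integral>\<^sup>+x. ennreal (h i x powr r) \<partial>lborel) \<le> ennreal B"
  shows "(\<integral>\<^sup>+x. ennreal ((\<Sum>i\<in>I. exp_mean (s i) (h i) x) powr r) \<partial>lborel)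
    \<le> ennreal (card I powr r * (card I * (exp_kernel_mass TYPE('a) powr r * B)))"
proof -
  note [measurable] = hm
  have e0: "0 \<le> exp_mean t f x" for t and f :: "'a \<Rightarrow> real" and x by (rule exp_mean_nonneg)
  have "(\<integral>\<^sup>+x. ennreal ((\<Sum>i\<in>I. exp_mean (s i) (h i) x) powr r) \<partial>lborel)
     \<le> (\<integral>\<^sup>+x. ennreal (card I powr r) * (\<Sum>i\<in>I. ennreal (exp_mean (s i) (h i) x powr r)) \<partial>lborel)"
  proof (rule nn_integral_mono)
    fix x
    have "(\<Sum>i\<in>I. exp_mean (s i) (h i) x) powr r \<le> card I powr r * (\<Sum>i\<in>I. exp_mean (s i) (h i) x powr r)"
      using r I e0 by (intro powr_sum_le) auto
    then show "ennreal ((\<Sum>i\<in>I. exp_mean (s i) (h i) x) powr r)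
       \<le> ennreal (card I powr r) * (\<Sum>i\<in>I. ennreal (exp_mean (s i) (h i) x powr r))"
      by (auto simp: sum_ennreal simp flip: ennreal_mult' intro!: ennreal_leI)
  qed
  also have "\<dots> = ennreal (card I powr r) * (\<Sum>i\<in>I. \<integral>\<^sup>+x. ennreal (exp_mean (s i) (h i) x powr r) \<partial>lborel)"
    by (subst nn_integral_cmult) (auto simp: nn_integral_sum simp del: sum_ennreal)
  also have "\<dots> \<le> ennreal (card I powr r) * (\<Sum>i\<in>I. ennreal (exp_kernel_mass TYPE('a) powr r) * ennreal B)"
  proof (intro mult_left_mono sum_mono)
    fix i assume i: "i \<in> I"
    have "(\<integral>\<^sup>+x. ennreal (exp_mean (s i) (h i) x powr r) \<partial>lborel)
        \<le> ennreal (exp_kernel_mass TYPE('a) powr r) * (\<integral>\<^sup>+x. ennreal (h i x powr r) \<partial>lborel)"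
      using i s h0 r le_less_trans[OF B[OF i] ennreal_less_top]
      by (intro nn_integral_exp_mean_powr_le) auto
    also have "\<dots> \<le> ennreal (exp_kernel_mass TYPE('a) powr r) * ennreal B"
      using B[OF i] by (intro mult_left_mono) auto
    finally show "(\<integral>\<^sup>+x. ennreal (exp_mean (s i) (h i) x powr r) \<partial>lborel)
        \<le> ennreal (exp_kernel_mass TYPE('a) powr r) * ennreal B" .
  qed auto
  also have "\<dots> = ennreal (card I powr r * (card I * (exp_kernel_mass TYPE('a) powr r * B)))"
    by (simp add: ennreal_of_nat_eq_real_of_nat flip: ennreal_mult')
  finally show ?thesis .
qed

text \<open>For r > 1 this is K^r with K the constant of the one-step estimate, because y = K
  B^(1/r) y^(1 - 1/r) has the positive solution y = K^r B when K and B are positive.\<close>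

definition sum_exp_mean_const :: "'a::euclidean_space itself \<Rightarrow> real \<Rightarrow> real" where
  "sum_exp_mean_const _ r = (if r = 1 then exp_kernel_mass TYPE('a) else
     (r * (r ^ DIM('a)) powr (r - 1) * (r ^ DIM('a) * exp_kernel_mass TYPE('a))) powr r)"

lemma sum_exp_mean_const_nonneg: "0 \<le> sum_exp_mean_const TYPE('a::euclidean_space) r"
  using exp_kernel_mass_pos[where 'a = 'a] by (simp add: sum_exp_mean_const_def)

text \<open>The absorption step: a positive real x may be divided by its own power
  \<open>x powr (1 - 1 / r)\<close>.\<close>

lemma le_powr_self_bound:
  fixes x K B r :: real
  assumes x: "0 \<le> x" and KB: "0 \<le> K" "0 \<le> B" and r: "1 < r" and le: "x \<le> K * (B powr (1 / r) * x powr (1 - 1 / r))"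
  shows "x \<le> K powr r * B"
proof (cases "x = 0")
  case False
  then have pos: "0 < x" using x by simp
  have "x = x powr (1 / r) * x powr (1 - 1 / r)"
    using pos by (simp flip: powr_add)
  then have "x powr (1 / r) * x powr (1 - 1 / r) \<le> (K * B powr (1 / r)) * x powr (1 - 1 / r)"
    using le by (simp add: mult.assoc)
  then have "x powr (1 / r) \<le> K * B powr (1 / r)" using pos by simp
  then have "(x powr (1 / r)) powr r \<le> (K * B powr (1 / r)) powr r"
    using r by (intro powr_mono2) auto
  then show ?thesis using pos KB r by (simp add: powr_mult powr_powr)
qed (use KB in simp)

lemma sum_exp_mean_bound:
  fixes h :: "'i \<Rightarrow> 'a::euclidean_space \<Rightarrow> real"
  assumes r: "1 \<le> r" and I: "finite I" and s: "\<And>i. i \<in> I \<Longrightarrow> 0 < s i"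
    and hm: "\<And>i. i \<in> I \<Longrightarrow> h i \<in> borel_measurable borel" and h0: "\<And>i x. i \<in> I \<Longrightarrow> 0 \<le> h i x"
    and B: "0 \<le> B" "(\<integral>\<^sup>+x. ennreal ((\<Sum>i\<in>I. h i x) powr r) \<partial>lborel) \<le> ennreal B"
  shows "(\<integral>\<^sup>+x. ennreal ((\<Sum>i\<in>I. exp_mean (s i) (h i) x) powr r) \<partial>lborel)
    \<le> ennreal (sum_exp_mean_const TYPE('a) r * B)"
proof -
  note [measurable] = hm
  have le: "(\<integral>\<^sup>+x. ennreal (h i x powr r) \<partial>lborel) \<le> ennreal B" if i: "i \<in> I" for i
  proof -
    have "(\<integral>\<^sup>+x. ennreal (h i x powr r) \<partial>lborel) \<le> (\<integral>\<^sup>+x. ennreal ((\<Sum>i\<in>I. h i x) powr r) \<partial>lborel)"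
      using i r h0 I by (intro nn_integral_mono ennreal_leI powr_mono2 member_le_sum) auto
    also note B(2)
    finally show ?thesis .
  qed
  show ?thesis
  proof (cases "r = 1")
    \<comment> \<open>On nonnegative functions the L^1 norm is additive, so the mass bound for each
      summand suffices.\<close>
    case True
    have "(\<integral>\<^sup>+x. ennreal ((\<Sum>i\<in>I. exp_mean (s i) (h i) x) powr r) \<partial>lborel)
       = (\<Sum>i\<in>I. \<integral>\<^sup>+x. ennreal (exp_mean (s i) (h i) x) \<partial>lborel)"
      using True by (subst nn_integral_sum[symmetric]) (auto simp: exp_mean_nonneg sum_nonneg sum_ennreal)
    also have "\<dots> \<le> (\<Sum>i\<in>I. ennreal (exp_kernel_mass TYPE('a)) * (\<integral>\<^sup>+x. ennreal (h i x) \<partial>lborel))"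
    proof (rule sum_mono)
      fix i assume i: "i \<in> I"
      show "(\<integral>\<^sup>+x. ennreal (exp_mean (s i) (h i) x) \<partial>lborel)
          \<le> ennreal (exp_kernel_mass TYPE('a)) * (\<integral>\<^sup>+x. ennreal (h i x) \<partial>lborel)"
        using i s h0 le_less_trans[OF le[OF i] ennreal_less_top] r
        by (intro nn_integral_exp_mean_le[where r = r]) auto
    qed
    also have "\<dots> = ennreal (exp_kernel_mass TYPE('a)) * (\<integral>\<^sup>+x. ennreal ((\<Sum>i\<in>I. h i x) powr r) \<partial>lborel)"
      using True h0 by (simp add: sum_nonneg nn_integral_sum flip: sum_ennreal sum_distrib_left)
    also have "\<dots> \<le> ennreal (exp_kernel_mass TYPE('a)) * ennreal B"
      using B by (intro mult_left_mono) auto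
    finally show ?thesis
      using True B by (simp add: sum_exp_mean_const_def flip: ennreal_mult'')
  next
    case False
    then have r1: "1 < r" using r by simp
    define K where "K = r * (r ^ DIM('a)) powr (r - 1) * (r ^ DIM('a) * exp_kernel_mass TYPE('a))"
    have K: "0 \<le> K" using r1 exp_kernel_mass_pos[where 'a = 'a] by (simp add: K_def)
    define X where "X k = (\<integral>\<^sup>+x. ennreal ((\<Sum>i\<in>I. exp_mean (r ^ k * s i) (h i) x) powr r) \<partial>lborel)" for k
    define N where "N = card I powr r * (card I * (exp_kernel_mass TYPE('a) powr r * B))"
    have rs: "0 < r ^ k * s i" if "i \<in> I" for k i using s[OF that] r by simp
    have N: "0 \<le> N" using B by (simp add: N_def)
    have XN: "X k \<le> ennreal N" for k
      unfolding X_def N_def using r1 I rs h0 le by (intro sum_exp_mean_crude) auto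
    define y where "y k = enn2real (X k)" for k
    have Xy: "X k = ennreal (y k)" for k
      using le_less_trans[OF XN ennreal_less_top] by (simp add: y_def)
    have y0: "0 \<le> y k" for k by (simp add: y_def)
    have yN: "y k \<le> N" for k using XN[of k] N by (simp add: y_def enn2real_leI)
    \<comment> \<open>Finite thanks to the crude bound \<open>N\<close>, which does not enter the
      result. Each \<open>y k\<close> is estimated through \<open>y (Suc k)\<close>, hence through
      S, so that S is bounded by its own power and can be absorbed.\<close>
    define S where "S = (SUP k. y k)"
    have bdd: "bdd_above (range y)" using yN by (intro bdd_aboveI[of _ N]) auto
    have yS: "y k \<le> S" for k unfolding S_def by (intro cSUP_upper bdd) auto
    have S0: "0 \<le> S" using y0[of 0] yS[of 0] by simp
    have "y k \<le> K * (B powr (1 / r) * S powr (1 - 1 / r))" for k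
    proof -
      have "X k \<le> ennreal (K * (B powr (1 / r) * y (Suc k) powr (1 - 1 / r)))"
        unfolding X_def K_def
      proof (rule sum_exp_mean_step)
        show "(\<integral>\<^sup>+x. ennreal ((\<Sum>i\<in>I. exp_mean (r * (r ^ k * s i)) (h i) x) powr r) \<partial>lborel) \<le> ennreal (y (Suc k))"
          using Xy[of "Suc k"] by (simp add: X_def mult.assoc)
      qed (use r1 I rs hm h0 B y0 in auto)
      then have "y k \<le> K * (B powr (1 / r) * y (Suc k) powr (1 - 1 / r))"
        unfolding y_def[of k] using K by (intro enn2real_leI) auto
      also have "\<dots> \<le> K * (B powr (1 / r) * S powr (1 - 1 / r))"
        using K r1 y0 yS by (intro mult_left_mono powr_mono2) auto
      finally show ?thesis .
    qed
    then have "S \<le> K * (B powr (1 / r) * S powr (1 - 1 / r))"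
      unfolding S_def by (intro cSUP_least) auto
    then have "S \<le> K powr r * B" using S0 K B r1 by (intro le_powr_self_bound) auto
    then have "y 0 \<le> K powr r * B" using yS[of 0] by simp
    then have "X 0 \<le> ennreal (K powr r * B)" by (simp add: Xy ennreal_leI)
    then show ?thesis using r1 by (simp add: X_def K_def sum_exp_mean_const_def)
  qed
qed

section \<open>Square functions of the averages\<close>

lemma L2_set_powr: "L2_set a I powr p = (\<Sum>i\<in>I. (a i)\<^sup>2) powr (p / 2)"
  by (simp add: L2_set_def powr_half_sqrt[symmetric] powr_powr sum_nonneg)

text \<open>For p \<ge> 2, Jensen's inequality for squares contributes the mass to the power p / 2,
  and the summation bound is used with exponent p / 2. For p < 2 the constant of the dual exponent
  is converted to a norm constant by the power 1 - 1/p, and back to p-th powers by the outer power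
  p.\<close>

definition exp_mean_square_const :: "'a::euclidean_space itself \<Rightarrow> real \<Rightarrow> real" where
  "exp_mean_square_const _ p =
    (let C = (\<lambda>p. exp_kernel_mass TYPE('a) powr (p / 2) * sum_exp_mean_const TYPE('a) (p / 2))
     in if 2 \<le> p then C p else (C (p / (p - 1)) powr (1 - 1 / p)) powr p)"

lemma exp_mean_square_const_nonneg: "0 \<le> exp_mean_square_const TYPE('a::euclidean_space) p"
  by (simp add: exp_mean_square_const_def Let_def sum_exp_mean_const_nonneg)

lemma exp_mean_square_function_ge2:
  fixes g :: "'i \<Rightarrow> 'a::euclidean_space \<Rightarrow> real"
  assumes p: "2 \<le> p"
    and I: "finite I" and s: "\<And>i. i \<in> I \<Longrightarrow> 0 < s i"
    and gm: "\<And>i. i \<in> I \<Longrightarrow> g i \<in> borel_measurable borel" and g0: "\<And>i x. i \<in> I \<Longrightarrow> 0 \<le> g i x" and B: "0 \<le> B"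
    and gB: "(\<integral>\<^sup>+x. ennreal (L2_set (\<lambda>i. g i x) I powr p) \<partial>lborel) \<le> ennreal B"
  shows "(\<integral>\<^sup>+x. ennreal (L2_set (\<lambda>i. exp_mean (s i) (g i) x) I powr p) \<partial>lborel)
    \<le> ennreal (exp_mean_square_const TYPE('a) p * B)"
proof -
  define r where "r = p / 2"
  have r: "1 \<le> r" using p by (simp add: r_def)
  define c where "c = exp_kernel_mass TYPE('a)"
  have c: "0 < c" by (simp add: c_def exp_kernel_mass_pos)
  define C where "C = c powr r * sum_exp_mean_const TYPE('a) r"
  note [measurable] = gm
  define h where "h i x = (g i x)\<^sup>2" for i x
  have hm[measurable]: "i \<in> I \<Longrightarrow> h i \<in> borel_measurable borel" for i unfolding h_def by measurable
  have h0: "0 \<le> h i x" for i x by (simp add: h_def)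
  have hB: "(\<integral>\<^sup>+x. ennreal ((\<Sum>i\<in>I. h i x) powr r) \<partial>lborel) \<le> ennreal B"
    using gB by (simp add: L2_set_powr h_def r_def)
  have pt: "L2_set (\<lambda>i. exp_mean (s i) (g i) x) I powr p \<le> c powr r * (\<Sum>i\<in>I. exp_mean (s i) (h i) x) powr r" for x
  proof -
    have "(\<Sum>i\<in>I. (exp_mean (s i) (g i) x)\<^sup>2) \<le> c * (\<Sum>i\<in>I. exp_mean (s i) (h i) x)"
      unfolding sum_distrib_left
    proof (rule sum_mono)
      fix i assume i: "i \<in> I"
      have sq: "g i x powr 2 = h i x" for x using g0[OF i, of x] by (simp add: h_def)
      have "(\<integral>\<^sup>+x. ennreal (h i x powr r) \<partial>lborel) \<le> (\<integral>\<^sup>+x. ennreal ((\<Sum>i\<in>I. h i x) powr r) \<partial>lborel)"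
        using i r h0 I by (intro nn_integral_mono ennreal_leI powr_mono2 member_le_sum) auto
      also note hB
      also have "ennreal B < \<infinity>" by simp
      finally have fin: "(\<integral>\<^sup>+x. ennreal ((g i x powr 2) powr r) \<partial>lborel) < \<infinity>" by (simp add: sq)
      \<comment> \<open>Jensen's inequality with exponent 2; the square of \<open>g i\<close> is
        known only to lie in L^(p/2), which is what \<open>fin\<close> says.\<close>
      have "exp_mean (s i) (g i) x powr 2 \<le> c powr (2 - 1) * exp_mean (s i) (\<lambda>x. g i x powr 2) x"
        unfolding c_def using i by (intro exp_mean_powr_le[OF s _ _ _ r fin]) (auto intro: g0)
      then show "(exp_mean (s i) (g i) x)\<^sup>2 \<le> c * exp_mean (s i) (h i) x"
        using c by (simp add: sq exp_mean_nonneg)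
    qed
    then have "(\<Sum>i\<in>I. (exp_mean (s i) (g i) x)\<^sup>2) powr r \<le> (c * (\<Sum>i\<in>I. exp_mean (s i) (h i) x)) powr r"
      using r by (intro powr_mono2 sum_nonneg) auto
    then show ?thesis using c by (simp add: L2_set_powr r_def powr_mult sum_nonneg exp_mean_nonneg)
  qed
  have "(\<integral>\<^sup>+x. ennreal (L2_set (\<lambda>i. exp_mean (s i) (g i) x) I powr p) \<partial>lborel)
    \<le> (\<integral>\<^sup>+x. ennreal (c powr r) * ennreal ((\<Sum>i\<in>I. exp_mean (s i) (h i) x) powr r) \<partial>lborel)"
    using pt by (intro nn_integral_mono) (auto simp flip: ennreal_mult' intro!: ennreal_leI)
  also have "\<dots> = ennreal (c powr r) * (\<integral>\<^sup>+x. ennreal ((\<Sum>i\<in>I. exp_mean (s i) (h i) x) powr r) \<partial>lborel)"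
    by (intro nn_integral_cmult) measurable
  also have "\<dots> \<le> ennreal (c powr r) * ennreal (sum_exp_mean_const TYPE('a) r * B)"
    using r I s hm h0 B hB by (intro mult_left_mono sum_exp_mean_bound) auto
  finally show ?thesis
    using p by (simp add: C_def c_def r_def exp_mean_square_const_def mult.assoc flip: ennreal_mult')
qed

text \<open>Self-adjointness moves the averages onto the test family \<phi>, where the bound for the
  dual exponent q \<ge> 2 applies; Hoelder's inequality then bounds \<open>X\<close> by its own
  power 1 / q = 1 - 1 / p.\<close>

lemma exp_mean_square_function_less2:
  fixes g :: "'i \<Rightarrow> 'a::euclidean_space \<Rightarrow> real"
  assumes p: "1 < p" "p < 2"
    and I: "finite I" and s: "\<And>i. i \<in> I \<Longrightarrow> 0 < s i"
    and gm: "\<And>i. i \<in> I \<Longrightarrow> g i \<in> borel_measurable borel" and g0: "\<And>i x. i \<in> I \<Longrightarrow> 0 \<le> g i x" and B: "0 \<le> B"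
    and gB: "(\<integral>\<^sup>+x. ennreal (L2_set (\<lambda>i. g i x) I powr p) \<partial>lborel) \<le> ennreal B"
  shows "(\<integral>\<^sup>+x. ennreal (L2_set (\<lambda>i. exp_mean (s i) (g i) x) I powr p) \<partial>lborel)
    \<le> ennreal (exp_mean_square_const TYPE('a) p * B)"
proof -
  define q where "q = p / (p - 1)"
  have q: "2 \<le> q" "1 < q" and pq: "1 / q = 1 - 1 / p" "1 / p + 1 / q = 1" using p by (auto simp: q_def field_simps)
  define Cq where "Cq = exp_mean_square_const TYPE('a) q"
  have Cq: "0 \<le> Cq" by (simp add: Cq_def exp_mean_square_const_nonneg)
  note [measurable] = gm
  define u where "u i = exp_mean (s i) (g i)" for i
  define F where "F x = L2_set (\<lambda>i. u i x) I" for x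
  \<comment> \<open>testing the square function F against the family that extremizes the duality pairing\<close>
  define \<phi> where "\<phi> i x = u i x * F x powr (p - 2)" for i x
  have um[measurable]: "i \<in> I \<Longrightarrow> u i \<in> borel_measurable borel" for i unfolding u_def by measurable
  have [measurable]: "F \<in> borel_measurable borel" unfolding F_def L2_set_def by measurable
  have \<phi>m[measurable]: "i \<in> I \<Longrightarrow> \<phi> i \<in> borel_measurable borel" for i unfolding \<phi>_def by measurable
  have u0: "0 \<le> u i x" for i x by (simp add: u_def exp_mean_nonneg)
  have F0: "0 \<le> F x" for x by (simp add: F_def L2_set_nonneg)
  have \<phi>0: "0 \<le> \<phi> i x" for i x by (simp add: \<phi>_def u0)
  have gp: "(\<integral>\<^sup>+x. ennreal (g i x powr p) \<partial>lborel) \<le> ennreal B" if i: "i \<in> I" for i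
  proof -
    have "(\<integral>\<^sup>+x. ennreal (g i x powr p) \<partial>lborel) \<le> (\<integral>\<^sup>+x. ennreal (L2_set (\<lambda>i. g i x) I powr p) \<partial>lborel)"
      using i p g0 I by (intro nn_integral_mono ennreal_leI powr_mono2 member_le_L2_set) auto
    then show ?thesis using gB by (rule order_trans)
  qed
  define X where "X = enn2real (\<integral>\<^sup>+x. ennreal (F x powr p) \<partial>lborel)"
  \<comment> \<open>Finiteness of \<open>X\<close> must be known in advance, as \<open>X\<close> is
    later divided by a power of itself.\<close>
  have "(\<integral>\<^sup>+x. ennreal (F x powr p) \<partial>lborel) \<le> (\<integral>\<^sup>+x. ennreal ((\<Sum>i\<in>I. exp_mean (s i) (g i) x) powr p) \<partial>lborel)"
    unfolding F_def u_def using p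
    by (intro nn_integral_mono ennreal_leI powr_mono2 L2_set_le_sum) (auto simp: exp_mean_nonneg L2_set_nonneg)
  also have "\<dots> \<le> ennreal (card I powr p * (card I * (exp_kernel_mass TYPE('a) powr p * B)))"
    using p I s g0 gp by (intro sum_exp_mean_crude) auto
  also have "\<dots> < \<infinity>" by simp
  finally have X: "(\<integral>\<^sup>+x. ennreal (F x powr p) \<partial>lborel) = ennreal X" by (simp add: X_def)
  have X0: "0 \<le> X" by (simp add: X_def)
  \<comment> \<open>The l2 norm of \<phi> is F^(p - 1), and (p - 1) q = p. The negative exponent p -
    2 is harmless where F = 0, because \<phi> is 0 there.\<close>
  have L2\<phi>: "L2_set (\<lambda>i. \<phi> i x) I powr q = F x powr p" for x
  proof -
    have "L2_set (\<lambda>i. \<phi> i x) I = F x powr (p - 2) * F x"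
      using L2_set_right_distrib[of "F x powr (p - 2)" "\<lambda>i. u i x" I]
      by (simp add: \<phi>_def F_def mult.commute)
    also have "\<dots> = F x powr (p - 1)"
      using F0[of x] by (cases "F x = 0") (auto simp: powr_diff power2_eq_square)
    finally show ?thesis using p by (simp add: powr_powr q_def)
  qed
  have \<phi>q: "(\<integral>\<^sup>+x. ennreal (\<phi> i x powr q) \<partial>lborel) < \<infinity>" if i: "i \<in> I" for i
  proof -
    have "(\<integral>\<^sup>+x. ennreal (\<phi> i x powr q) \<partial>lborel) \<le> (\<integral>\<^sup>+x. ennreal (L2_set (\<lambda>i. \<phi> i x) I powr q) \<partial>lborel)"
      using i q \<phi>0 I by (intro nn_integral_mono ennreal_leI powr_mono2 member_le_L2_set) auto
    also have "\<dots> < \<infinity>" by (simp add: L2\<phi> X)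
    finally show ?thesis .
  qed
  have E\<phi>: "(\<integral>\<^sup>+x. ennreal (L2_set (\<lambda>i. exp_mean (s i) (\<phi> i) x) I powr q) \<partial>lborel) \<le> ennreal (Cq * X)"
    unfolding Cq_def using q I s \<phi>m \<phi>0 X0
    by (intro exp_mean_square_function_ge2) (auto simp: L2\<phi> X)
  have "ennreal X = (\<integral>\<^sup>+x. (\<Sum>i\<in>I. ennreal (u i x * \<phi> i x)) \<partial>lborel)"
    unfolding X[symmetric]
  proof (rule nn_integral_cong)
    fix x
    have "(\<Sum>i\<in>I. u i x * \<phi> i x) = (\<Sum>i\<in>I. (u i x)\<^sup>2) * F x powr (p - 2)"
      by (simp add: \<phi>_def sum_distrib_right power2_eq_square mult.assoc)
    also have "(\<Sum>i\<in>I. (u i x)\<^sup>2) = F x ^ 2"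
      by (simp add: F_def L2_set_def sum_nonneg)
    also have "\<dots> * F x powr (p - 2) = F x powr p"
      using F0[of x] by (cases "F x = 0") (auto simp: powr_diff)
    finally show "ennreal (F x powr p) = (\<Sum>i\<in>I. ennreal (u i x * \<phi> i x))"
      using u0 \<phi>0 by (simp add: sum_ennreal)
  qed
  also have "\<dots> = (\<Sum>i\<in>I. \<integral>\<^sup>+x. ennreal (u i x * \<phi> i x) \<partial>lborel)"
    by (intro nn_integral_sum) measurable
  also have "\<dots> = (\<Sum>i\<in>I. \<integral>\<^sup>+x. ennreal (g i x * exp_mean (s i) (\<phi> i) x) \<partial>lborel)"
  proof (rule sum.cong)
    fix i assume i: "i \<in> I"
    have "(\<integral>\<^sup>+x. ennreal (u i x * \<phi> i x) \<partial>lborel)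
      = (\<integral>\<^sup>+z. ennreal (g i z) * (\<integral>\<^sup>+y. ennreal (exp_kernel (s i) z y * \<phi> i y) \<partial>lborel) \<partial>lborel)"
      unfolding u_def using i p s g0 \<phi>0 le_less_trans[OF gp[OF i] ennreal_less_top]
      by (intro nn_integral_exp_mean_mult[where r = p]) auto
    also have "\<dots> = (\<integral>\<^sup>+x. ennreal (g i x * exp_mean (s i) (\<phi> i) x) \<partial>lborel)"
    proof (rule nn_integral_cong)
      fix z
      have "(\<integral>\<^sup>+y. ennreal (exp_kernel (s i) z y * \<phi> i y) \<partial>lborel) = ennreal (exp_mean (s i) (\<phi> i) z)"
        using i s \<phi>0 q \<phi>q[OF i] by (intro ennreal_exp_mean[symmetric, where r = q]) auto
      then show "ennreal (g i z) * (\<integral>\<^sup>+y. ennreal (exp_kernel (s i) z y * \<phi> i y) \<partial>lborel)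
          = ennreal (g i z * exp_mean (s i) (\<phi> i) z)"
        using g0[OF i] by (simp add: ennreal_mult')
    qed
    finally show "(\<integral>\<^sup>+x. ennreal (u i x * \<phi> i x) \<partial>lborel) = (\<integral>\<^sup>+x. ennreal (g i x * exp_mean (s i) (\<phi> i) x) \<partial>lborel)" .
  qed simp
  also have "\<dots> = (\<integral>\<^sup>+x. (\<Sum>i\<in>I. ennreal (g i x * exp_mean (s i) (\<phi> i) x)) \<partial>lborel)"
    by (intro nn_integral_sum[symmetric]) measurable
  also have "\<dots> \<le> (\<integral>\<^sup>+x. ennreal (L2_set (\<lambda>i. g i x) I * L2_set (\<lambda>i. exp_mean (s i) (\<phi> i) x) I) \<partial>lborel)"
  proof (rule nn_integral_mono)
    fix x
    show "(\<Sum>i\<in>I. ennreal (g i x * exp_mean (s i) (\<phi> i) x)) \<le> ennreal (L2_set (\<lambda>i. g i x) I * L2_set (\<lambda>i. exp_mean (s i) (\<phi> i) x) I)"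
      using L2_set_mult_ineq[of "\<lambda>i. g i x" "\<lambda>i. exp_mean (s i) (\<phi> i) x" I] g0
      by (simp add: sum_ennreal exp_mean_nonneg ennreal_leI)
  qed
  also have "\<dots> \<le> ennreal (B powr (1 / p) * (Cq * X) powr (1 / q))"
    using p q pq B Cq X0 gB E\<phi> by (intro nn_integral_Holder) (auto simp: L2_set_nonneg L2_set_def sum_nonneg)
  finally have "X \<le> B powr (1 / p) * (Cq * X) powr (1 / q)" by simp
  also have "\<dots> = Cq powr (1 / q) * (B powr (1 / p) * X powr (1 - 1 / p))"
    using Cq X0 by (simp add: powr_mult pq(1) mult_ac)
  finally have "X \<le> (Cq powr (1 / q)) powr p * B"
    using X0 Cq B p by (intro le_powr_self_bound[where K = "Cq powr (1 / q)"]) auto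
  also have "(Cq powr (1 / q)) powr p = exp_mean_square_const TYPE('a) p"
    using p q by (simp add: Cq_def exp_mean_square_const_def Let_def pq(1) flip: q_def)
  finally show ?thesis
    using X unfolding F_def u_def by (simp add: ennreal_leI)
qed

lemma exp_mean_square_function:
  fixes g :: "'i \<Rightarrow> 'a::euclidean_space \<Rightarrow> real"
  assumes p: "1 < p"
    and I: "finite I" and s: "\<And>i. i \<in> I \<Longrightarrow> 0 < s i"
    and gm: "\<And>i. i \<in> I \<Longrightarrow> g i \<in> borel_measurable borel" and g0: "\<And>i x. i \<in> I \<Longrightarrow> 0 \<le> g i x" and B: "0 \<le> B"
    and gB: "(\<integral>\<^sup>+x. ennreal (L2_set (\<lambda>i. g i x) I powr p) \<partial>lborel) \<le> ennreal B"
  shows "(\<integral>\<^sup>+x. ennreal (L2_set (\<lambda>i. exp_mean (s i) (g i) x) I powr p) \<partial>lborel)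
    \<le> ennreal (exp_mean_square_const TYPE('a) p * B)"
  using exp_mean_square_function_ge2[OF _ I s gm g0 B gB] exp_mean_square_function_less2[OF p _ I s gm g0 B gB]
  by (cases "2 \<le> p") auto

section \<open>The operators S(t)\<close>

text \<open>Since min x 1 = x / max x 1, passing from a to b multiplies the minimum by (b / a)
  \<rho>, where \<rho> lies between 1 and max a 1. The comparison is thus homogeneous up to a loss
  that occurs only for a > 1.\<close>

lemma min_one_powr_le:
  fixes a b \<beta> :: real
  assumes "0 < b" "b \<le> a"
  shows "min b 1 powr (- \<beta>) \<le> min a 1 powr (- \<beta>) * (a / b) powr \<beta> * max a 1 powr \<bar>\<beta>\<bar>"
proof -
  define \<rho> where "\<rho> = max a 1 / max b 1"
  have \<rho>: "1 \<le> \<rho>" "\<rho> \<le> max a 1" using assms by (auto simp: \<rho>_def field_simps max_def)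
  have "min b 1 = min a 1 * (b / a) * \<rho>"
    using assms by (auto simp: \<rho>_def min_def max_def field_simps)
  then have "min b 1 powr (- \<beta>) = min a 1 powr (- \<beta>) * (b / a) powr (- \<beta>) * \<rho> powr (- \<beta>)"
    using assms \<rho> by (simp add: powr_mult del: times_divide_eq_right times_divide_eq_left)
  also have "(b / a) powr (- \<beta>) = (a / b) powr \<beta>"
    using assms by (simp add: powr_divide powr_minus field_simps)
  also have "min a 1 powr (- \<beta>) * (a / b) powr \<beta> * \<rho> powr (- \<beta>)
      \<le> min a 1 powr (- \<beta>) * (a / b) powr \<beta> * max a 1 powr \<bar>\<beta>\<bar>"
  proof (rule mult_left_mono)
    have "\<rho> powr (- \<beta>) \<le> \<rho> powr \<bar>\<beta>\<bar>" using \<rho> by (intro powr_mono) auto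
    also have "\<dots> \<le> max a 1 powr \<bar>\<beta>\<bar>" using \<rho> by (intro powr_mono2) auto
    finally show "\<rho> powr (- \<beta>) \<le> max a 1 powr \<bar>\<beta>\<bar>" .
  qed auto
  finally show ?thesis .
qed

text \<open>Completing the square: (d - \<kappa> / 2)^2 / \<kappa> is nonnegative.\<close>

lemma gaussian_le_exp:
  fixes d \<kappa> :: real
  assumes "0 < \<kappa>"
  shows "exp (- (d\<^sup>2 / \<kappa>)) \<le> exp (\<kappa> / 4) * exp (- d)"
proof -
  have "0 \<le> (d - \<kappa> / 2)\<^sup>2 / \<kappa>" using assms by simp
  also have "\<dots> = d\<^sup>2 / \<kappa> - d + \<kappa> / 4" using assms by (simp add: power2_eq_square field_simps)
  finally show ?thesis by (simp add: mult_exp_exp)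
qed

text \<open>Here a, b, d stand for |y|, |z|, |y - z| in units of sqrt t. The exponential term serves
  a \<sim> b with a > 1; in the remaining regimes, a \<le> 1 or b \<le> a / 2, the homogeneous term
  suffices.\<close>

lemma weighted_gaussian_bound_ordered:
  fixes \<alpha> \<beta> \<gamma> \<kappa> M :: real
  assumes \<kappa>: "0 < \<kappa>" and \<alpha>\<beta>: "\<alpha> + \<beta> \<le> M"
  obtains C where "0 \<le> C"
    "\<And>a b d. 0 < b \<Longrightarrow> b \<le> a \<Longrightarrow> a - b \<le> d \<Longrightarrow>
      min a 1 powr (- \<alpha>) * min b 1 powr (- \<beta>) * exp (- (d\<^sup>2 / \<kappa>)) * (a / b) powr \<gamma>
      \<le> C * (exp (- d) + a powr (- M) * (a / b) powr (\<beta> + \<gamma>))"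
proof
  \<comment> \<open>Chosen so that 2 r \<ge> \<bar>\<beta>\<bar> + M; the summand 1 keeps r
    positive, as \<open>powr_le_exp\<close> demands.\<close>
  define r where "r = (\<bar>\<beta>\<bar> + \<bar>M\<bar> + 1) / 2"
  have r: "0 < r" by (simp add: r_def add_nonneg_pos)
  define K1 where "K1 = (4 * \<kappa>) powr r * r powr r"
  define K2 where "K2 = 2 powr \<bar>\<beta>\<bar> * 2 powr \<bar>\<gamma>\<bar> * exp (\<kappa> / 4)"
  define C where "C = 1 + K1 + K2"
  have K0: "0 \<le> K1" "0 \<le> K2" by (auto simp: K1_def K2_def)
  show "0 \<le> C" using K0 by (simp add: C_def)
  fix a b d :: real assume b: "0 < b" and ab: "b \<le> a" and d: "a - b \<le> d"
  define G where "G = exp (- (d\<^sup>2 / \<kappa>))"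
  define L where "L = min a 1 powr (- \<alpha>) * min b 1 powr (- \<beta>) * G * (a / b) powr \<gamma>"
  define P where "P = (a / b) powr (\<beta> + \<gamma>)"
  define T where "T = a powr (- M) * P"
  have a: "0 < a" using b ab by simp
  have T0: "0 \<le> T" by (simp add: T_def P_def)
  have G01: "0 \<le> G" "G \<le> 1" using \<kappa> by (auto simp: G_def)
  have general: "L \<le> min a 1 powr (- (\<alpha> + \<beta>)) * max a 1 powr \<bar>\<beta>\<bar> * G * P"
  proof -
    have "L = min b 1 powr (- \<beta>) * (min a 1 powr (- \<alpha>) * G * (a / b) powr \<gamma>)" by (simp add: L_def)
    also have "\<dots> \<le> (min a 1 powr (- \<beta>) * (a / b) powr \<beta> * max a 1 powr \<bar>\<beta>\<bar>) * (min a 1 powr (- \<alpha>) * G * (a / b) powr \<gamma>)"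
      using b ab G01 by (intro mult_right_mono min_one_powr_le) auto
    also have "\<dots> = (min a 1 powr (- \<beta>) * min a 1 powr (- \<alpha>)) * max a 1 powr \<bar>\<beta>\<bar> * G * ((a / b) powr \<beta> * (a / b) powr \<gamma>)"
      by (simp add: mult_ac)
    also have "\<dots> = min a 1 powr (- (\<alpha> + \<beta>)) * max a 1 powr \<bar>\<beta>\<bar> * G * P"
      unfolding P_def powr_add[symmetric] by (simp add: add.commute)
    finally show ?thesis .
  qed
  have "L \<le> C * (exp (- d) + T)"
  proof (cases "a \<le> 1")
    \<comment> \<open>Near the origin the Gaussian is merely bounded by 1, and \<alpha> + \<beta>
      \<le> M turns a^(-(\<alpha> + \<beta>)) into a^(-M).\<close>
    case True
    have "L \<le> a powr (- (\<alpha> + \<beta>)) * (G * P)" using general True by (simp add: mult.assoc)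
    also have "\<dots> \<le> a powr (- M) * (1 * P)"
      using True a \<alpha>\<beta> G01 by (intro mult_mono powr_mono') (auto simp: P_def)
    also have "\<dots> \<le> 1 * (exp (- d) + T)" by (simp add: T_def)
    also have "\<dots> \<le> C * (exp (- d) + T)" using K0 T0 by (intro mult_right_mono) (auto simp: C_def)
    finally show ?thesis .
  next
    case a1: False
    show ?thesis
    proof (cases "b \<le> a / 2")
      \<comment> \<open>The points are far apart, d \<ge> a / 2, so the Gaussian decays in a^2 and
        beats the power a^(\<bar>\<beta>\<bar> + M).\<close>
      case True
      have d2: "a / 2 \<le> d" using True d by simp
      define x where "x = a\<^sup>2 / (4 * \<kappa>)"
      have x: "0 \<le> x" using \<kappa> by (simp add: x_def)
      have "(a / 2)\<^sup>2 / \<kappa> \<le> d\<^sup>2 / \<kappa>" using d2 a \<kappa> by (intro divide_right_mono power_mono) auto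
      then have Gx: "G \<le> exp (- x)" by (simp add: G_def x_def power_divide)
      have "a powr (\<bar>\<beta>\<bar> + M) \<le> a powr (2 * r)" using a1 by (intro powr_mono) (auto simp: r_def)
      also have "\<dots> = (4 * \<kappa> * x) powr r"
        using a \<kappa> by (simp add: x_def powr_powr[symmetric] powr_numeral)
      also have "\<dots> = (4 * \<kappa>) powr r * x powr r" using \<kappa> x by (simp add: powr_mult)
      also have "\<dots> \<le> (4 * \<kappa>) powr r * (r powr r * exp x)"
        using x r by (intro mult_left_mono powr_le_exp) auto
      finally have "a powr (\<bar>\<beta>\<bar> + M) * exp (- x) \<le> (K1 * exp x) * exp (- x)"
        by (intro mult_right_mono) (auto simp: K1_def mult_ac)
      then have *: "a powr (\<bar>\<beta>\<bar> + M) * exp (- x) \<le> K1" by (simp add: exp_minus field_simps)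
      have "L \<le> a powr \<bar>\<beta>\<bar> * G * P" using general a1 by simp
      also have "\<dots> \<le> a powr \<bar>\<beta>\<bar> * exp (- x) * P"
        using Gx by (intro mult_right_mono mult_left_mono) (auto simp: P_def)
      also have "a powr \<bar>\<beta>\<bar> * exp (- x) = (a powr (\<bar>\<beta>\<bar> + M) * exp (- x)) * a powr (- M)"
        using a by (simp add: powr_add powr_minus)
      also have "\<dots> * P \<le> K1 * a powr (- M) * P"
        using * by (intro mult_right_mono) (auto simp: P_def)
      also have "\<dots> = K1 * T" by (simp add: T_def)
      also have "\<dots> \<le> C * (exp (- d) + T)" using K0 T0 by (intro mult_mono) (auto simp: C_def)
      finally show ?thesis .
    next
      \<comment> \<open>Here b > 1/2 and a / b < 2: all power factors are comparable to 1, and only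
        the Gaussian has to be estimated.\<close>
      case False
      have 1: "min b 1 powr (- \<beta>) \<le> 2 powr \<bar>- \<beta>\<bar> * 1 powr (- \<beta>)"
        using a1 False b by (intro powr_le_powr_comparable) auto
      have 2: "(a / b) powr \<gamma> \<le> 2 powr \<bar>\<gamma>\<bar> * 1 powr \<gamma>"
        using ab False b by (intro powr_le_powr_comparable) (auto simp: field_simps)
      have "L = min b 1 powr (- \<beta>) * (a / b) powr \<gamma> * G" using a1 by (simp add: L_def mult_ac)
      also have "\<dots> \<le> (2 powr \<bar>\<beta>\<bar>) * (2 powr \<bar>\<gamma>\<bar>) * (exp (\<kappa> / 4) * exp (- d))"
        unfolding G_def using 1 2 by (intro mult_mono gaussian_le_exp \<kappa>) auto
      also have "\<dots> = K2 * exp (- d)" by (simp add: K2_def)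
      also have "\<dots> \<le> C * (exp (- d) + T)" using K0 T0 by (intro mult_mono) (auto simp: C_def)
      finally show ?thesis .
    qed
  qed
  then show "min a 1 powr (- \<alpha>) * min b 1 powr (- \<beta>) * exp (- (d\<^sup>2 / \<kappa>)) * (a / b) powr \<gamma>
      \<le> C * (exp (- d) + a powr (- M) * (a / b) powr (\<beta> + \<gamma>))"
    by (simp add: L_def G_def T_def P_def)
qed

text \<open>The factor (|y| / |z|)^\<gamma> is the conjugation by the weight. Rescaling by s = sqrt
  t reduces the claim to the numbers a, b, d of the preceding lemma.\<close>

lemma weighted_gaussian_bound:
  fixes \<alpha> \<beta> \<gamma> \<kappa> :: real
  assumes \<kappa>: "0 < \<kappa>" and \<alpha>\<beta>: "\<alpha> + \<beta> \<le> DIM('a::euclidean_space)"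
  obtains C where "0 \<le> C"
    "\<And>(y::'a) z t. y \<noteq> 0 \<Longrightarrow> z \<noteq> 0 \<Longrightarrow> 0 < t \<Longrightarrow>
      t powr (- (DIM('a) / 2)) * min (norm y / sqrt t) 1 powr (- \<alpha>)
        * (min (norm z / sqrt t) 1 powr (- \<beta>) * exp (- ((norm (y - z))\<^sup>2 / (\<kappa> * t)))) * (norm y / norm z) powr \<gamma>
      \<le> C * (exp_kernel (sqrt t) y z + hardy_kernel (\<beta> + \<gamma>) y z + hardy_kernel (\<alpha> - \<gamma>) z y)"
proof -
  define D where "D = real DIM('a)"
  obtain C1 where C1: "0 \<le> C1" "\<And>a b d. 0 < b \<Longrightarrow> b \<le> a \<Longrightarrow> a - b \<le> d \<Longrightarrow>
      min a 1 powr (- \<alpha>) * min b 1 powr (- \<beta>) * exp (- (d\<^sup>2 / \<kappa>)) * (a / b) powr \<gamma>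
      \<le> C1 * (exp (- d) + a powr (- D) * (a / b) powr (\<beta> + \<gamma>))"
    using weighted_gaussian_bound_ordered[of \<kappa> \<alpha> \<beta> D \<gamma>] assms D_def by blast
  \<comment> \<open>For |y| < |z| the roles of y and z are exchanged, which swaps \<alpha> and
    \<beta> and changes the sign of \<gamma>.\<close>
  obtain C2 where C2: "0 \<le> C2" "\<And>a b d. 0 < b \<Longrightarrow> b \<le> a \<Longrightarrow> a - b \<le> d \<Longrightarrow>
      min a 1 powr (- \<beta>) * min b 1 powr (- \<alpha>) * exp (- (d\<^sup>2 / \<kappa>)) * (a / b) powr (- \<gamma>)
      \<le> C2 * (exp (- d) + a powr (- D) * (a / b) powr (\<alpha> + - \<gamma>))"
    using weighted_gaussian_bound_ordered[of \<kappa> \<beta> \<alpha> D "- \<gamma>"] assms D_def by (metis add.commute)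
  show ?thesis
  proof (rule that)
    show "0 \<le> C1 + C2" using C1 C2 by simp
    fix y z :: 'a and t :: real
    assume y: "y \<noteq> 0" and z: "z \<noteq> 0" and t: "0 < t"
    define s where "s = sqrt t"
    have s: "0 < s" "t = s\<^sup>2" using t by (auto simp: s_def)
    define a b d where "a = norm y / s" and "b = norm z / s" and "d = norm (y - z) / s"
    have ab: "0 < a" "0 < b" using y z s by (auto simp: a_def b_def)
    have d: "a - b \<le> d" "b - a \<le> d"
      using s norm_triangle_ineq2[of y z] norm_triangle_ineq2[of z y]
      by (auto simp: a_def b_def d_def norm_minus_commute simp flip: diff_divide_distrib intro!: divide_right_mono)
    define L where "L = min a 1 powr (- \<alpha>) * min b 1 powr (- \<beta>) * exp (- (d\<^sup>2 / \<kappa>)) * (a / b) powr \<gamma>"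
    have sD: "t powr (- (DIM('a) / 2)) = s powr (- D)"
    proof -
      have "t = s powr 2" using s by (simp add: powr_numeral)
      then show ?thesis by (simp add: powr_powr D_def)
    qed
    have E: "s powr (- D) * exp (- d) = exp_kernel s y z"
      using s by (simp add: exp_kernel_def d_def D_def powr_minus powr_realpow norm_minus_commute field_simps)
    \<comment> \<open>All powers of s cancel; this is why the Hardy kernels do not depend on
      t.\<close>
    have H1: "s powr (- D) * (a powr (- D) * (a / b) powr (\<beta> + \<gamma>)) = norm y powr ((\<beta> + \<gamma>) - D) * norm z powr (- (\<beta> + \<gamma>))"
      using s y z by (simp add: a_def b_def powr_divide powr_minus powr_diff powr_add field_simps)
    have H2: "s powr (- D) * (b powr (- D) * (b / a) powr (\<alpha> + - \<gamma>)) = norm z powr ((\<alpha> - \<gamma>) - D) * norm y powr (- (\<alpha> - \<gamma>))"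
      using s y z by (simp add: a_def b_def powr_divide powr_minus powr_diff powr_add field_simps)
    have h0: "0 \<le> hardy_kernel \<theta> x (w::'a)" for \<theta> x w by (simp add: hardy_kernel_def)
    have e0: "0 \<le> exp_kernel s y z" using s by (simp add: exp_kernel_nonneg)
    have "s powr (- D) * L \<le> (C1 + C2) * (exp_kernel s y z + hardy_kernel (\<beta> + \<gamma>) y z + hardy_kernel (\<alpha> - \<gamma>) z y)"
    proof (cases "b \<le> a")
      case True
      then have "norm z \<le> norm y" using s by (auto simp: a_def b_def divide_le_cancel)
      then have "norm z \<le> 2 * norm y" using norm_ge_zero[of y] by linarith
      then have h: "hardy_kernel (\<beta> + \<gamma>) y z = norm y powr ((\<beta> + \<gamma>) - D) * norm z powr (- (\<beta> + \<gamma>))"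
        by (simp add: hardy_kernel_def D_def)
      have "s powr (- D) * L \<le> s powr (- D) * (C1 * (exp (- d) + a powr (- D) * (a / b) powr (\<beta> + \<gamma>)))"
        unfolding L_def using True ab d by (intro mult_left_mono C1) auto
      also have "\<dots> = C1 * (exp_kernel s y z + hardy_kernel (\<beta> + \<gamma>) y z)"
        unfolding h E[symmetric] H1[symmetric] by (simp add: algebra_simps)
      also have "\<dots> \<le> (C1 + C2) * (exp_kernel s y z + hardy_kernel (\<beta> + \<gamma>) y z + hardy_kernel (\<alpha> - \<gamma>) z y)"
        using C1 C2 h0 e0 by (intro mult_mono) auto
      finally show ?thesis .
    next
      case False
      then have "norm y \<le> norm z" using s by (auto simp: a_def b_def divide_le_cancel)
      then have "norm y \<le> 2 * norm z" using norm_ge_zero[of z] by linarith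
      then have h: "hardy_kernel (\<alpha> - \<gamma>) z y = norm z powr ((\<alpha> - \<gamma>) - D) * norm y powr (- (\<alpha> - \<gamma>))"
        by (simp add: hardy_kernel_def D_def)
      have "L = min b 1 powr (- \<beta>) * min a 1 powr (- \<alpha>) * exp (- (d\<^sup>2 / \<kappa>)) * (b / a) powr (- \<gamma>)"
        using ab by (simp add: L_def powr_divide powr_minus field_simps)
      then have "s powr (- D) * L \<le> s powr (- D) * (C2 * (exp (- d) + b powr (- D) * (b / a) powr (\<alpha> + - \<gamma>)))"
        using False ab d by (simp only:) (intro mult_left_mono C2, auto)
      also have "\<dots> = C2 * (exp_kernel s y z + hardy_kernel (\<alpha> - \<gamma>) z y)"
        unfolding h E[symmetric] H2[symmetric] by (simp add: algebra_simps)
      also have "\<dots> \<le> (C1 + C2) * (exp_kernel s y z + hardy_kernel (\<beta> + \<gamma>) y z + hardy_kernel (\<alpha> - \<gamma>) z y)"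
        using C1 C2 h0 e0 by (intro mult_mono) auto
      finally show ?thesis .
    qed
    then have "t powr (- (DIM('a) / 2)) * min a 1 powr (- \<alpha>) * (min b 1 powr (- \<beta>) * exp (- (d\<^sup>2 / \<kappa>))) * (a / b) powr \<gamma>
      \<le> (C1 + C2) * (exp_kernel s y z + hardy_kernel (\<beta> + \<gamma>) y z + hardy_kernel (\<alpha> - \<gamma>) z y)"
      unfolding sD L_def by (simp add: mult_ac)
    moreover have "d\<^sup>2 / \<kappa> = (norm (y - z))\<^sup>2 / (\<kappa> * t)"
      using s by (simp add: d_def power_divide)
    moreover have "a / b = norm y / norm z" using s by (simp add: a_def b_def)
    ultimately show "t powr (- (DIM('a) / 2)) * min (norm y / sqrt t) 1 powr (- \<alpha>)
        * (min (norm z / sqrt t) 1 powr (- \<beta>) * exp (- ((norm (y - z))\<^sup>2 / (\<kappa> * t)))) * (norm y / norm z) powr \<gamma>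
      \<le> (C1 + C2) * (exp_kernel (sqrt t) y z + hardy_kernel (\<beta> + \<gamma>) y z + hardy_kernel (\<alpha> - \<gamma>) z y)"
      by (simp only: a_def b_def s_def)
  qed
qed

section \<open>The weighted measure and the square function estimate for S(t)\<close>

lemma sets_weighted_lborel [simp, measurable_cong]: "sets (weighted_lborel m) = sets borel"
  by (simp add: weighted_lborel_def)

lemma borel_measurable_weighted_lborel [simp]: "borel_measurable (weighted_lborel m) = borel_measurable borel"
  by (rule measurable_cong_sets) auto

lemma sigma_finite_weighted_lborel: "sigma_finite_measure (weighted_lborel m)"
  unfolding weighted_lborel_def
  by (subst sigma_finite_measure.sigma_finite_iff_density_finite[OF sigma_finite_lborel]) auto

lemma AE_weighted_lborelI: "AE y in lborel. P y \<Longrightarrow> AE y in weighted_lborel m. P y"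
  unfolding weighted_lborel_def by (subst AE_density) (auto elim: eventually_mono)

text \<open>Multiplication by |y|^(m/p) is an isometry from the weighted to the unweighted L^p
  space.\<close>

lemma nn_integral_weighted_lborel:
  fixes F :: "real ^ 'n \<Rightarrow> real"
  assumes p: "p \<noteq> 0" and [measurable]: "F \<in> borel_measurable borel" and F0: "\<And>y. 0 \<le> F y"
  shows "(\<integral>\<^sup>+y. ennreal (F y powr p) \<partial>weighted_lborel m)
    = (\<integral>\<^sup>+y. ennreal ((norm y powr (m / p) * F y) powr p) \<partial>lborel)"
  unfolding weighted_lborel_def using p F0
  by (subst nn_integral_density) (auto simp: powr_mult powr_powr ennreal_mult')

text \<open>The integral of the norm of the integrand is bounded first; this yields absolute
  convergence, and only then does the Bochner integral inherit the estimate.\<close>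

lemma S_op_pointwise_bound:
  fixes f :: "real ^ 'n \<Rightarrow> 'k::{real_normed_field, euclidean_space}"
  assumes fm[measurable]: "f \<in> borel_measurable borel" and t: "0 < t" and y: "y \<noteq> 0" and C: "0 \<le> C"
    and bound: "\<And>z. z \<noteq> 0 \<Longrightarrow>
      t powr (- (CARD('n) / 2)) * min (norm y / sqrt t) 1 powr (- \<alpha>)
        * (min (norm z / sqrt t) 1 powr (- \<beta>) * exp (- ((norm (y - z))\<^sup>2 / (\<kappa> * t)))) * (norm y / norm z) powr \<gamma>
      \<le> C * k z"
    and k: "k \<in> borel_measurable borel" "\<And>z. 0 \<le> k z"
    and fin: "(\<integral>\<^sup>+z. ennreal (k z * (norm z powr \<gamma> * norm (f z))) \<partial>lborel) < \<infinity>"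
  shows "integrable lborel (S_integrand \<kappa> \<beta> t f y)"
    and "norm y powr \<gamma> * norm (S_op \<kappa> \<alpha> \<beta> t f y)
      \<le> C * enn2real (\<integral>\<^sup>+z. ennreal (k z * (norm z powr \<gamma> * norm (f z))) \<partial>lborel)"
proof -
  note [measurable] = k(1)
  define I where "I = enn2real (\<integral>\<^sup>+z. ennreal (k z * (norm z powr \<gamma> * norm (f z))) \<partial>lborel)"
  have I: "(\<integral>\<^sup>+z. ennreal (k z * (norm z powr \<gamma> * norm (f z))) \<partial>lborel) = ennreal I" "0 \<le> I"
    using fin by (auto simp: I_def)
  define c where "c = t powr (- (CARD('n) / 2)) * min (norm y / sqrt t) 1 powr (- \<alpha>)"
  \<comment> \<open>All factors independent of z. Its positivity, which rests on y being nonzero,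
    allows finiteness to be read off after the multiplication by v.\<close>
  define v where "v = norm y powr \<gamma> * c"
  have "0 < min (norm y / sqrt t) 1 powr (- \<alpha>)"
    using t y by (subst powr_gt_zero) (auto simp: min_def)
  then have v: "0 < v" "0 \<le> c" using t y by (auto simp: v_def c_def intro!: mult_pos_pos)
  have [measurable]: "S_integrand \<kappa> \<beta> t f y \<in> borel_measurable lborel"
    unfolding S_integrand_def by measurable
  have "ennreal v * (\<integral>\<^sup>+z. ennreal (norm (S_integrand \<kappa> \<beta> t f y z)) \<partial>lborel)
      = (\<integral>\<^sup>+z. ennreal v * ennreal (norm (S_integrand \<kappa> \<beta> t f y z)) \<partial>lborel)"
    by (intro nn_integral_cmult[symmetric]) measurable
  also have "\<dots> \<le> (\<integral>\<^sup>+z. ennreal C * ennreal (k z * (norm z powr \<gamma> * norm (f z))) \<partial>lborel)"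
  proof (rule nn_integral_mono_AE)
    show "AE z in lborel. ennreal v * ennreal (norm (S_integrand \<kappa> \<beta> t f y z))
        \<le> ennreal C * ennreal (k z * (norm z powr \<gamma> * norm (f z)))"
      using AE_lborel_singleton[of "0 :: real ^ 'n"]
    proof eventually_elim
      case (elim z)
      define w where "w = min (norm z / sqrt t) 1 powr (- \<beta>) * exp (- ((norm (y - z))\<^sup>2 / (\<kappa> * t)))"
      have w: "0 \<le> w" by (simp add: w_def)
      have "v * norm (S_integrand \<kappa> \<beta> t f y z) = v * (w * norm (f z))"
        using w by (simp add: S_integrand_def flip: w_def)
      also have "\<dots> = (c * w * (norm y / norm z) powr \<gamma>) * (norm z powr \<gamma> * norm (f z))"
        using y elim by (simp add: v_def powr_divide)
      also have "\<dots> \<le> (C * k z) * (norm z powr \<gamma> * norm (f z))"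
        using bound[OF elim] by (intro mult_right_mono) (auto simp: c_def w_def)
      finally show ?case
        using v C by (auto simp: mult.assoc simp flip: ennreal_mult' intro!: ennreal_leI)
    qed
  qed
  also have "\<dots> = ennreal C * (\<integral>\<^sup>+z. ennreal (k z * (norm z powr \<gamma> * norm (f z))) \<partial>lborel)"
    by (intro nn_integral_cmult) measurable
  also have "\<dots> = ennreal (C * I)" using C I by (simp add: ennreal_mult')
  finally have le: "ennreal v * (\<integral>\<^sup>+z. ennreal (norm (S_integrand \<kappa> \<beta> t f y z)) \<partial>lborel) \<le> ennreal (C * I)" .
  then have "ennreal v * (\<integral>\<^sup>+z. ennreal (norm (S_integrand \<kappa> \<beta> t f y z)) \<partial>lborel) < \<infinity>"
    by (rule le_less_trans) simp
  then have "(\<integral>\<^sup>+z. ennreal (norm (S_integrand \<kappa> \<beta> t f y z)) \<partial>lborel) < \<infinity>"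
    using v by (auto simp: ennreal_mult_less_top)
  then show int: "integrable lborel (S_integrand \<kappa> \<beta> t f y)"
    by (intro integrableI_bounded) auto
  have "norm (\<integral>z. S_integrand \<kappa> \<beta> t f y z \<partial>lborel) \<le> (\<integral>z. norm (S_integrand \<kappa> \<beta> t f y z) \<partial>lborel)"
    by (rule integral_norm_bound)
  then have "v * norm (\<integral>z. S_integrand \<kappa> \<beta> t f y z \<partial>lborel) \<le> v * (\<integral>z. norm (S_integrand \<kappa> \<beta> t f y z) \<partial>lborel)"
    using v by (intro mult_left_mono) auto
  also have "ennreal (v * (\<integral>z. norm (S_integrand \<kappa> \<beta> t f y z) \<partial>lborel)) \<le> ennreal (C * I)"
    using le int v by (simp add: nn_integral_eq_integral ennreal_mult')
  then have "v * (\<integral>z. norm (S_integrand \<kappa> \<beta> t f y z) \<partial>lborel) \<le> C * I"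
    using C I by simp
  finally show "norm y powr \<gamma> * norm (S_op \<kappa> \<alpha> \<beta> t f y) \<le> C * enn2real (\<integral>\<^sup>+z. ennreal (k z * (norm z powr \<gamma> * norm (f z))) \<partial>lborel)"
    using v by (simp add: S_op_def v_def I_def mult.assoc flip: c_def)
qed

lemma S_op_measurable [measurable]:
  fixes f :: "real ^ 'n \<Rightarrow> 'k::{real_normed_field, euclidean_space}"
  assumes [measurable]: "f \<in> borel_measurable borel"
  shows "S_op \<kappa> \<alpha> \<beta> t f \<in> borel_measurable borel"
proof -
  have "(\<lambda>y. \<integral>z. S_integrand \<kappa> \<beta> t f y z \<partial>lborel) \<in> borel_measurable borel"
    unfolding S_integrand_def by measurable
  then show ?thesis unfolding S_op_def[abs_def] by measurable
qed

lemma powr_add3_le: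
  fixes a b c p :: real
  assumes "0 \<le> a" "0 \<le> b" "0 \<le> c" "0 \<le> p"
  shows "(a + b + c) powr p \<le> 2 powr p * 2 powr p * (a powr p + b powr p + c powr p)"
proof -
  have "(a + b + c) powr p \<le> 2 powr p * ((a + b) powr p + c powr p)"
    using assms by (intro powr_add_le) auto
  also have "\<dots> \<le> 2 powr p * (2 powr p * (a powr p + b powr p) + 2 powr p * c powr p)"
  proof (intro mult_left_mono add_mono powr_add_le)
    have "1 \<le> 2 powr p" using assms by (intro ge_one_powr_ge_zero) auto
    then show "c powr p \<le> 2 powr p * c powr p"
      using mult_right_mono[of 1 "2 powr p" "c powr p"] by simp
  qed (use assms in auto)
  finally show ?thesis by (simp add: algebra_simps)
qed

text \<open>The three dominating kernels are treated separately for the conjugated functions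
  \<open>g i\<close>. The constant collects the domination constant, the two factors 2^p for a sum
  of three terms, and the three kernel constants; like them it refers to p-th powers.\<close>

lemma S_op_square_function:
  fixes m \<alpha> \<beta> \<kappa> p :: real
  assumes \<kappa>: "0 < \<kappa>" and p: "1 < p"
    and \<alpha>: "\<alpha> < (real CARD('n::finite) + m) / p"
    and \<beta>: "(real CARD('n) + m) / p < real CARD('n) - \<beta>"
  obtains C where "0 \<le> C"
    "\<And>(I :: nat set) t (f :: nat \<Rightarrow> real ^ 'n \<Rightarrow> 'k::{real_normed_field, euclidean_space}) B.
      finite I \<Longrightarrow> (\<And>i. i \<in> I \<Longrightarrow> 0 < t i) \<Longrightarrow> (\<And>i. i \<in> I \<Longrightarrow> f i \<in> borel_measurable borel) \<Longrightarrow> 0 \<le> B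
      \<Longrightarrow> (\<integral>\<^sup>+x. ennreal (L2_set (\<lambda>i. norm (f i x)) I powr p) \<partial>weighted_lborel m) \<le> ennreal B
      \<Longrightarrow> (AE y in weighted_lborel m. \<forall>i\<in>I. integrable lborel (S_integrand \<kappa> \<beta> (t i) (f i) y))
        \<and> (\<integral>\<^sup>+x. ennreal (L2_set (\<lambda>i. norm (S_op \<kappa> \<alpha> \<beta> (t i) (f i) x)) I powr p) \<partial>weighted_lborel m) \<le> ennreal (C * B)"
proof -
  define D where "D = real CARD('n)"
  define \<gamma> where "\<gamma> = m / p"
  define q where "q = p / (p - 1)"
  have q: "1 < q" "1 / p + 1 / q = 1" "1 / q + 1 / p = 1" using p by (auto simp: q_def field_simps)
  have DIM: "real DIM(real ^ 'n) = D" by (simp add: D_def)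
  have Dq: "D / q = D - D / p" using p by (simp add: q_def field_simps)
  have \<theta>1: "\<beta> + \<gamma> < D / q" using \<beta> Dq unfolding \<gamma>_def D_def by (simp add: add_divide_distrib)
  have \<theta>2: "\<alpha> - \<gamma> < D / p" using \<alpha> unfolding \<gamma>_def D_def by (simp add: add_divide_distrib)
  have \<alpha>\<beta>: "\<alpha> + \<beta> \<le> D" using \<alpha> \<beta> unfolding D_def by simp
  define H1 H2 :: "real ^ 'n \<Rightarrow> real ^ 'n \<Rightarrow> real"
    where "H1 = hardy_kernel (\<beta> + \<gamma>)" and "H2 = (\<lambda>y z. hardy_kernel (\<alpha> - \<gamma>) z y)"
  have S1: "schur_bounded lborel p q H1"
    unfolding H1_def using p q \<theta>1 DIM by (intro schur_bounded_hardy_kernel) auto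
  \<comment> \<open>The second Hardy kernel appears transposed, so the roles of p and q are
    interchanged; this turns the condition on \<theta> into \<alpha> - \<gamma> < D / p.\<close>
  have S2: "schur_bounded lborel p q H2"
    unfolding H2_def
    by (rule schur_bounded_transpose, rule schur_bounded_hardy_kernel) (use p q \<theta>2 DIM in auto)
  obtain C1 C2 where C1: "0 \<le> C1" "l2_bounded_kernel lborel p H1 C1" and C2: "0 \<le> C2" "l2_bounded_kernel lborel p H2 C2"
    using lborel.schur_square_function[OF S1 p q(1,2)] lborel.schur_square_function[OF S2 p q(1,2)] by blast
  obtain C0 where C0: "0 \<le> C0" and b0: "\<And>(y :: real ^ 'n) z t. y \<noteq> 0 \<Longrightarrow> z \<noteq> 0 \<Longrightarrow> 0 < t \<Longrightarrow>
      t powr (- (DIM(real ^ 'n) / 2)) * min (norm y / sqrt t) 1 powr (- \<alpha>)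
        * (min (norm z / sqrt t) 1 powr (- \<beta>) * exp (- ((norm (y - z))\<^sup>2 / (\<kappa> * t)))) * (norm y / norm z) powr \<gamma>
      \<le> C0 * (exp_kernel (sqrt t) y z + hardy_kernel (\<beta> + \<gamma>) y z + hardy_kernel (\<alpha> - \<gamma>) z y)"
    by (rule weighted_gaussian_bound[where 'a = "real ^ 'n" and \<alpha> = \<alpha> and \<beta> = \<beta> and \<gamma> = \<gamma>, OF \<kappa> \<alpha>\<beta>[folded DIM]])
      (erule that)
  define CE where "CE = exp_mean_square_const TYPE(real ^ 'n) p"
  have CE: "0 \<le> CE" by (simp add: CE_def exp_mean_square_const_nonneg)
  define C where "C = C0 powr p * (2 powr p * 2 powr p) * (CE + C1 + C2)"
  have h0: "0 \<le> H1 y z" "0 \<le> H2 y z" for y z by (auto simp: H1_def H2_def hardy_kernel_def)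
  have hm[measurable]: "H1 y \<in> borel_measurable borel" "H2 y \<in> borel_measurable borel" for y
  proof -
    have "(\<lambda>(y, z). H1 y z) \<in> borel_measurable (lborel \<Otimes>\<^sub>M lborel)" "(\<lambda>(y, z). H2 y z) \<in> borel_measurable (lborel \<Otimes>\<^sub>M lborel)"
      using S1 S2 by (auto simp: schur_bounded_def)
    moreover have "Pair y \<in> lborel \<rightarrow>\<^sub>M lborel \<Otimes>\<^sub>M (lborel :: (real ^ 'n) measure)"
      by (rule measurable_Pair1') simp
    ultimately have "(\<lambda>z. H1 y z) \<in> borel_measurable lborel" "(\<lambda>z. H2 y z) \<in> borel_measurable lborel"
      by (auto dest: measurable_compose)
    then show "H1 y \<in> borel_measurable borel" "H2 y \<in> borel_measurable borel" by auto
  qed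
  show ?thesis
  proof (rule that)
    show "0 \<le> C" using C1 C2 CE by (simp add: C_def)
    fix I :: "nat set" and t :: "nat \<Rightarrow> real" and f :: "nat \<Rightarrow> real ^ 'n \<Rightarrow> 'k" and B :: real
    assume I: "finite I" and t: "\<And>i. i \<in> I \<Longrightarrow> 0 < t i" and fm: "\<And>i. i \<in> I \<Longrightarrow> f i \<in> borel_measurable borel"
      and B: "0 \<le> B" and fB: "(\<integral>\<^sup>+x. ennreal (L2_set (\<lambda>i. norm (f i x)) I powr p) \<partial>weighted_lborel m) \<le> ennreal B"
    note [measurable] = fm
    define g where "g i z = norm z powr \<gamma> * norm (f i z)" for i z
    have gm[measurable]: "i \<in> I \<Longrightarrow> g i \<in> borel_measurable borel" for i unfolding g_def by measurable
    have g0: "0 \<le> g i z" for i z by (simp add: g_def)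
    have "L2_set (\<lambda>i. g i x) I = norm x powr \<gamma> * L2_set (\<lambda>i. norm (f i x)) I" for x
      using L2_set_right_distrib[of "norm x powr \<gamma>" "\<lambda>i. norm (f i x)" I] by (simp add: g_def)
    moreover have m1: "(\<lambda>x. L2_set (\<lambda>i. norm (f i x)) I) \<in> borel_measurable borel"
      unfolding L2_set_def by measurable
    ultimately have gB: "(\<integral>\<^sup>+x. ennreal (L2_set (\<lambda>i. g i x) I powr p) \<partial>lborel) \<le> ennreal B"
      using fB p by (subst (asm) nn_integral_weighted_lborel) (auto simp: L2_set_nonneg \<gamma>_def)
    define E G1 G2 where "E i y = exp_mean (sqrt (t i)) (g i) y"
      and "G1 i y = enn2real (\<integral>\<^sup>+z. ennreal (H1 y z * g i z) \<partial>lborel)"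
      and "G2 i y = enn2real (\<integral>\<^sup>+z. ennreal (H2 y z * g i z) \<partial>lborel)" for i y
    have nn: "0 \<le> E i y" "0 \<le> G1 i y" "0 \<le> G2 i y" for i y
      by (auto simp: E_def G1_def G2_def exp_mean_nonneg)
    have f1: "AE y in lborel. \<forall>i\<in>I. (\<integral>\<^sup>+z. ennreal (H1 y z * g i z) \<partial>lborel) < \<infinity>"
      and i1: "(\<integral>\<^sup>+y. ennreal (L2_set (\<lambda>i. G1 i y) I powr p) \<partial>lborel) \<le> ennreal (C1 * B)"
      using C1(2)[unfolded l2_bounded_kernel_def, rule_format, of I g B] I g0 B gB by (auto simp: G1_def)
    have f2: "AE y in lborel. \<forall>i\<in>I. (\<integral>\<^sup>+z. ennreal (H2 y z * g i z) \<partial>lborel) < \<infinity>"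
      and i2: "(\<integral>\<^sup>+y. ennreal (L2_set (\<lambda>i. G2 i y) I powr p) \<partial>lborel) \<le> ennreal (C2 * B)"
      using C2(2)[unfolded l2_bounded_kernel_def, rule_format, of I g B] I g0 B gB by (auto simp: G2_def)
    have iE: "(\<integral>\<^sup>+y. ennreal (L2_set (\<lambda>i. E i y) I powr p) \<partial>lborel) \<le> ennreal (CE * B)"
      unfolding E_def CE_def using p I t g0 B gB by (intro exp_mean_square_function) auto
    have finE: "(\<integral>\<^sup>+z. ennreal (exp_kernel (sqrt (t i)) y z * g i z) \<partial>lborel) < \<infinity>" if i: "i \<in> I" for i y
    proof (rule exp_mean_finite)
      have "(\<integral>\<^sup>+x. ennreal (g i x powr p) \<partial>lborel) \<le> (\<integral>\<^sup>+x. ennreal (L2_set (\<lambda>i. g i x) I powr p) \<partial>lborel)"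
        using i p g0 I by (intro nn_integral_mono ennreal_leI powr_mono2 member_le_L2_set) auto
      also note gB
      finally show "(\<integral>\<^sup>+x. ennreal (g i x powr p) \<partial>lborel) < \<infinity>" by (rule le_less_trans) simp
    qed (use t i p g0 in auto)
    have key: "AE y in lborel. \<forall>i\<in>I. integrable lborel (S_integrand \<kappa> \<beta> (t i) (f i) y) \<and>
        norm y powr \<gamma> * norm (S_op \<kappa> \<alpha> \<beta> (t i) (f i) y) \<le> C0 * (E i y + G1 i y + G2 i y)"
      using f1 f2 AE_lborel_singleton[of "0 :: real ^ 'n"]
    proof (eventually_elim, intro ballI)
      fix y :: "real ^ 'n" and i
      assume y: "y \<noteq> 0" and i: "i \<in> I" and fin: "\<forall>i\<in>I. (\<integral>\<^sup>+z. ennreal (H1 y z * g i z) \<partial>lborel) < \<infinity>"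
        "\<forall>i\<in>I. (\<integral>\<^sup>+z. ennreal (H2 y z * g i z) \<partial>lborel) < \<infinity>"
      \<comment> \<open>The Hardy integrals are finite for almost every y only, the exponential
        average for every y; together they make the integral of the dominating kernel
        finite.\<close>
      define k where "k z = exp_kernel (sqrt (t i)) y z + H1 y z + H2 y z" for z
      have e0: "0 \<le> exp_kernel (sqrt (t i)) y z" for z using t[OF i] by (simp add: exp_kernel_nonneg)
      have km: "k \<in> borel_measurable borel" unfolding k_def by measurable
      have k0: "0 \<le> k z" for z using e0[of z] h0[of y z] by (simp add: k_def)
      have "(\<integral>\<^sup>+z. ennreal (k z * g i z) \<partial>lborel)
        = (\<integral>\<^sup>+z. ennreal (exp_kernel (sqrt (t i)) y z * g i z) + ennreal (H1 y z * g i z) + ennreal (H2 y z * g i z) \<partial>lborel)"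
        using e0 h0 g0 by (simp add: k_def distrib_right flip: ennreal_plus)
      also have "\<dots> = (\<integral>\<^sup>+z. ennreal (exp_kernel (sqrt (t i)) y z * g i z) \<partial>lborel)
          + (\<integral>\<^sup>+z. ennreal (H1 y z * g i z) \<partial>lborel) + (\<integral>\<^sup>+z. ennreal (H2 y z * g i z) \<partial>lborel)"
        using i by (simp add: nn_integral_add)
      also have "\<dots> = ennreal (E i y + G1 i y + G2 i y)"
        using fin finE[OF i, of y] i nn by (simp add: E_def G1_def G2_def exp_mean_def)
      finally have sum: "(\<integral>\<^sup>+z. ennreal (k z * g i z) \<partial>lborel) = ennreal (E i y + G1 i y + G2 i y)" .
      have bd: "t i powr (- (CARD('n) / 2)) * min (norm y / sqrt (t i)) 1 powr (- \<alpha>)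
        * (min (norm z / sqrt (t i)) 1 powr (- \<beta>) * exp (- ((norm (y - z))\<^sup>2 / (\<kappa> * t i)))) * (norm y / norm z) powr \<gamma>
        \<le> C0 * k z" if "z \<noteq> 0" for z
        using b0[OF y that t[OF i]] by (simp add: k_def H1_def H2_def)
      have fin': "(\<integral>\<^sup>+z. ennreal (k z * (norm z powr \<gamma> * norm (f i z))) \<partial>lborel) < \<infinity>"
        using sum by (simp add: g_def)
      show "integrable lborel (S_integrand \<kappa> \<beta> (t i) (f i) y) \<and>
        norm y powr \<gamma> * norm (S_op \<kappa> \<alpha> \<beta> (t i) (f i) y) \<le> C0 * (E i y + G1 i y + G2 i y)"
        using S_op_pointwise_bound[OF fm[OF i] t[OF i] y C0 bd km k0 fin'] sum nn[of i y]
        by (simp add: g_def del: ennreal_plus)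
    qed
    have "AE y in lborel. \<forall>i\<in>I. integrable lborel (S_integrand \<kappa> \<beta> (t i) (f i) y)"
      using key by eventually_elim auto
    moreover have "(\<integral>\<^sup>+x. ennreal (L2_set (\<lambda>i. norm (S_op \<kappa> \<alpha> \<beta> (t i) (f i) x)) I powr p) \<partial>weighted_lborel m) \<le> ennreal (C * B)"
    proof -
      have m2: "(\<lambda>x. L2_set (\<lambda>i. norm (S_op \<kappa> \<alpha> \<beta> (t i) (f i) x)) I) \<in> borel_measurable borel"
        unfolding L2_set_def by measurable
      have mL[measurable]: "(\<lambda>y. L2_set (\<lambda>i. E i y) I) \<in> borel_measurable borel"
        "(\<lambda>y. L2_set (\<lambda>i. G1 i y) I) \<in> borel_measurable borel"
        "(\<lambda>y. L2_set (\<lambda>i. G2 i y) I) \<in> borel_measurable borel"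
      proof -
        have mH: "(\<lambda>(y, z). H1 y z) \<in> borel_measurable (borel \<Otimes>\<^sub>M borel)" "(\<lambda>(y, z). H2 y z) \<in> borel_measurable (borel \<Otimes>\<^sub>M borel)"
          using S1 S2 unfolding schur_bounded_def by (simp_all cong: measurable_cong_sets sets_pair_measure_cong)
        have "G1 i \<in> borel_measurable borel" "G2 i \<in> borel_measurable borel" if i: "i \<in> I" for i
        proof -
          note [measurable] = mH gm[OF i]
          have "(\<lambda>y. \<integral>\<^sup>+z. ennreal (H1 y z * g i z) \<partial>lborel) \<in> borel_measurable borel"
            "(\<lambda>y. \<integral>\<^sup>+z. ennreal (H2 y z * g i z) \<partial>lborel) \<in> borel_measurable borel" by measurable
          then show "G1 i \<in> borel_measurable borel" "G2 i \<in> borel_measurable borel"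
            unfolding G1_def[abs_def] G2_def[abs_def] by measurable
        qed
        note [measurable] = this
        show "(\<lambda>y. L2_set (\<lambda>i. E i y) I) \<in> borel_measurable borel"
          unfolding L2_set_def E_def by measurable
        show "(\<lambda>y. L2_set (\<lambda>i. G1 i y) I) \<in> borel_measurable borel"
          "(\<lambda>y. L2_set (\<lambda>i. G2 i y) I) \<in> borel_measurable borel"
          unfolding L2_set_def by measurable
      qed
      define K where "K = C0 powr p * (2 powr p * 2 powr p)"
      have K: "0 \<le> K" by (simp add: K_def)
      have "(\<integral>\<^sup>+x. ennreal (L2_set (\<lambda>i. norm (S_op \<kappa> \<alpha> \<beta> (t i) (f i) x)) I powr p) \<partial>weighted_lborel m)
        = (\<integral>\<^sup>+y. ennreal ((norm y powr \<gamma> * L2_set (\<lambda>i. norm (S_op \<kappa> \<alpha> \<beta> (t i) (f i) y)) I) powr p) \<partial>lborel)"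
        unfolding \<gamma>_def using p m2 by (intro nn_integral_weighted_lborel) (auto simp: L2_set_nonneg)
      also have "\<dots> \<le> (\<integral>\<^sup>+y. ennreal K * (ennreal (L2_set (\<lambda>i. E i y) I powr p)
          + ennreal (L2_set (\<lambda>i. G1 i y) I powr p) + ennreal (L2_set (\<lambda>i. G2 i y) I powr p)) \<partial>lborel)"
      proof (rule nn_integral_mono_AE)
        show "AE y in lborel. ennreal ((norm y powr \<gamma> * L2_set (\<lambda>i. norm (S_op \<kappa> \<alpha> \<beta> (t i) (f i) y)) I) powr p)
          \<le> ennreal K * (ennreal (L2_set (\<lambda>i. E i y) I powr p)
          + ennreal (L2_set (\<lambda>i. G1 i y) I powr p) + ennreal (L2_set (\<lambda>i. G2 i y) I powr p))"
          using key
        proof eventually_elim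
          case (elim y)
          let ?e = "L2_set (\<lambda>i. E i y) I" and ?a = "L2_set (\<lambda>i. G1 i y) I" and ?b = "L2_set (\<lambda>i. G2 i y) I"
          have "norm y powr \<gamma> * L2_set (\<lambda>i. norm (S_op \<kappa> \<alpha> \<beta> (t i) (f i) y)) I
            = L2_set (\<lambda>i. norm y powr \<gamma> * norm (S_op \<kappa> \<alpha> \<beta> (t i) (f i) y)) I"
            by (rule L2_set_right_distrib) simp
          also have "\<dots> \<le> L2_set (\<lambda>i. C0 * (E i y + G1 i y + G2 i y)) I"
            using elim by (intro L2_set_mono) auto
          also have "\<dots> = C0 * L2_set (\<lambda>i. (E i y + G1 i y) + G2 i y) I"
            using C0 by (simp add: L2_set_right_distrib)
          also have "\<dots> \<le> C0 * (?e + ?a + ?b)"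
            using C0 by (intro mult_left_mono order_trans[OF L2_set_triangle_ineq] add_right_mono L2_set_triangle_ineq) auto
          finally have "(norm y powr \<gamma> * L2_set (\<lambda>i. norm (S_op \<kappa> \<alpha> \<beta> (t i) (f i) y)) I) powr p \<le> (C0 * (?e + ?a + ?b)) powr p"
            using p by (intro powr_mono2) (auto simp: L2_set_nonneg)
          also have "\<dots> = C0 powr p * (?e + ?a + ?b) powr p" using C0 by (simp add: powr_mult L2_set_nonneg)
          also have "\<dots> \<le> C0 powr p * (2 powr p * 2 powr p * (?e powr p + ?a powr p + ?b powr p))"
            using p by (intro mult_left_mono powr_add3_le) (auto simp: L2_set_nonneg)
          finally show ?case
            using K by (auto simp: K_def mult.assoc simp flip: ennreal_plus ennreal_mult' intro!: ennreal_leI)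
        qed
      qed
      also have "\<dots> = ennreal K * ((\<integral>\<^sup>+y. ennreal (L2_set (\<lambda>i. E i y) I powr p) \<partial>lborel)
          + (\<integral>\<^sup>+y. ennreal (L2_set (\<lambda>i. G1 i y) I powr p) \<partial>lborel) + (\<integral>\<^sup>+y. ennreal (L2_set (\<lambda>i. G2 i y) I powr p) \<partial>lborel))"
        by (subst nn_integral_cmult) (auto simp: nn_integral_add)
      also have "\<dots> \<le> ennreal K * (ennreal (CE * B) + ennreal (C1 * B) + ennreal (C2 * B))"
        using i1 i2 iE by (intro mult_left_mono add_mono) auto
      also have "\<dots> = ennreal (C * B)"
        using K CE C1 C2 B by (simp add: C_def K_def algebra_simps flip: ennreal_plus ennreal_mult')
      finally show ?thesis .
    qed
    ultimately show "(AE y in weighted_lborel m. \<forall>i\<in>I. integrable lborel (S_integrand \<kappa> \<beta> (t i) (f i) y))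
        \<and> (\<integral>\<^sup>+x. ennreal (L2_set (\<lambda>i. norm (S_op \<kappa> \<alpha> \<beta> (t i) (f i) x)) I powr p) \<partial>weighted_lborel m) \<le> ennreal (C * B)"
      by (auto intro: AE_weighted_lborelI)
  qed
qed

section \<open>Khintchine's inequalities\<close>

text \<open>Hoeffding's inequality for the symmetric two-point distribution, taken at h = 2 |x| and
  multiplied by exp(-|x|) to centre it.\<close>

lemma cosh_le_exp:
  fixes x :: real
  shows "(exp x + exp (- x)) / 2 \<le> exp (x\<^sup>2 / 2)"
proof -
  define h where "h = 2 * \<bar>x\<bar>"
  have "- h * (1/2) + ln (1 + (1/2) * (exp h - 1)) \<le> h\<^sup>2 / 8"
    by (rule Hoeffdings_lemma_aux) (auto simp: h_def)
  then have "ln ((1 + exp h) / 2) \<le> x\<^sup>2 / 2 + \<bar>x\<bar>"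
    by (simp add: h_def power_mult_distrib field_simps)
  moreover have "0 < (1 + exp h) / 2" by (simp add: add_pos_pos)
  ultimately have "(1 + exp h) / 2 \<le> exp (x\<^sup>2 / 2 + \<bar>x\<bar>)"
    by (metis exp_le_cancel_iff exp_ln)
  then have "(1 + exp h) / 2 * exp (- \<bar>x\<bar>) \<le> exp (x\<^sup>2 / 2 + \<bar>x\<bar>) * exp (- \<bar>x\<bar>)"
    by (rule mult_right_mono) auto
  also have "\<dots> = exp (x\<^sup>2 / 2)" by (simp add: mult_exp_exp)
  also have "(1 + exp h) / 2 * exp (- \<bar>x\<bar>) = (exp \<bar>x\<bar> + exp (- \<bar>x\<bar>)) / 2"
    by (simp add: h_def field_simps mult_exp_exp)
  also have "exp \<bar>x\<bar> + exp (- \<bar>x\<bar>) = exp x + exp (- x)" by (simp add: abs_if)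
  finally show ?thesis .
qed

lemma rademacher_sequenceD:
  assumes "rademacher_sequence \<Omega> \<epsilon>"
  shows "prob_space \<Omega>" "prob_space.indep_vars \<Omega> (\<lambda>_. borel) \<epsilon> UNIV"
    "\<epsilon> i \<in> borel_measurable \<Omega>" "\<omega> \<in> space \<Omega> \<Longrightarrow> \<epsilon> i \<omega> = 1 \<or> \<epsilon> i \<omega> = - 1"
proof -
  show P: "prob_space \<Omega>" and I: "prob_space.indep_vars \<Omega> (\<lambda>_. borel) \<epsilon> UNIV"
    using assms by (auto simp: rademacher_sequence_def)
  show "\<epsilon> i \<in> borel_measurable \<Omega>"
    using I unfolding prob_space.indep_vars_def[OF P] by auto
  show "\<omega> \<in> space \<Omega> \<Longrightarrow> \<epsilon> i \<omega> = 1 \<or> \<epsilon> i \<omega> = - 1"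
    using assms by (auto simp: rademacher_sequence_def Pi_iff)
qed

lemma integrable_rademacher:
  fixes g :: "'w \<Rightarrow> real"
  assumes R: "rademacher_sequence \<Omega> \<epsilon>" and [measurable]: "g \<in> borel_measurable \<Omega>"
    and b: "\<And>\<omega>. \<omega> \<in> space \<Omega> \<Longrightarrow> \<bar>g \<omega>\<bar> \<le> B"
  shows "integrable \<Omega> g"
proof -
  interpret prob_space \<Omega> by (rule rademacher_sequenceD[OF R])
  show ?thesis by (rule integrable_const_bound[where B = B]) (use b in auto)
qed

lemma integral_rademacher:
  fixes g :: "real \<Rightarrow> real"
  assumes R: "rademacher_sequence \<Omega> \<epsilon>"
  shows "(\<integral>\<omega>. g (\<epsilon> i \<omega>) \<partial>\<Omega>) = (g 1 + g (- 1)) / 2"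
proof -
  interpret prob_space \<Omega> by (rule rademacher_sequenceD[OF R])
  have [measurable]: "\<epsilon> i \<in> borel_measurable \<Omega>" by (rule rademacher_sequenceD[OF R])
  define P Q where "P = {\<omega> \<in> space \<Omega>. \<epsilon> i \<omega> = 1}" and "Q = {\<omega> \<in> space \<Omega>. \<epsilon> i \<omega> = - 1}"
  have [measurable]: "P \<in> sets \<Omega>" "Q \<in> sets \<Omega>" unfolding P_def Q_def by measurable
  have PQ: "measure \<Omega> P = 1 / 2" "measure \<Omega> Q = 1 / 2"
    using R by (auto simp: rademacher_sequence_def P_def Q_def)
  have "(\<integral>\<omega>. g (\<epsilon> i \<omega>) \<partial>\<Omega>) = (\<integral>\<omega>. g 1 * indicator P \<omega> + g (- 1) * indicator Q \<omega> \<partial>\<Omega>)"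
  proof (rule Bochner_Integration.integral_cong)
    fix \<omega> assume "\<omega> \<in> space \<Omega>"
    then show "g (\<epsilon> i \<omega>) = g 1 * indicator P \<omega> + g (- 1) * indicator Q \<omega>"
      using rademacher_sequenceD(4)[OF R, of \<omega> i] by (auto simp: P_def Q_def)
  qed simp
  also have "\<dots> = g 1 * measure \<Omega> P + g (- 1) * measure \<Omega> Q"
    by (subst Bochner_Integration.integral_add) (auto simp: less_top[symmetric])
  finally show ?thesis by (simp only: PQ) simp
qed

text \<open>By independence the expectation factorises into hyperbolic cosines, each of which is
  subgaussian.\<close>

lemma rademacher_exp_moment:
  assumes R: "rademacher_sequence \<Omega> \<epsilon>"
  shows "(\<integral>\<omega>. exp (\<Sum>i<n. \<epsilon> i \<omega> * a i) \<partial>\<Omega>) \<le> exp ((\<Sum>i<n. (a i)\<^sup>2) / 2)"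
proof -
  interpret prob_space \<Omega> by (rule rademacher_sequenceD[OF R])
  note [measurable] = rademacher_sequenceD(3)[OF R]
  have "indep_vars (\<lambda>_. borel) \<epsilon> {..<n}"
    using rademacher_sequenceD(2)[OF R] by (rule indep_vars_subset) auto
  then have ind: "indep_vars (\<lambda>_. borel) (\<lambda>i \<omega>. exp (\<epsilon> i \<omega> * a i)) {..<n}"
    by (rule indep_vars_compose2) auto
  have "(\<integral>\<omega>. exp (\<Sum>i<n. \<epsilon> i \<omega> * a i) \<partial>\<Omega>) = (\<integral>\<omega>. (\<Prod>i<n. exp (\<epsilon> i \<omega> * a i)) \<partial>\<Omega>)"
    by (simp add: exp_sum)
  also have "\<dots> = (\<Prod>i<n. \<integral>\<omega>. exp (\<epsilon> i \<omega> * a i) \<partial>\<Omega>)"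
  proof (rule indep_vars_lebesgue_integral[OF _ ind])
    fix i
    show "integrable \<Omega> (\<lambda>\<omega>. exp (\<epsilon> i \<omega> * a i))"
    proof (rule integrable_rademacher[OF R, where B = "exp \<bar>a i\<bar>"])
      fix \<omega> assume "\<omega> \<in> space \<Omega>"
      then show "\<bar>exp (\<epsilon> i \<omega> * a i)\<bar> \<le> exp \<bar>a i\<bar>"
        using rademacher_sequenceD(4)[OF R, of \<omega> i] by auto
    qed simp
  qed simp
  also have "\<dots> = (\<Prod>i<n. (exp (a i) + exp (- a i)) / 2)"
    by (subst integral_rademacher[OF R, of "\<lambda>x. exp (x * _)"]) simp
  also have "\<dots> \<le> (\<Prod>i<n. exp ((a i)\<^sup>2 / 2))"
    by (intro prod_mono conjI cosh_le_exp) (auto simp: add_nonneg_nonneg)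
  also have "\<dots> = exp ((\<Sum>i<n. (a i)\<^sup>2) / 2)"
    by (simp add: exp_sum sum_divide_distrib)
  finally show ?thesis .
qed

lemma rademacher_sum_abs_le:
  assumes R: "rademacher_sequence \<Omega> \<epsilon>" and \<omega>: "\<omega> \<in> space \<Omega>"
  shows "norm (\<Sum>i<n. \<epsilon> i \<omega> *\<^sub>R (a i :: 'b::real_normed_vector)) \<le> (\<Sum>i<n. norm (a i))"
proof (rule order_trans[OF norm_sum sum_mono])
  fix i
  show "norm (\<epsilon> i \<omega> *\<^sub>R a i) \<le> norm (a i)"
    using rademacher_sequenceD(4)[OF R \<omega>, of i] by auto
qed

text \<open>For coefficients of l2 norm 1 and Y their random sum, |Y|^r \<le> r^r (exp Y + exp(-Y)),
  and both exponential moments are at most exp(1/2). The constant refers to r-th powers.\<close>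

definition khintchine_const :: "real \<Rightarrow> real" where
  "khintchine_const r = 2 * r powr r * exp (1 / 2)"

lemma khintchine_upper_real:
  fixes a :: "nat \<Rightarrow> real"
  assumes R: "rademacher_sequence \<Omega> \<epsilon>" and r: "0 < r"
  shows "(\<integral>\<omega>. \<bar>\<Sum>i<n. \<epsilon> i \<omega> * a i\<bar> powr r \<partial>\<Omega>) \<le> khintchine_const r * L2_set a {..<n} powr r"
proof (cases "L2_set a {..<n} = 0")
  case True
  then have "a i = 0" if "i < n" for i using that by (simp add: L2_set_eq_0_iff)
  then show ?thesis using True by simp
next
  case False
  interpret prob_space \<Omega> by (rule rademacher_sequenceD[OF R])
  note [measurable] = rademacher_sequenceD(3)[OF R]
  define S where "S = L2_set a {..<n}"
  have S: "0 < S" using False L2_set_nonneg[of a "{..<n}"] unfolding S_def by linarith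
  define b where "b i = a i / S" for i
  have "(\<Sum>i<n. (b i)\<^sup>2) = (\<Sum>i<n. (a i)\<^sup>2) / S\<^sup>2"
    by (simp add: b_def power_divide sum_divide_distrib)
  also have "\<dots> = 1" using S by (simp add: S_def L2_set_def sum_nonneg)
  finally have b1: "(\<Sum>i<n. (b i)\<^sup>2) = 1" .
  define Y where "Y \<omega> = (\<Sum>i<n. \<epsilon> i \<omega> * b i)" for \<omega>
  have [measurable]: "Y \<in> borel_measurable \<Omega>" unfolding Y_def by measurable
  have Yb: "\<bar>Y \<omega>\<bar> \<le> (\<Sum>i<n. \<bar>b i\<bar>)" if "\<omega> \<in> space \<Omega>" for \<omega>
    using rademacher_sum_abs_le[OF R that, where a = b] by (simp add: Y_def)
  have i1: "integrable \<Omega> (\<lambda>\<omega>. exp (Y \<omega>))"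
    by (rule integrable_rademacher[OF R, where B = "exp (\<Sum>i<n. \<bar>b i\<bar>)"]) (use Yb abs_le_D1 in auto)
  have i2: "integrable \<Omega> (\<lambda>\<omega>. exp (- Y \<omega>))"
    by (rule integrable_rademacher[OF R, where B = "exp (\<Sum>i<n. \<bar>b i\<bar>)"]) (use Yb abs_le_D2 in auto)
  have i3: "integrable \<Omega> (\<lambda>\<omega>. \<bar>Y \<omega>\<bar> powr r)"
    by (rule integrable_rademacher[OF R, where B = "(\<Sum>i<n. \<bar>b i\<bar>) powr r"]) (use Yb r in \<open>auto intro: powr_mono2\<close>)
  have e1: "(\<integral>\<omega>. exp (Y \<omega>) \<partial>\<Omega>) \<le> exp (1 / 2)"
    using rademacher_exp_moment[OF R, where n = n and a = b] by (simp add: Y_def b1)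
  have e2: "(\<integral>\<omega>. exp (- Y \<omega>) \<partial>\<Omega>) \<le> exp (1 / 2)"
    using rademacher_exp_moment[OF R, where n = n and a = "\<lambda>i. - b i"] by (simp add: Y_def b1 sum_negf)
  have "(\<integral>\<omega>. \<bar>Y \<omega>\<bar> powr r \<partial>\<Omega>) \<le> (\<integral>\<omega>. r powr r * (exp (Y \<omega>) + exp (- Y \<omega>)) \<partial>\<Omega>)"
  proof (rule integral_mono[OF i3])
    show "integrable \<Omega> (\<lambda>\<omega>. r powr r * (exp (Y \<omega>) + exp (- Y \<omega>)))" using i1 i2 by simp
    fix \<omega>
    have "\<bar>Y \<omega>\<bar> powr r \<le> r powr r * exp \<bar>Y \<omega>\<bar>" using r by (intro powr_le_exp) auto
    also have "\<dots> \<le> r powr r * (exp (Y \<omega>) + exp (- Y \<omega>))"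
      by (intro mult_left_mono) (auto simp: abs_if)
    finally show "\<bar>Y \<omega>\<bar> powr r \<le> r powr r * (exp (Y \<omega>) + exp (- Y \<omega>))" .
  qed
  also have "\<dots> = r powr r * ((\<integral>\<omega>. exp (Y \<omega>) \<partial>\<Omega>) + (\<integral>\<omega>. exp (- Y \<omega>) \<partial>\<Omega>))"
    using i1 i2 by simp
  also have "\<dots> \<le> r powr r * (exp (1/2) + exp (1/2))"
    using e1 e2 by (intro mult_left_mono add_mono) auto
  finally have le: "(\<integral>\<omega>. \<bar>Y \<omega>\<bar> powr r \<partial>\<Omega>) \<le> khintchine_const r" by (simp add: khintchine_const_def)
  have "\<bar>\<Sum>i<n. \<epsilon> i \<omega> * a i\<bar> powr r = S powr r * \<bar>Y \<omega>\<bar> powr r" for \<omega>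
  proof -
    have "(\<Sum>i<n. \<epsilon> i \<omega> * a i) = S * Y \<omega>" using S by (simp add: Y_def b_def sum_distrib_left)
    then show ?thesis using S by (simp add: abs_mult powr_mult)
  qed
  then have "(\<integral>\<omega>. \<bar>\<Sum>i<n. \<epsilon> i \<omega> * a i\<bar> powr r \<partial>\<Omega>) = S powr r * (\<integral>\<omega>. \<bar>Y \<omega>\<bar> powr r \<partial>\<Omega>)" by simp
  also have "\<dots> \<le> S powr r * khintchine_const r" using le by (intro mult_left_mono) auto
  finally show ?thesis by (simp add: S_def mult.commute)
qed

lemma rademacher_second_moment:
  fixes a :: "nat \<Rightarrow> real"
  assumes R: "rademacher_sequence \<Omega> \<epsilon>"
  shows "(\<integral>\<omega>. (\<Sum>i<n. \<epsilon> i \<omega> * a i)\<^sup>2 \<partial>\<Omega>) = (\<Sum>i<n. (a i)\<^sup>2)"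
proof -
  interpret prob_space \<Omega> by (rule rademacher_sequenceD[OF R])
  note [measurable] = rademacher_sequenceD(3)[OF R]
  have int: "integrable \<Omega> (\<lambda>\<omega>. \<epsilon> i \<omega> * \<epsilon> j \<omega>)" for i j
  proof (rule integrable_rademacher[OF R, where B = 1])
    fix \<omega> assume "\<omega> \<in> space \<Omega>"
    then show "\<bar>\<epsilon> i \<omega> * \<epsilon> j \<omega>\<bar> \<le> 1"
      using rademacher_sequenceD(4)[OF R, of \<omega> i] rademacher_sequenceD(4)[OF R, of \<omega> j] by auto
  qed simp
  have int1: "integrable \<Omega> (\<epsilon> i)" for i
  proof (rule integrable_rademacher[OF R, where B = 1])
    fix \<omega> assume "\<omega> \<in> space \<Omega>"
    then show "\<bar>\<epsilon> i \<omega>\<bar> \<le> 1" using rademacher_sequenceD(4)[OF R, of \<omega> i] by auto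
  qed simp
  have orth: "(\<integral>\<omega>. \<epsilon> i \<omega> * \<epsilon> j \<omega> \<partial>\<Omega>) = (if i = j then 1 else 0)" for i j
  proof (cases "i = j")
    case True
    have "(\<integral>\<omega>. \<epsilon> i \<omega> * \<epsilon> i \<omega> \<partial>\<Omega>) = 1"
      using integral_rademacher[OF R, of "\<lambda>x. x * x" i] by simp
    then show ?thesis using True by simp
  next
    case False
    have "indep_vars (\<lambda>_. borel) \<epsilon> {i, j}"
      using rademacher_sequenceD(2)[OF R] by (rule indep_vars_subset) auto
    then have "(\<integral>\<omega>. (\<Prod>k\<in>{i, j}. \<epsilon> k \<omega>) \<partial>\<Omega>) = (\<Prod>k\<in>{i, j}. \<integral>\<omega>. \<epsilon> k \<omega> \<partial>\<Omega>)"
      using int1 by (intro indep_vars_lebesgue_integral) auto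
    then show ?thesis using False integral_rademacher[OF R, of "\<lambda>x. x" i] by simp
  qed
  have "(\<Sum>i<n. \<epsilon> i \<omega> * a i)\<^sup>2 = (\<Sum>i<n. \<Sum>j<n. (a i * a j) * (\<epsilon> i \<omega> * \<epsilon> j \<omega>))" for \<omega>
    by (simp add: power2_eq_square sum_product mult_ac)
  then have "(\<integral>\<omega>. (\<Sum>i<n. \<epsilon> i \<omega> * a i)\<^sup>2 \<partial>\<Omega>) = (\<integral>\<omega>. (\<Sum>i<n. \<Sum>j<n. (a i * a j) * (\<epsilon> i \<omega> * \<epsilon> j \<omega>)) \<partial>\<Omega>)"
    by simp
  also have "\<dots> = (\<Sum>i<n. \<Sum>j<n. (a i * a j) * (\<integral>\<omega>. \<epsilon> i \<omega> * \<epsilon> j \<omega> \<partial>\<Omega>))"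
    using int by (simp add: Bochner_Integration.integral_sum)
  also have "\<dots> = (\<Sum>i<n. (a i)\<^sup>2)"
    by (simp add: orth power2_eq_square if_distrib cong: if_cong)
  finally show ?thesis .
qed

lemma khintchine_lower_real:
  fixes a :: "nat \<Rightarrow> real"
  assumes R: "rademacher_sequence \<Omega> \<epsilon>"
  shows "L2_set a {..<n} \<le> 2 * sqrt (2 * khintchine_const 4) * (\<integral>\<omega>. \<bar>\<Sum>i<n. \<epsilon> i \<omega> * a i\<bar> \<partial>\<Omega>)"
proof (cases "L2_set a {..<n} = 0")
  case True
  have "0 \<le> khintchine_const 4" by (simp add: khintchine_const_def)
  then show ?thesis using True by simp
next
  case False
  interpret prob_space \<Omega> by (rule rademacher_sequenceD[OF R])
  note [measurable] = rademacher_sequenceD(3)[OF R]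
  define S where "S = L2_set a {..<n}"
  have S: "0 < S" using False L2_set_nonneg[of a "{..<n}"] unfolding S_def by linarith
  define K where "K = khintchine_const 4"
  have K: "0 < K" by (simp add: K_def khintchine_const_def)
  \<comment> \<open>With this choice the fourth-moment term K S^4 / (\<mu> S)^2 equals S^2 / 2 and
    is absorbed by the left-hand side; that absorption doubles the constant to 2 \<mu>.\<close>
  define \<mu> where "\<mu> = sqrt (2 * K)"
  have \<mu>: "0 < \<mu>" "\<mu>\<^sup>2 = 2 * K" using K by (auto simp: \<mu>_def)
  define X where "X \<omega> = (\<Sum>i<n. \<epsilon> i \<omega> * a i)" for \<omega>
  have [measurable]: "X \<in> borel_measurable \<Omega>" unfolding X_def by measurable
  have Xb: "\<bar>X \<omega>\<bar> \<le> (\<Sum>i<n. \<bar>a i\<bar>)" if "\<omega> \<in> space \<Omega>" for \<omega>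
    using rademacher_sum_abs_le[OF R that, where a = a] by (simp add: X_def)
  have i1: "integrable \<Omega> (\<lambda>\<omega>. \<bar>X \<omega>\<bar>)"
    by (rule integrable_rademacher[OF R, where B = "\<Sum>i<n. \<bar>a i\<bar>"]) (use Xb in auto)
  have i2: "integrable \<Omega> (\<lambda>\<omega>. (X \<omega>)\<^sup>2)"
    by (rule integrable_rademacher[OF R, where B = "(\<Sum>i<n. \<bar>a i\<bar>)\<^sup>2"]) (use Xb in \<open>auto intro!: abs_le_square_iff[THEN iffD1] simp: sum_nonneg\<close>)
  have i4: "integrable \<Omega> (\<lambda>\<omega>. \<bar>X \<omega>\<bar> powr 4)"
  proof (rule integrable_rademacher[OF R, where B = "(\<Sum>i<n. \<bar>a i\<bar>) powr 4"])
    fix \<omega> assume "\<omega> \<in> space \<Omega>"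
    then show "\<bar>\<bar>X \<omega>\<bar> powr 4\<bar> \<le> (\<Sum>i<n. \<bar>a i\<bar>) powr 4"
      unfolding abs_of_nonneg[OF powr_ge_zero] using Xb by (intro powr_mono2) auto
  qed simp
  \<comment> \<open>Splitting at the level \<mu> * S replaces the interpolation of the second moment between the first and the fourth.\<close>
  have pt: "(X \<omega>)\<^sup>2 \<le> \<mu> * S * \<bar>X \<omega>\<bar> + \<bar>X \<omega>\<bar> powr 4 / (\<mu> * S)\<^sup>2" for \<omega>
  proof -
    have 4: "\<bar>X \<omega>\<bar> powr 4 = (X \<omega>)\<^sup>2 * (X \<omega>)\<^sup>2"
      by (simp add: powr_numeral flip: power_add)
    show ?thesis
    proof (cases "\<bar>X \<omega>\<bar> \<le> \<mu> * S")
      case True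
      then have "\<bar>X \<omega>\<bar> * \<bar>X \<omega>\<bar> \<le> \<mu> * S * \<bar>X \<omega>\<bar>" by (intro mult_right_mono) auto
      then show ?thesis by (simp add: power2_eq_square add_increasing2)
    next
      case False
      then have "(\<mu> * S)\<^sup>2 \<le> (X \<omega>)\<^sup>2" using S \<mu> by (intro abs_le_square_iff[THEN iffD1]) auto
      then have "(\<mu> * S)\<^sup>2 * (X \<omega>)\<^sup>2 \<le> (X \<omega>)\<^sup>2 * (X \<omega>)\<^sup>2" by (rule mult_right_mono) simp
      then have "(X \<omega>)\<^sup>2 \<le> \<bar>X \<omega>\<bar> powr 4 / (\<mu> * S)\<^sup>2"
        unfolding 4 using S \<mu> by (subst pos_le_divide_eq) (auto simp: mult.commute)
      then show ?thesis using S \<mu> by (simp add: add_increasing)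
    qed
  qed
  have "S\<^sup>2 = (\<integral>\<omega>. (X \<omega>)\<^sup>2 \<partial>\<Omega>)"
    using rademacher_second_moment[OF R, where n = n and a = a] by (simp add: X_def S_def L2_set_def sum_nonneg)
  also have "\<dots> \<le> (\<integral>\<omega>. \<mu> * S * \<bar>X \<omega>\<bar> + \<bar>X \<omega>\<bar> powr 4 / (\<mu> * S)\<^sup>2 \<partial>\<Omega>)"
    using i1 i2 i4 pt by (intro integral_mono) auto
  also have "\<dots> = \<mu> * S * (\<integral>\<omega>. \<bar>X \<omega>\<bar> \<partial>\<Omega>) + (\<integral>\<omega>. \<bar>X \<omega>\<bar> powr 4 \<partial>\<Omega>) / (\<mu> * S)\<^sup>2"
    using i1 i4 by simp
  also have "(\<integral>\<omega>. \<bar>X \<omega>\<bar> powr 4 \<partial>\<Omega>) \<le> K * S powr 4"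
    using khintchine_upper_real[OF R, where r = 4 and n = n and a = a] by (simp add: X_def K_def S_def)
  also have "K * S powr 4 / (\<mu> * S)\<^sup>2 = S\<^sup>2 / 2"
    using S K \<mu> by (simp add: power_mult_distrib field_simps)
  finally have "S\<^sup>2 \<le> \<mu> * S * (\<integral>\<omega>. \<bar>X \<omega>\<bar> \<partial>\<Omega>) + S\<^sup>2 / 2"
    by (simp add: divide_right_mono)
  then have "S * S \<le> S * (2 * \<mu> * (\<integral>\<omega>. \<bar>X \<omega>\<bar> \<partial>\<Omega>))"
    by (simp add: power2_eq_square algebra_simps)
  then have "S \<le> 2 * \<mu> * (\<integral>\<omega>. \<bar>X \<omega>\<bar> \<partial>\<Omega>)" using S by simp
  then show ?thesis by (simp add: S_def \<mu>_def K_def X_def)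
qed

lemma L2_set_sum_le:
  assumes "finite J"
  shows "L2_set (\<lambda>i. \<Sum>b\<in>J. f b i) I \<le> (\<Sum>b\<in>J. L2_set (f b) I)"
  using assms
proof (induction J rule: finite_induct)
  case empty
  then show ?case by (simp add: L2_set_def)
next
  case (insert b J)
  have "L2_set (\<lambda>i. f b i + (\<Sum>b\<in>J. f b i)) I \<le> L2_set (f b) I + L2_set (\<lambda>i. \<Sum>b\<in>J. f b i) I"
    by (rule L2_set_triangle_ineq)
  then show ?case using insert by simp
qed

text \<open>Reduction to the real coordinates. The power of the dimension comes from a power of a
  sum, the further factor counts the coordinates.\<close>

lemma khintchine_upper:
  fixes a :: "nat \<Rightarrow> 'b::euclidean_space"
  assumes R: "rademacher_sequence \<Omega> \<epsilon>" and r: "0 < r"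
  shows "(\<integral>\<^sup>+\<omega>. ennreal (norm (\<Sum>i<n. \<epsilon> i \<omega> *\<^sub>R a i) powr r) \<partial>\<Omega>)
    \<le> ennreal (DIM('b) powr r * (DIM('b) * khintchine_const r) * L2_set (\<lambda>i. norm (a i)) {..<n} powr r)"
proof -
  note [measurable] = rademacher_sequenceD(3)[OF R]
  define S where "S = L2_set (\<lambda>i. norm (a i)) {..<n}"
  have K: "0 \<le> khintchine_const r" by (simp add: khintchine_const_def)
  have int: "integrable \<Omega> (\<lambda>\<omega>. \<bar>\<Sum>i<n. \<epsilon> i \<omega> * c i\<bar> powr r)" for c
  proof (rule integrable_rademacher[OF R, where B = "(\<Sum>i<n. \<bar>c i\<bar>) powr r"])
    fix \<omega> assume "\<omega> \<in> space \<Omega>"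
    then show "\<bar>\<bar>\<Sum>i<n. \<epsilon> i \<omega> * c i\<bar> powr r\<bar> \<le> (\<Sum>i<n. \<bar>c i\<bar>) powr r"
      using rademacher_sum_abs_le[OF R, of \<omega> c n] r by (auto intro: powr_mono2)
  qed simp
  have one: "(\<integral>\<^sup>+\<omega>. ennreal (\<bar>\<Sum>i<n. \<epsilon> i \<omega> * (a i \<bullet> b)\<bar> powr r) \<partial>\<Omega>) \<le> ennreal (khintchine_const r * S powr r)"
    if b: "b \<in> Basis" for b
  proof -
    have "(\<integral>\<^sup>+\<omega>. ennreal (\<bar>\<Sum>i<n. \<epsilon> i \<omega> * (a i \<bullet> b)\<bar> powr r) \<partial>\<Omega>)
        = ennreal (\<integral>\<omega>. \<bar>\<Sum>i<n. \<epsilon> i \<omega> * (a i \<bullet> b)\<bar> powr r \<partial>\<Omega>)"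
      using int by (intro nn_integral_eq_integral) auto
    also have "\<dots> \<le> ennreal (khintchine_const r * L2_set (\<lambda>i. a i \<bullet> b) {..<n} powr r)"
      by (intro ennreal_leI khintchine_upper_real R r)
    also have "\<dots> \<le> ennreal (khintchine_const r * S powr r)"
    proof (intro ennreal_leI mult_left_mono powr_mono2 K)
      show "L2_set (\<lambda>i. a i \<bullet> b) {..<n} \<le> S"
        unfolding S_def L2_set_def using b
        by (intro real_sqrt_le_mono sum_mono abs_le_square_iff[THEN iffD1]) (auto simp: Basis_le_norm)
    qed (use r in \<open>auto simp: L2_set_nonneg\<close>)
    finally show ?thesis .
  qed
  have "(\<integral>\<^sup>+\<omega>. ennreal (norm (\<Sum>i<n. \<epsilon> i \<omega> *\<^sub>R a i) powr r) \<partial>\<Omega>)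
    \<le> (\<integral>\<^sup>+\<omega>. ennreal (DIM('b) powr r) * (\<Sum>b\<in>Basis. ennreal (\<bar>\<Sum>i<n. \<epsilon> i \<omega> * (a i \<bullet> b)\<bar> powr r)) \<partial>\<Omega>)"
  proof (rule nn_integral_mono)
    fix \<omega>
    define v where "v = (\<Sum>i<n. \<epsilon> i \<omega> *\<^sub>R a i)"
    have "norm v powr r \<le> (\<Sum>b\<in>Basis. \<bar>v \<bullet> b\<bar>) powr r"
      using r by (intro powr_mono2 norm_le_l1) auto
    also have "\<dots> \<le> DIM('b) powr r * (\<Sum>b\<in>Basis. \<bar>v \<bullet> b\<bar> powr r)"
      using r by (intro powr_sum_le) auto
    finally show "ennreal (norm (\<Sum>i<n. \<epsilon> i \<omega> *\<^sub>R a i) powr r)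
        \<le> ennreal (DIM('b) powr r) * (\<Sum>b\<in>Basis. ennreal (\<bar>\<Sum>i<n. \<epsilon> i \<omega> * (a i \<bullet> b)\<bar> powr r))"
      by (auto simp: v_def inner_sum_left simp flip: ennreal_mult' intro!: ennreal_leI)
  qed
  also have "\<dots> = ennreal (DIM('b) powr r) * (\<Sum>b\<in>Basis. \<integral>\<^sup>+\<omega>. ennreal (\<bar>\<Sum>i<n. \<epsilon> i \<omega> * (a i \<bullet> b)\<bar> powr r) \<partial>\<Omega>)"
    by (subst nn_integral_cmult) (auto simp: nn_integral_sum simp del: sum_ennreal)
  also have "\<dots> \<le> ennreal (DIM('b) powr r) * (\<Sum>b\<in>(Basis :: 'b set). ennreal (khintchine_const r * S powr r))"
    by (intro mult_left_mono sum_mono one) auto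
  also have "\<dots> = ennreal (DIM('b) powr r * (DIM('b) * khintchine_const r) * S powr r)"
    using K by (simp add: ennreal_of_nat_eq_real_of_nat mult.assoc flip: ennreal_mult')
  finally show ?thesis by (simp add: S_def)
qed

text \<open>Again coordinatewise. The expectation is an extended integral so that Tonelli's theorem
  applies when it is integrated in x.\<close>

lemma khintchine_lower:
  fixes a :: "nat \<Rightarrow> 'b::euclidean_space"
  assumes R: "rademacher_sequence \<Omega> \<epsilon>"
  shows "ennreal (L2_set (\<lambda>i. norm (a i)) {..<n})
    \<le> ennreal (DIM('b) * (2 * sqrt (2 * khintchine_const 4))) * (\<integral>\<^sup>+\<omega>. ennreal (norm (\<Sum>i<n. \<epsilon> i \<omega> *\<^sub>R a i)) \<partial>\<Omega>)"
proof -
  note [measurable] = rademacher_sequenceD(3)[OF R]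
  define c where "c = 2 * sqrt (2 * khintchine_const 4)"
  have c: "0 \<le> c" by (simp add: c_def khintchine_const_def)
  define X where "X \<omega> = (\<Sum>i<n. \<epsilon> i \<omega> *\<^sub>R a i)" for \<omega>
  have [measurable]: "X \<in> borel_measurable \<Omega>" unfolding X_def by measurable
  have i1: "integrable \<Omega> (\<lambda>\<omega>. norm (X \<omega>))"
    by (rule integrable_rademacher[OF R, where B = "\<Sum>i<n. norm (a i)"])
      (use rademacher_sum_abs_le[OF R] in \<open>auto simp: X_def\<close>)
  have ib: "integrable \<Omega> (\<lambda>\<omega>. \<bar>X \<omega> \<bullet> b\<bar>)" if "b \<in> Basis" for b
    by (rule Bochner_Integration.integrable_bound[OF i1]) (use that in \<open>auto simp: Basis_le_norm\<close>)
  have "L2_set (\<lambda>i. norm (a i)) {..<n} \<le> L2_set (\<lambda>i. \<Sum>b\<in>Basis. \<bar>a i \<bullet> b\<bar>) {..<n}"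
    by (intro L2_set_mono norm_le_l1) auto
  also have "\<dots> \<le> (\<Sum>b\<in>Basis. L2_set (\<lambda>i. \<bar>a i \<bullet> b\<bar>) {..<n})"
    by (rule L2_set_sum_le) simp
  also have "\<dots> = (\<Sum>b\<in>Basis. L2_set (\<lambda>i. a i \<bullet> b) {..<n})" by (simp add: L2_set_def)
  also have "\<dots> \<le> (\<Sum>b\<in>(Basis :: 'b set). c * (\<integral>\<omega>. norm (X \<omega>) \<partial>\<Omega>))"
  proof (rule sum_mono)
    fix b :: 'b assume b: "b \<in> Basis"
    have "L2_set (\<lambda>i. a i \<bullet> b) {..<n} \<le> c * (\<integral>\<omega>. \<bar>X \<omega> \<bullet> b\<bar> \<partial>\<Omega>)"
      using khintchine_lower_real[OF R, where n = n and a = "\<lambda>i. a i \<bullet> b"] by (simp add: c_def X_def inner_sum_left)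
    also have "\<dots> \<le> c * (\<integral>\<omega>. norm (X \<omega>) \<partial>\<Omega>)"
      using ib[OF b] i1 b c by (intro mult_left_mono integral_mono) (auto simp: Basis_le_norm)
    finally show "L2_set (\<lambda>i. a i \<bullet> b) {..<n} \<le> c * (\<integral>\<omega>. norm (X \<omega>) \<partial>\<Omega>)" .
  qed
  also have "\<dots> = DIM('b) * c * (\<integral>\<omega>. norm (X \<omega>) \<partial>\<Omega>)" by simp
  finally have "ennreal (L2_set (\<lambda>i. norm (a i)) {..<n}) \<le> ennreal (DIM('b) * c * (\<integral>\<omega>. norm (X \<omega>) \<partial>\<Omega>))"
    by (rule ennreal_leI)
  also have "\<dots> = ennreal (DIM('b) * c) * (\<integral>\<^sup>+\<omega>. ennreal (norm (X \<omega>)) \<partial>\<Omega>)"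
    using c i1 by (subst nn_integral_eq_integral) (auto simp: ennreal_mult')
  finally show ?thesis by (simp add: c_def X_def)
qed

section \<open>Rademacher averages in Lp\<close>

lemma Lp_space_sum_bound:
  fixes f :: "nat \<Rightarrow> 'a \<Rightarrow> 'b::real_normed_vector"
  assumes f: "\<And>i. i < n \<Longrightarrow> f i \<in> Lp_space \<mu> p" and p: "0 < p"
  shows "integrable \<mu> (\<lambda>x. (\<Sum>i<n. norm (f i x)) powr p)"
proof (rule Bochner_Integration.integrable_bound)
  have [measurable]: "f i \<in> borel_measurable \<mu>" if "i < n" for i using f[OF that] by (simp add: Lp_space_def)
  show "integrable \<mu> (\<lambda>x. real n powr p * (\<Sum>i<n. norm (f i x) powr p))"
    using f by (auto simp: Lp_space_def)
  show "(\<lambda>x. (\<Sum>i<n. norm (f i x)) powr p) \<in> borel_measurable \<mu>" by measurable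
  show "AE x in \<mu>. norm ((\<Sum>i<n. norm (f i x)) powr p) \<le> norm (real n powr p * (\<Sum>i<n. norm (f i x) powr p))"
    using powr_sum_le[of "{..<n}" "\<lambda>i. norm (f i _)" p] p by (auto simp: sum_nonneg)
qed

lemma rademacher_Lp_integrable:
  fixes f :: "nat \<Rightarrow> 'a \<Rightarrow> 'k::euclidean_space"
  assumes R: "rademacher_sequence \<Omega> \<epsilon>" and f: "\<And>i. i < n \<Longrightarrow> f i \<in> Lp_space \<mu> p" and p: "0 < p"
    and \<omega>: "\<omega> \<in> space \<Omega>"
  shows "integrable \<mu> (\<lambda>x. norm (\<Sum>i<n. \<epsilon> i \<omega> *\<^sub>R f i x) powr p)"
    and "(\<integral>x. norm (\<Sum>i<n. \<epsilon> i \<omega> *\<^sub>R f i x) powr p \<partial>\<mu>) \<le> (\<integral>x. (\<Sum>i<n. norm (f i x)) powr p \<partial>\<mu>)"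
proof -
  have [measurable]: "f i \<in> borel_measurable \<mu>" if "i < n" for i using f[OF that] by (simp add: Lp_space_def)
  note i1 = Lp_space_sum_bound[OF f p]
  have le: "norm (\<Sum>i<n. \<epsilon> i \<omega> *\<^sub>R f i x) powr p \<le> (\<Sum>i<n. norm (f i x)) powr p" for x
    using p by (intro powr_mono2 rademacher_sum_abs_le[OF R \<omega>]) auto
  show i2: "integrable \<mu> (\<lambda>x. norm (\<Sum>i<n. \<epsilon> i \<omega> *\<^sub>R f i x) powr p)"
    by (rule Bochner_Integration.integrable_bound[OF i1]) (use le in auto)
  show "(\<integral>x. norm (\<Sum>i<n. \<epsilon> i \<omega> *\<^sub>R f i x) powr p \<partial>\<mu>) \<le> (\<integral>x. (\<Sum>i<n. norm (f i x)) powr p \<partial>\<mu>)"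
    by (intro integral_mono i1 i2 le)
qed

text \<open>With N the p-th power of the inner norm, Hoelder's inequality gives (N / B)^(r/p) \<le>
  W / B, where W is the integral of |X|^r S^(p - r). Its expectation is at most K B by Tonelli and
  Khintchine's inequality with exponent r. Since q \<le> r, the q/p-th power is at most 1 plus the
  r/p-th, which explains the constant 1 + K.\<close>

lemma rademacher_Lp_upper_pos:
  fixes f :: "nat \<Rightarrow> 'a \<Rightarrow> 'k::euclidean_space"
  assumes R: "rademacher_sequence \<Omega> \<epsilon>" and sf: "sigma_finite_measure \<mu>" and p: "1 < p" and q: "1 \<le> q"
    and r: "p < r" "q \<le> r"
    and f: "\<And>i. i < n \<Longrightarrow> f i \<in> Lp_space \<mu> p" and B: "0 < B"
    and SB: "(\<integral>\<^sup>+x. ennreal (L2_set (\<lambda>i. norm (f i x)) {..<n} powr p) \<partial>\<mu>) \<le> ennreal B"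
  shows "Lp_norm \<Omega> q (\<lambda>\<omega>. Lp_norm \<mu> p (\<lambda>x. \<Sum>i<n. \<epsilon> i \<omega> *\<^sub>R f i x))
    \<le> (1 + DIM('k) powr r * (DIM('k) * khintchine_const r)) powr (1 / q) * B powr (1 / p)"
proof -
  interpret prob_space \<Omega> by (rule rademacher_sequenceD[OF R])
  interpret sigma_finite_measure \<mu> by (rule sf)
  interpret P: pair_sigma_finite \<mu> \<Omega> by standard
  note [measurable] = rademacher_sequenceD(3)[OF R]
  have [measurable]: "f i \<in> borel_measurable \<mu>" if "i \<in> {..<n}" for i using f that by (simp add: Lp_space_def)
  define K where "K = DIM('k) powr r * (DIM('k) * khintchine_const r)"
  have K: "0 \<le> K" by (simp add: K_def khintchine_const_def)
  define X where "X \<omega> x = (\<Sum>i<n. \<epsilon> i \<omega> *\<^sub>R f i x)" for \<omega> x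
  define S where "S x = L2_set (\<lambda>i. norm (f i x)) {..<n}" for x
  have S0: "0 \<le> S x" for x by (simp add: S_def L2_set_nonneg)
  have [measurable]: "S \<in> borel_measurable \<mu>" unfolding S_def L2_set_def by measurable
  have Xm[measurable]: "(\<lambda>(x, \<omega>). norm (X \<omega> x)) \<in> borel_measurable (\<mu> \<Otimes>\<^sub>M \<Omega>)" unfolding X_def by measurable
  have Xm1[measurable]: "X \<omega> \<in> borel_measurable \<mu>" for \<omega> unfolding X_def by measurable
  \<comment> \<open>The weight \<open>S x powr (p - r)\<close> has a negative exponent and takes the
    default value 0 where S = 0. As X vanishes there, inserting the weight and its inverse loses
    nothing.\<close>
  have X0: "X \<omega> x = 0" if "S x = 0" for \<omega> x
    using that by (simp add: X_def S_def L2_set_eq_0_iff)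
  define N where "N \<omega> = (\<integral>x. norm (X \<omega> x) powr p \<partial>\<mu>)" for \<omega>
  have N0: "0 \<le> N \<omega>" for \<omega> by (simp add: N_def)
  have Nm[measurable]: "N \<in> borel_measurable \<Omega>"
  proof -
    have "(\<lambda>\<omega>. \<integral>x. norm (\<Sum>i<n. \<epsilon> i \<omega> *\<^sub>R f i x) powr p \<partial>\<mu>) \<in> borel_measurable \<Omega>" by measurable
    then show ?thesis by (simp add: N_def[abs_def] X_def)
  qed
  have Nnn: "(\<integral>\<^sup>+x. ennreal (norm (X \<omega> x) powr p) \<partial>\<mu>) = ennreal (N \<omega>)" if "\<omega> \<in> space \<Omega>" for \<omega>
    unfolding N_def X_def using p rademacher_Lp_integrable(1)[OF R f _ that]
    by (intro nn_integral_eq_integral) auto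
  define W where "W \<omega> = (\<integral>\<^sup>+x. ennreal (norm (X \<omega> x) powr r * S x powr (p - r)) \<partial>\<mu>)" for \<omega>
  have "(\<integral>\<^sup>+\<omega>. W \<omega> \<partial>\<Omega>) = (\<integral>\<^sup>+x. \<integral>\<^sup>+\<omega>. ennreal (norm (X \<omega> x) powr r * S x powr (p - r)) \<partial>\<Omega> \<partial>\<mu>)"
    unfolding W_def by (rule P.Fubini') measurable
  also have "\<dots> \<le> (\<integral>\<^sup>+x. ennreal K * ennreal (S x powr p) \<partial>\<mu>)"
  proof (rule nn_integral_mono)
    fix x
    have "(\<integral>\<^sup>+\<omega>. ennreal (norm (X \<omega> x) powr r * S x powr (p - r)) \<partial>\<Omega>)
       = (\<integral>\<^sup>+\<omega>. ennreal (norm (X \<omega> x) powr r) * ennreal (S x powr (p - r)) \<partial>\<Omega>)"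
      by (simp add: ennreal_mult')
    also have "\<dots> = (\<integral>\<^sup>+\<omega>. ennreal (norm (X \<omega> x) powr r) \<partial>\<Omega>) * ennreal (S x powr (p - r))"
      unfolding X_def by (rule nn_integral_multc) measurable
    also have "\<dots> \<le> ennreal (K * S x powr r) * ennreal (S x powr (p - r))"
      unfolding X_def K_def S_def using r p by (intro mult_right_mono khintchine_upper R) auto
    also have "\<dots> = ennreal K * ennreal (S x powr p)"
      using K by (simp add: mult.assoc flip: ennreal_mult' powr_add)
    finally show "(\<integral>\<^sup>+\<omega>. ennreal (norm (X \<omega> x) powr r * S x powr (p - r)) \<partial>\<Omega>) \<le> ennreal K * ennreal (S x powr p)" .
  qed
  also have "\<dots> = ennreal K * (\<integral>\<^sup>+x. ennreal (S x powr p) \<partial>\<mu>)" by (intro nn_integral_cmult) measurable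
  also have "\<dots> \<le> ennreal K * ennreal B" using SB by (intro mult_left_mono) (auto simp: S_def)
  finally have WKB: "(\<integral>\<^sup>+\<omega>. W \<omega> \<partial>\<Omega>) \<le> ennreal (K * B)" using K by (simp add: ennreal_mult')
  define r' where "r' = r / (r - p)"
  have rp: "1 < r / p" "1 < r'" "1 / (r / p) + 1 / r' = 1" "1 / r' = 1 - p / r"
    using r p by (auto simp: r'_def field_simps)
  \<comment> \<open>Hoelder's inequality for the measure S^p d\<mu> raises the exponent from p to r, where Khintchine's
    inequality can be applied pointwise.\<close>
  have NW: "ennreal ((N \<omega> / B) powr (r / p)) \<le> ennreal (1 / B) * W \<omega>" if \<omega>: "\<omega> \<in> space \<Omega>" for \<omega>
  proof (cases "W \<omega> = \<infinity>")
    case True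
    then show ?thesis using B by (simp add: ennreal_mult_top)
  next
    case False
    define w where "w = enn2real (W \<omega>)"
    have w: "W \<omega> = ennreal w" "0 \<le> w" using False by (auto simp: w_def less_top)
    have "ennreal (N \<omega>) = (\<integral>\<^sup>+x. ennreal ((norm (X \<omega> x) powr p * S x powr (p * (p - r) / r)) * S x powr (p * (r - p) / r)) \<partial>\<mu>)"
      unfolding Nnn[OF \<omega>, symmetric]
    proof (rule nn_integral_cong)
      fix x
      have "p * (p - r) / r + p * (r - p) / r = 0"
        by (simp add: algebra_simps flip: add_divide_distrib)
      then have "S x powr (p * (p - r) / r) * S x powr (p * (r - p) / r) = (if S x = 0 then 0 else 1)"
        by (simp flip: powr_add)
      then show "ennreal (norm (X \<omega> x) powr p) = ennreal ((norm (X \<omega> x) powr p * S x powr (p * (p - r) / r)) * S x powr (p * (r - p) / r))"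
        using X0[of x \<omega>] p by (simp add: mult.assoc)
    qed
    also have "\<dots> \<le> ennreal (w powr (1 / (r / p)) * B powr (1 / r'))"
    proof (rule nn_integral_Holder[OF _ _ _ _ rp(1-3)])
      have "(norm (X \<omega> x) powr p * S x powr (p * (p - r) / r)) powr (r / p) = norm (X \<omega> x) powr r * S x powr (p - r)" for x
        using p r by (simp add: powr_mult powr_powr)
      then show "(\<integral>\<^sup>+x. ennreal ((norm (X \<omega> x) powr p * S x powr (p * (p - r) / r)) powr (r / p)) \<partial>\<mu>) \<le> ennreal w"
        unfolding w(1)[symmetric] W_def by simp
      have "(S x powr (p * (r - p) / r)) powr r' = S x powr p" for x
        using p r by (simp add: powr_powr r'_def)
      then show "(\<integral>\<^sup>+x. ennreal ((S x powr (p * (r - p) / r)) powr r') \<partial>\<mu>) \<le> ennreal B"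
        using SB by (simp add: S_def)
    qed (use w B in auto)
    finally have "N \<omega> \<le> w powr (p / r) * B powr (1 - p / r)"
      by (simp add: rp(4))
    also have "\<dots> = (w / B) powr (p / r) * B"
      using w B by (simp add: powr_divide powr_diff)
    finally have "N \<omega> / B \<le> (w / B) powr (p / r)"
      using B by (simp add: pos_divide_le_eq)
    then have "(N \<omega> / B) powr (r / p) \<le> ((w / B) powr (p / r)) powr (r / p)"
      using N0 B p r by (intro powr_mono2) auto
    also have "\<dots> = 1 / B * w" using w B p r by (simp add: powr_powr)
    finally show ?thesis
      unfolding w(1) using B by (auto simp flip: ennreal_mult' intro!: ennreal_leI)
  qed
  have "(\<integral>\<^sup>+\<omega>. ennreal (N \<omega> powr (q / p)) \<partial>\<Omega>) \<le> (\<integral>\<^sup>+\<omega>. ennreal (B powr (q / p)) * (1 + ennreal (1 / B) * W \<omega>) \<partial>\<Omega>)"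
  proof (rule nn_integral_mono)
    fix \<omega> assume \<omega>: "\<omega> \<in> space \<Omega>"
    define y where "y = N \<omega> / B"
    have y: "0 \<le> y" using N0 B by (simp add: y_def)
    have "y powr (q / p) \<le> 1 + y powr (r / p)"
    proof (cases "y \<le> 1")
      case True
      then have "y powr (q / p) \<le> 1" using y p q by (intro powr_le1) auto
      then show ?thesis by (simp add: add_increasing2)
    next
      case False
      then have "y powr (q / p) \<le> y powr (r / p)" using p r by (intro powr_mono divide_right_mono) auto
      then show ?thesis by simp
    qed
    then have "ennreal (y powr (q / p)) \<le> ennreal (1 + y powr (r / p))" by (rule ennreal_leI)
    also have "\<dots> = 1 + ennreal (y powr (r / p))" by simp
    also have "\<dots> \<le> 1 + ennreal (1 / B) * W \<omega>"
      using NW[OF \<omega>] by (intro add_left_mono) (simp add: y_def)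
    finally have "ennreal (B powr (q / p)) * ennreal (y powr (q / p)) \<le> ennreal (B powr (q / p)) * (1 + ennreal (1 / B) * W \<omega>)"
      by (rule mult_left_mono) simp
    also have "ennreal (B powr (q / p)) * ennreal (y powr (q / p)) = ennreal (N \<omega> powr (q / p))"
      using B N0 by (simp add: y_def powr_divide flip: ennreal_mult')
    finally show "ennreal (N \<omega> powr (q / p)) \<le> ennreal (B powr (q / p)) * (1 + ennreal (1 / B) * W \<omega>)" .
  qed
  also have "\<dots> = ennreal (B powr (q / p)) * (1 + ennreal (1 / B) * (\<integral>\<^sup>+\<omega>. W \<omega> \<partial>\<Omega>))"
  proof -
    have [measurable]: "W \<in> borel_measurable \<Omega>"
    proof -
      have "(\<lambda>\<omega>. \<integral>\<^sup>+x. ennreal (norm (\<Sum>i<n. \<epsilon> i \<omega> *\<^sub>R f i x) powr r * S x powr (p - r)) \<partial>\<mu>) \<in> borel_measurable \<Omega>" by measurable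
      then show ?thesis by (simp add: W_def[abs_def] X_def)
    qed
    show ?thesis by (simp add: nn_integral_cmult nn_integral_add emeasure_space_1)
  qed
  also have "\<dots> \<le> ennreal (B powr (q / p)) * (1 + ennreal (1 / B) * ennreal (K * B))"
    using WKB by (intro mult_left_mono add_left_mono) auto
  also have "\<dots> = ennreal ((1 + K) * B powr (q / p))"
    using K B by (simp add: mult.commute flip: ennreal_mult' ennreal_1 ennreal_plus)
  finally have "(\<integral>\<omega>. N \<omega> powr (q / p) \<partial>\<Omega>) \<le> (1 + K) * B powr (q / p)"
    using K B by (intro integral_real_bounded) auto
  then have "(\<integral>\<omega>. N \<omega> powr (q / p) \<partial>\<Omega>) powr (1 / q) \<le> ((1 + K) * B powr (q / p)) powr (1 / q)"
    using q by (intro powr_mono2) auto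
  also have "\<dots> = (1 + K) powr (1 / q) * B powr (1 / p)"
    using K q by (simp add: powr_mult powr_powr)
  finally show ?thesis
    using p q unfolding Lp_norm_def by (simp add: powr_powr X_def N_def K_def)
qed

text \<open>A zero bound is also a bound by every positive number; letting that number tend to 0
  settles the degenerate case.\<close>

lemma rademacher_Lp_upper:
  fixes f :: "nat \<Rightarrow> 'a \<Rightarrow> 'k::euclidean_space"
  assumes R: "rademacher_sequence \<Omega> \<epsilon>" and sf: "sigma_finite_measure \<mu>" and p: "1 < p" and q: "1 \<le> q"
    and r: "p < r" "q \<le> r"
    and f: "\<And>i. i < n \<Longrightarrow> f i \<in> Lp_space \<mu> p" and B: "0 \<le> B"
    and SB: "(\<integral>\<^sup>+x. ennreal (L2_set (\<lambda>i. norm (f i x)) {..<n} powr p) \<partial>\<mu>) \<le> ennreal B"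
  shows "Lp_norm \<Omega> q (\<lambda>\<omega>. Lp_norm \<mu> p (\<lambda>x. \<Sum>i<n. \<epsilon> i \<omega> *\<^sub>R f i x))
    \<le> (1 + DIM('k) powr r * (DIM('k) * khintchine_const r)) powr (1 / q) * B powr (1 / p)"
proof (cases "B = 0")
  case False
  then show ?thesis using B by (intro rademacher_Lp_upper_pos[OF R sf p q r f _ SB]) auto
next
  case True
  define c where "c = (1 + DIM('k) powr r * (DIM('k) * khintchine_const r)) powr (1 / q)"
  have "0 \<le> DIM('k) powr r * (DIM('k) * khintchine_const r)" by (simp add: khintchine_const_def)
  then have c: "0 < c" by (simp add: c_def)
  have "Lp_norm \<Omega> q (\<lambda>\<omega>. Lp_norm \<mu> p (\<lambda>x. \<Sum>i<n. \<epsilon> i \<omega> *\<^sub>R f i x)) \<le> 0 + e" if e: "0 < e" for e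
  proof -
    define b where "b = (e / c) powr p"
    have b: "0 < b" using e c by (simp add: b_def)
    have "(\<integral>\<^sup>+x. ennreal (L2_set (\<lambda>i. norm (f i x)) {..<n} powr p) \<partial>\<mu>) \<le> ennreal b"
      using SB True by simp
    from rademacher_Lp_upper_pos[OF R sf p q r f b this]
    have "Lp_norm \<Omega> q (\<lambda>\<omega>. Lp_norm \<mu> p (\<lambda>x. \<Sum>i<n. \<epsilon> i \<omega> *\<^sub>R f i x)) \<le> c * b powr (1 / p)"
      by (simp add: c_def)
    also have "c * b powr (1 / p) = e" using e c p by (simp add: b_def powr_powr)
    finally show ?thesis by simp
  qed
  then have "Lp_norm \<Omega> q (\<lambda>\<omega>. Lp_norm \<mu> p (\<lambda>x. \<Sum>i<n. \<epsilon> i \<omega> *\<^sub>R f i x)) \<le> 0"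
    by (rule field_le_epsilon)
  then show ?thesis using True by simp
qed

text \<open>In S^p = S S^(p - 1) only the first factor is replaced by the expectation of |X|.
  Tonelli and Hoelder's inequality in x bring out the norm V of X and B^(1 - 1/p); the latter is
  absorbed, since B is finite.\<close>

lemma rademacher_Lp_lower:
  fixes f :: "nat \<Rightarrow> 'a \<Rightarrow> 'k::euclidean_space"
  assumes R: "rademacher_sequence \<Omega> \<epsilon>" and sf: "sigma_finite_measure \<mu>" and p: "1 < p" and q: "1 \<le> q"
    and f: "\<And>i. i < n \<Longrightarrow> f i \<in> Lp_space \<mu> p"
  shows "(\<integral>\<^sup>+x. ennreal (L2_set (\<lambda>i. norm (f i x)) {..<n} powr p) \<partial>\<mu>)
    \<le> ennreal ((DIM('k) * (2 * sqrt (2 * khintchine_const 4))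
        * Lp_norm \<Omega> q (\<lambda>\<omega>. Lp_norm \<mu> p (\<lambda>x. \<Sum>i<n. \<epsilon> i \<omega> *\<^sub>R f i x))) powr p)"
proof -
  interpret prob_space \<Omega> by (rule rademacher_sequenceD[OF R])
  interpret sigma_finite_measure \<mu> by (rule sf)
  interpret P: pair_sigma_finite \<mu> \<Omega> by standard
  note [measurable] = rademacher_sequenceD(3)[OF R]
  have [measurable]: "f i \<in> borel_measurable \<mu>" if "i \<in> {..<n}" for i using f that by (simp add: Lp_space_def)
  define c where "c = DIM('k) * (2 * sqrt (2 * khintchine_const 4))"
  have c: "0 \<le> c" by (simp add: c_def khintchine_const_def)
  define X where "X \<omega> x = (\<Sum>i<n. \<epsilon> i \<omega> *\<^sub>R f i x)" for \<omega> x
  define S where "S x = L2_set (\<lambda>i. norm (f i x)) {..<n}" for x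
  have S0: "0 \<le> S x" for x by (simp add: S_def L2_set_nonneg)
  have [measurable]: "S \<in> borel_measurable \<mu>" unfolding S_def L2_set_def by measurable
  have Xm[measurable]: "(\<lambda>(x, \<omega>). norm (X \<omega> x)) \<in> borel_measurable (\<mu> \<Otimes>\<^sub>M \<Omega>)" unfolding X_def by measurable
  have Xm1[measurable]: "X \<omega> \<in> borel_measurable \<mu>" for \<omega> unfolding X_def by measurable
  have Xm2[measurable]: "(\<lambda>\<omega>. X \<omega> x) \<in> borel_measurable \<Omega>" for x unfolding X_def by measurable
  define N where "N \<omega> = (\<integral>x. norm (X \<omega> x) powr p \<partial>\<mu>)" for \<omega>
  have N0: "0 \<le> N \<omega>" for \<omega> by (simp add: N_def)
  have Nm[measurable]: "N \<in> borel_measurable \<Omega>"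
  proof -
    have "(\<lambda>\<omega>. \<integral>x. norm (\<Sum>i<n. \<epsilon> i \<omega> *\<^sub>R f i x) powr p \<partial>\<mu>) \<in> borel_measurable \<Omega>" by measurable
    then show ?thesis by (simp add: N_def[abs_def] X_def)
  qed
  have Nnn: "(\<integral>\<^sup>+x. ennreal (norm (X \<omega> x) powr p) \<partial>\<mu>) = ennreal (N \<omega>)" if "\<omega> \<in> space \<Omega>" for \<omega>
    unfolding N_def X_def using p rademacher_Lp_integrable(1)[OF R f _ that]
    by (intro nn_integral_eq_integral) auto
  define T where "T = (\<integral>x. (\<Sum>i<n. norm (f i x)) powr p \<partial>\<mu>)"
  have NT: "N \<omega> \<le> T" if "\<omega> \<in> space \<Omega>" for \<omega>
    unfolding N_def X_def T_def using p rademacher_Lp_integrable(2)[OF R f _ that] by simp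
  define V where "V \<omega> = N \<omega> powr (1 / p)" for \<omega>
  have V0: "0 \<le> V \<omega>" for \<omega> by (simp add: V_def)
  have [measurable]: "V \<in> borel_measurable \<Omega>" unfolding V_def by measurable
  define Z where "Z = Lp_norm \<Omega> q V"
  have Z0: "0 \<le> Z" by (simp add: Z_def Lp_norm_def)
  have intV: "integrable \<Omega> (\<lambda>\<omega>. V \<omega> powr q)"
  proof (rule integrable_rademacher[OF R, where B = "T powr (q / p)"])
    fix \<omega> assume "\<omega> \<in> space \<Omega>"
    then show "\<bar>V \<omega> powr q\<bar> \<le> T powr (q / p)"
      using NT[of \<omega>] N0 p q by (auto simp: V_def powr_powr intro!: powr_mono2)
  qed simp
  \<comment> \<open>On a probability space the first moment is dominated by the L^q norm; q = 1 is
    separate because it has no finite dual exponent.\<close>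
  have VZ: "(\<integral>\<^sup>+\<omega>. ennreal (V \<omega>) \<partial>\<Omega>) \<le> ennreal Z"
  proof (cases "q = 1")
    case True
    have "(\<integral>\<^sup>+\<omega>. ennreal (V \<omega>) \<partial>\<Omega>) = ennreal (\<integral>\<omega>. V \<omega> \<partial>\<Omega>)"
      using intV V0 True by (intro nn_integral_eq_integral) auto
    then show ?thesis using True V0 by (simp add: Z_def Lp_norm_def)
  next
    case False
    then have q1: "1 < q" using q by simp
    define q' where "q' = q / (q - 1)"
    have q': "1 < q'" "1 / q + 1 / q' = 1" using q1 by (auto simp: q'_def field_simps)
    have "(\<integral>\<^sup>+\<omega>. ennreal (V \<omega> * 1) \<partial>\<Omega>) \<le> ennreal ((\<integral>\<omega>. V \<omega> powr q \<partial>\<Omega>) powr (1 / q) * 1 powr (1 / q'))"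
      using intV V0 by (intro nn_integral_Holder q1 q') (auto simp: nn_integral_eq_integral emeasure_space_1)
    then show ?thesis using V0 by (simp add: Z_def Lp_norm_def)
  qed
  define B where "B = enn2real (\<integral>\<^sup>+x. ennreal (S x powr p) \<partial>\<mu>)"
  have "(\<integral>\<^sup>+x. ennreal (S x powr p) \<partial>\<mu>) \<le> (\<integral>\<^sup>+x. ennreal ((\<Sum>i<n. norm (f i x)) powr p) \<partial>\<mu>)"
    unfolding S_def using p by (intro nn_integral_mono ennreal_leI powr_mono2 L2_set_le_sum) (auto simp: L2_set_nonneg)
  also have "\<dots> = ennreal T"
    unfolding T_def using p Lp_space_sum_bound[OF f] by (intro nn_integral_eq_integral) auto
  also have "\<dots> < \<infinity>" by simp
  finally have B: "(\<integral>\<^sup>+x. ennreal (S x powr p) \<partial>\<mu>) = ennreal B" "0 \<le> B" by (auto simp: B_def)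
  define p' where "p' = p / (p - 1)"
  have p': "1 < p'" "1 / p + 1 / p' = 1" "1 / p' = 1 - 1 / p" using p by (auto simp: p'_def field_simps)
  have "ennreal B \<le> (\<integral>\<^sup>+x. ennreal c * (\<integral>\<^sup>+\<omega>. ennreal (norm (X \<omega> x) * S x powr (p - 1)) \<partial>\<Omega>) \<partial>\<mu>)"
    unfolding B(1)[symmetric]
  proof (rule nn_integral_mono)
    fix x
    have "ennreal (S x powr p) = ennreal (S x) * ennreal (S x powr (p - 1))"
      using S0[of x] by (cases "S x = 0") (auto simp: powr_diff simp flip: ennreal_mult')
    also have "\<dots> \<le> (ennreal c * (\<integral>\<^sup>+\<omega>. ennreal (norm (X \<omega> x)) \<partial>\<Omega>)) * ennreal (S x powr (p - 1))"
      unfolding S_def X_def c_def by (intro mult_right_mono khintchine_lower R) auto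
    also have "\<dots> = ennreal c * (\<integral>\<^sup>+\<omega>. ennreal (norm (X \<omega> x)) * ennreal (S x powr (p - 1)) \<partial>\<Omega>)"
      by (subst nn_integral_multc) (auto simp: mult.assoc)
    finally show "ennreal (S x powr p) \<le> ennreal c * (\<integral>\<^sup>+\<omega>. ennreal (norm (X \<omega> x) * S x powr (p - 1)) \<partial>\<Omega>)"
      by (simp add: ennreal_mult')
  qed
  also have "\<dots> = ennreal c * (\<integral>\<^sup>+x. \<integral>\<^sup>+\<omega>. ennreal (norm (X \<omega> x) * S x powr (p - 1)) \<partial>\<Omega> \<partial>\<mu>)"
    by (intro nn_integral_cmult) measurable
  also have "(\<integral>\<^sup>+x. \<integral>\<^sup>+\<omega>. ennreal (norm (X \<omega> x) * S x powr (p - 1)) \<partial>\<Omega> \<partial>\<mu>)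
      = (\<integral>\<^sup>+\<omega>. \<integral>\<^sup>+x. ennreal (norm (X \<omega> x) * S x powr (p - 1)) \<partial>\<mu> \<partial>\<Omega>)"
    by (rule P.Fubini'[symmetric]) measurable
  also have "\<dots> \<le> (\<integral>\<^sup>+\<omega>. ennreal (V \<omega>) * ennreal (B powr (1 - 1 / p)) \<partial>\<Omega>)"
  proof (rule nn_integral_mono)
    fix \<omega> assume \<omega>: "\<omega> \<in> space \<Omega>"
    have "(\<integral>\<^sup>+x. ennreal (norm (X \<omega> x) * S x powr (p - 1)) \<partial>\<mu>) \<le> ennreal (N \<omega> powr (1 / p) * B powr (1 / p'))"
    proof (rule nn_integral_Holder[OF _ _ _ _ p p'(1,2) N0 B(2)])
      show "(\<integral>\<^sup>+x. ennreal (norm (X \<omega> x) powr p) \<partial>\<mu>) \<le> ennreal (N \<omega>)" using Nnn[OF \<omega>] by simp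
      show "(\<integral>\<^sup>+x. ennreal ((S x powr (p - 1)) powr p') \<partial>\<mu>) \<le> ennreal B"
        using B p by (simp add: powr_powr p'_def)
    qed auto
    then show "(\<integral>\<^sup>+x. ennreal (norm (X \<omega> x) * S x powr (p - 1)) \<partial>\<mu>) \<le> ennreal (V \<omega>) * ennreal (B powr (1 - 1 / p))"
      by (simp add: V_def p'(3) ennreal_mult')
  qed
  also have "\<dots> = (\<integral>\<^sup>+\<omega>. ennreal (V \<omega>) \<partial>\<Omega>) * ennreal (B powr (1 - 1 / p))" by (intro nn_integral_multc) measurable
  also have "\<dots> \<le> ennreal Z * ennreal (B powr (1 - 1 / p))" by (intro mult_right_mono VZ) simp
  finally have "ennreal B \<le> ennreal c * (ennreal Z * ennreal (B powr (1 - 1 / p)))"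
    by (simp add: mult_left_mono)
  \<comment> \<open>The factor \<open>1 powr (1 / p)\<close> brings the inequality into the form
    required by \<open>le_powr_self_bound\<close>.\<close>
  then have "B \<le> (c * Z) * (1 powr (1 / p) * B powr (1 - 1 / p))"
    using c Z0 by (simp add: mult.assoc flip: ennreal_mult')
  then have "B \<le> (c * Z) powr p * 1"
    using B c Z0 p by (intro le_powr_self_bound[where K = "c * Z"]) auto
  then have "ennreal B \<le> ennreal ((c * Z) powr p)" by (simp add: ennreal_leI)
  then show ?thesis
    unfolding B(1)[symmetric] by (simp add: S_def c_def Z_def V_def[abs_def] N_def X_def Lp_norm_def)
qed

(* The scalar sort {real_normed_field, euclidean_space} covers exactly the real and the complex
   scalars.  The first conclusion says that the integral defining S(t)f converges absolutely,
   so that S_op does not take the library's default value 0 of a divergent integral. *)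
theorem theorem7p7:
  fixes m \<alpha> \<beta> \<kappa> p q :: real
    and \<Omega> :: "'w measure" and \<epsilon> :: "nat \<Rightarrow> 'w \<Rightarrow> real"
  assumes "\<kappa> > 0" and "1 < p"
    and "\<alpha> < (real CARD('n::finite) + m) / p"
    and "(real CARD('n) + m) / p < real CARD('n) - \<beta>"
    and "1 \<le> q" and "rademacher_sequence \<Omega> \<epsilon>"
  shows "(\<forall>t>0. \<forall>f \<in> Lp_space (weighted_lborel m) p.
            AE y in weighted_lborel m.
              integrable lborel
                (S_integrand \<kappa> \<beta> t (f :: real ^ 'n \<Rightarrow> 'k::{real_normed_field, euclidean_space}) y))
       \<and> R_bounded_Lp \<Omega> \<epsilon> q (weighted_lborel m :: (real ^ 'n) measure) p
           ((S_op \<kappa> \<alpha> \<beta> :: real \<Rightarrow> (real ^ 'n \<Rightarrow> 'k) \<Rightarrow> real ^ 'n \<Rightarrow> 'k) ` {0<..})"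
proof -
  note p = assms(2) and q = assms(5) and R = assms(6)
  define \<mu> where "\<mu> = (weighted_lborel m :: (real ^ 'n) measure)"
  define L where "L = (Lp_space \<mu> p :: (real ^ 'n \<Rightarrow> 'k) set)"
  define S where "S = (S_op \<kappa> \<alpha> \<beta> :: real \<Rightarrow> (real ^ 'n \<Rightarrow> 'k) \<Rightarrow> real ^ 'n \<Rightarrow> 'k)"
  have sf: "sigma_finite_measure \<mu>" unfolding \<mu>_def by (rule sigma_finite_weighted_lborel)
  obtain C where C: "0 \<le> C" and sq: "\<And>(I :: nat set) t (f :: nat \<Rightarrow> real ^ 'n \<Rightarrow> 'k) B.
      finite I \<Longrightarrow> (\<And>i. i \<in> I \<Longrightarrow> 0 < t i) \<Longrightarrow> (\<And>i. i \<in> I \<Longrightarrow> f i \<in> borel_measurable borel) \<Longrightarrow> 0 \<le> B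
      \<Longrightarrow> (\<integral>\<^sup>+x. ennreal (L2_set (\<lambda>i. norm (f i x)) I powr p) \<partial>\<mu>) \<le> ennreal B
      \<Longrightarrow> (AE y in \<mu>. \<forall>i\<in>I. integrable lborel (S_integrand \<kappa> \<beta> (t i) (f i) y))
        \<and> (\<integral>\<^sup>+x. ennreal (L2_set (\<lambda>i. norm (S (t i) (f i) x)) I powr p) \<partial>\<mu>) \<le> ennreal (C * B)"
    using S_op_square_function[OF assms(1-4), where 'k = 'k] unfolding \<mu>_def S_def by blast
  have Lm: "f \<in> borel_measurable borel" if "f \<in> L" for f
    using that by (simp add: L_def Lp_space_def \<mu>_def)
  have single: "(AE y in \<mu>. integrable lborel (S_integrand \<kappa> \<beta> t f y)) \<and> S t f \<in> L
      \<and> (\<integral>x. norm (S t f x) powr p \<partial>\<mu>) \<le> C * (\<integral>x. norm (f x) powr p \<partial>\<mu>)"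
    if t: "0 < t" and f: "f \<in> L" for t f
  proof -
    have fi: "integrable \<mu> (\<lambda>x. norm (f x) powr p)" using f by (simp add: L_def Lp_space_def)
    \<comment> \<open>Boundedness of a single operator is the square function estimate for a family
      with one member.\<close>
    have "(\<integral>\<^sup>+x. ennreal (L2_set (\<lambda>i. norm (f x)) {0::nat} powr p) \<partial>\<mu>) \<le> ennreal (\<integral>x. norm (f x) powr p \<partial>\<mu>)"
      using fi by (simp add: L2_set_def nn_integral_eq_integral)
    from sq[of "{0}" "\<lambda>_. t" "\<lambda>_. f", OF _ _ _ _ this] t Lm[OF f]
    have 1: "AE y in \<mu>. integrable lborel (S_integrand \<kappa> \<beta> t f y)"
      and 2: "(\<integral>\<^sup>+x. ennreal (norm (S t f x) powr p) \<partial>\<mu>) \<le> ennreal (C * (\<integral>x. norm (f x) powr p \<partial>\<mu>))"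
      by (auto simp: L2_set_def)
    have Sm: "S t f \<in> borel_measurable \<mu>"
      using S_op_measurable[OF Lm[OF f]] by (simp add: S_def \<mu>_def)
    have "integrable \<mu> (\<lambda>x. norm (S t f x) powr p)"
      using Sm le_less_trans[OF 2 ennreal_less_top] by (intro integrableI_bounded) auto
    moreover have "(\<integral>x. norm (S t f x) powr p \<partial>\<mu>) \<le> C * (\<integral>x. norm (f x) powr p \<partial>\<mu>)"
      using 2 C by (intro integral_real_bounded) auto
    ultimately show ?thesis using 1 Sm by (simp add: L_def Lp_space_def)
  qed
  have lin: "bounded_linear_Lp \<mu> p (S t)" if t: "0 < t" for t
    unfolding bounded_linear_Lp_def L_def[symmetric]
  proof (intro conjI ballI allI)
    show "S t f \<in> L" if "f \<in> L" for f using single[OF t that] by blast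
    \<comment> \<open>Additivity holds where both integrals converge, hence only almost
      everywhere.\<close>
    show "AE x in \<mu>. S t (\<lambda>y. f y + g y) x = S t f x + S t g x" if "f \<in> L" "g \<in> L" for f g
    proof -
      have "AE y in \<mu>. integrable lborel (S_integrand \<kappa> \<beta> t f y)" "AE y in \<mu>. integrable lborel (S_integrand \<kappa> \<beta> t g y)"
        using single[OF t] that by blast+
      then show ?thesis
      proof eventually_elim
        case (elim y)
        have "S_integrand \<kappa> \<beta> t (\<lambda>y. f y + g y) y z = S_integrand \<kappa> \<beta> t f y z + S_integrand \<kappa> \<beta> t g y z" for z
          by (simp add: S_integrand_def scaleR_add_right)
        then show ?case using elim by (simp add: S_def S_op_def scaleR_add_right)
      qed
    qed
    \<comment> \<open>Homogeneity holds at every point: if the integral diverges, both sides take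
      the default value 0.\<close>
    show "AE x in \<mu>. S t (\<lambda>y. c * f y) x = c * S t f x" if "f \<in> L" for c f
    proof (rule AE_I2)
      fix y
      have "S_integrand \<kappa> \<beta> t (\<lambda>y. c * f y) y = (\<lambda>z. c * S_integrand \<kappa> \<beta> t f y z)"
        by (simp add: S_integrand_def fun_eq_iff)
      then show "S t (\<lambda>y. c * f y) y = c * S t f y" by (simp add: S_def S_op_def)
    qed
    show "\<exists>K. \<forall>f\<in>L. Lp_norm \<mu> p (S t f) \<le> K * Lp_norm \<mu> p f"
    proof (intro exI ballI)
      fix f assume f: "f \<in> L"
      have "(\<integral>x. norm (S t f x) powr p \<partial>\<mu>) powr (1 / p) \<le> (C * (\<integral>x. norm (f x) powr p \<partial>\<mu>)) powr (1 / p)"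
        using single[OF t f] p by (intro powr_mono2) auto
      then show "Lp_norm \<mu> p (S t f) \<le> C powr (1 / p) * Lp_norm \<mu> p f"
        using C by (simp add: Lp_norm_def powr_mult)
    qed
  qed
  \<comment> \<open>Any exponent above p and not below q would serve in the upper estimate.\<close>
  define r where "r = p + q"
  have r: "p < r" "q \<le> r" using p q by (auto simp: r_def)
  define K1 where "K1 = (1 + DIM('k) powr r * (DIM('k) * khintchine_const r)) powr (1 / q)"
  define K2 where "K2 = DIM('k) * (2 * sqrt (2 * khintchine_const 4))"
  have K2: "0 \<le> K2" by (simp add: K2_def khintchine_const_def)
  have "Lp_norm \<Omega> q (\<lambda>\<omega>. Lp_norm \<mu> p (\<lambda>x. \<Sum>i<n. \<epsilon> i \<omega> *\<^sub>R T i (f i) x))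
      \<le> K1 * C powr (1 / p) * K2 * Lp_norm \<Omega> q (\<lambda>\<omega>. Lp_norm \<mu> p (\<lambda>x. \<Sum>i<n. \<epsilon> i \<omega> *\<^sub>R f i x))"
    if T: "\<forall>i<n. T i \<in> S ` {0<..}" and f: "\<forall>i<n. f i \<in> L" for n :: nat and T f
  proof -
    have "\<forall>i. \<exists>t. i < n \<longrightarrow> 0 < t \<and> T i = S t" using T by auto
    then obtain t where t: "\<And>i. i < n \<Longrightarrow> 0 < t i \<and> T i = S (t i)" by metis
    define Z where "Z = Lp_norm \<Omega> q (\<lambda>\<omega>. Lp_norm \<mu> p (\<lambda>x. \<Sum>i<n. \<epsilon> i \<omega> *\<^sub>R f i x))"
    have Z: "0 \<le> Z" by (simp add: Z_def Lp_norm_def)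
    \<comment> \<open>From here the estimate runs from the random sum of the \<open>f i\<close> to
      their square function, to that of the \<open>T i (f i)\<close>, and back to a random
      sum.\<close>
    have "(\<integral>\<^sup>+x. ennreal (L2_set (\<lambda>i. norm (f i x)) {..<n} powr p) \<partial>\<mu>) \<le> ennreal ((K2 * Z) powr p)"
      unfolding K2_def Z_def using f by (intro rademacher_Lp_lower[OF R sf p q]) (auto simp: L_def)
    then have "(\<integral>\<^sup>+x. ennreal (L2_set (\<lambda>i. norm (S (t i) (f i) x)) {..<n} powr p) \<partial>\<mu>) \<le> ennreal (C * (K2 * Z) powr p)"
      using t f Lm sq[of "{..<n}" t f "(K2 * Z) powr p"] by auto
    also have "(\<integral>\<^sup>+x. ennreal (L2_set (\<lambda>i. norm (S (t i) (f i) x)) {..<n} powr p) \<partial>\<mu>)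
        = (\<integral>\<^sup>+x. ennreal (L2_set (\<lambda>i. norm (T i (f i) x)) {..<n} powr p) \<partial>\<mu>)"
      using t by (simp add: L2_set_def)
    finally have "Lp_norm \<Omega> q (\<lambda>\<omega>. Lp_norm \<mu> p (\<lambda>x. \<Sum>i<n. \<epsilon> i \<omega> *\<^sub>R T i (f i) x)) \<le> K1 * (C * (K2 * Z) powr p) powr (1 / p)"
      unfolding K1_def using t f single C
      by (intro rademacher_Lp_upper[OF R sf p q r]) (auto simp: L_def)
    also have "(C * (K2 * Z) powr p) powr (1 / p) = C powr (1 / p) * (K2 * Z)"
      using C K2 Z p by (simp add: powr_mult powr_powr)
    finally show ?thesis by (simp add: Z_def mult.assoc)
  qed
  then have "R_bounded_Lp \<Omega> \<epsilon> q \<mu> p (S ` {0<..})"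
    unfolding R_bounded_Lp_def L_def[symmetric] using lin by blast
  moreover have "\<forall>t>0. \<forall>f\<in>L. AE y in \<mu>. integrable lborel (S_integrand \<kappa> \<beta> t f y)"
    using single by blast
  ultimately show ?thesis unfolding L_def S_def \<mu>_def by blast
qed

end
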